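(* Let $X$ be a (reduced, irreducible) smooth projective curve over an algebraically closed field $k$ of characteristic $p \ge 0$, and let $\varphi: X \to \mathbb{P}^2$ be a morphism that is birational onto its image. Let $P_1,P_2,P_3\in X$ be such that $\varphi(P_1)$, $\varphi(P_2)$ and $\varphi(P_3)$ are different inner Galois points for $\varphi(X)$, and let $\sigma \in G_{\varphi(P_1)}$ satisfy $\sigma(P_2)=P_3$. If $\varphi(P_1)$, $\varphi(P_2)$ and $\varphi(P_3)$ are total inflection points of $\varphi(X)$, then there exists a linear transformation $\tilde{\sigma}$ of $\mathbb{P}^2$ such that $\varphi^{-1}\circ\tilde{\sigma}\circ\varphi=\sigma$.
   Context: A point $P \in \mathbb{P}^2$ is called a Galois point for $\varphi(X)$ if the extension of function fields $k(\varphi(X))/\pi_P^*k(\mathbb{P}^1)$ induced by the projection $\pi_P: \varphi(X) \dashrightarrow \mathbb{P}^1$ from $P$ is a Galois extension. A Galois point $P$ is inner if $P \in \varphi(X)\setminus \mathrm{Sing}(\varphi(X))$. For a Galois point $P$, $G_P$ denotes the Galois group of this extension, regarded via $k(X)=k(\varphi(X))$ as a subgroup of $\mathrm{Aut}(X)$. A smooth point of $\varphi(X)$ is a total inflection point if the tangent line there meets $\varphi(X)$ at that point with intersection multiplicity equal to $\deg\varphi(X)$. A linear transformation of $\mathbb{P}^2$ is an element of $\mathrm{PGL}(3,k)$; the equality $\varphi^{-1}\circ\tilde{\sigma}\circ\varphi=\sigma$ (with $\varphi^{-1}$ the birational inverse $\varphi(X)\dashrightarrow X$) means that $\tilde\sigma$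 preserves $\varphi(X)$ and $\tilde\sigma\circ\varphi=\varphi\circ\sigma$. *)

theory Defs
  imports "HOL-Library.Poly_Mapping" "HOL-Library.Numeral_Type"
    "HOL-Computational_Algebra.Polynomial" "HOL-Computational_Algebra.Factorial_Ring"
    "HOL-Algebra.Embedded_Algebras" "HOL-Algebra.QuotRing"
    "HOL-Analysis.Cartesian_Space" "HOL-Analysis.Abstract_Topology_2"
begin

section \<open>Forms\<close>

text \<open>
  Polynomials over \<open>'k\<close> in variables indexed by the finite type \<open>'n\<close>, as finitely supported
  functions on exponent vectors.
\<close>

type_synonym ('k, 'n) mpol = "('n \<Rightarrow>\<^sub>0 nat) \<Rightarrow>\<^sub>0 'k"

definition mono_eval :: "('n::finite \<Rightarrow>\<^sub>0 nat) \<Rightarrow> 'k::field ^ 'n \<Rightarrow> 'k" where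
  "mono_eval m v = (\<Prod>i\<in>UNIV. (v $ i) ^ Poly_Mapping.lookup m i)"

definition mp_eval :: "('k::field, 'n::finite) mpol \<Rightarrow> 'k ^ 'n \<Rightarrow> 'k" where
  "mp_eval F v = (\<Sum>m\<in>Poly_Mapping.keys F. Poly_Mapping.lookup F m * mono_eval m v)"

definition mp_deriv :: "'n \<Rightarrow> ('k::field, 'n::finite) mpol \<Rightarrow> ('k, 'n) mpol" where
  "mp_deriv i F = (\<Sum>m\<in>Poly_Mapping.keys F.
     Poly_Mapping.single (m - Poly_Mapping.single i 1)
       (of_nat (Poly_Mapping.lookup m i) * Poly_Mapping.lookup F m))"

text \<open>The zero polynomial is homogeneous of every degree.\<close>

definition homogeneous :: "nat \<Rightarrow> ('k::field, 'n::finite) mpol \<Rightarrow> bool" where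
  "homogeneous d F \<longleftrightarrow> (\<forall>m\<in>Poly_Mapping.keys F. (\<Sum>i\<in>UNIV. Poly_Mapping.lookup m i) = d)"

lemma mp_eval_superset:
  assumes "finite A" "Poly_Mapping.keys F \<subseteq> A"
  shows "mp_eval F v = (\<Sum>m\<in>A. Poly_Mapping.lookup F m * mono_eval m v)"
  unfolding mp_eval_def using assms
  by (intro sum.mono_neutral_left) (auto simp: in_keys_iff)

lemma mp_eval_zero [simp]: "mp_eval 0 v = 0"
  by (simp add: mp_eval_def)

lemma mp_eval_one [simp]: "mp_eval 1 v = 1"
  by (simp add: mp_eval_def mono_eval_def lookup_one)

lemma mono_eval_add: "mono_eval (m + m') v = mono_eval m v * mono_eval m' v"
  by (simp add: mono_eval_def lookup_add power_add prod.distrib)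

lemma mp_eval_add: "mp_eval (F + G) v = mp_eval F v + mp_eval G v"
proof -
  let ?A = "Poly_Mapping.keys F \<union> Poly_Mapping.keys G"
  have "mp_eval (F + G) v = (\<Sum>m\<in>?A. Poly_Mapping.lookup (F + G) m * mono_eval m v)"
    by (rule mp_eval_superset) (auto simp: Poly_Mapping.keys_add)
  also have "\<dots> = (\<Sum>m\<in>?A. Poly_Mapping.lookup F m * mono_eval m v) + (\<Sum>m\<in>?A. Poly_Mapping.lookup G m * mono_eval m v)"
    by (simp add: lookup_add distrib_right sum.distrib)
  also have "\<dots> = mp_eval F v + mp_eval G v"
    by (simp add: mp_eval_superset[of ?A F] mp_eval_superset[of ?A G])
  finally show ?thesis .
qed

lemma mp_eval_sum: "mp_eval (sum f A) v = (\<Sum>a\<in>A. mp_eval (f a) v)"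
  by (induction A rule: infinite_finite_induct) (auto simp: mp_eval_add)

lemma mp_eval_single: "mp_eval (Poly_Mapping.single m c) v = c * mono_eval m v"
  by (simp add: mp_eval_superset[of "{m}"])

lemma mp_expand: "F = (\<Sum>m\<in>Poly_Mapping.keys F. Poly_Mapping.single m (Poly_Mapping.lookup F m))"
  for F :: "('a \<Rightarrow>\<^sub>0 'b::comm_monoid_add)"
proof (rule poly_mapping_eqI)
  fix k
  have "Poly_Mapping.lookup (\<Sum>m\<in>Poly_Mapping.keys F. Poly_Mapping.single m (Poly_Mapping.lookup F m)) k
      = (\<Sum>m\<in>Poly_Mapping.keys F. Poly_Mapping.lookup (Poly_Mapping.single m (Poly_Mapping.lookup F m)) k)"
    by (simp add: lookup_sum)
  also have "\<dots> = (\<Sum>m\<in>Poly_Mapping.keys F. if m = k then Poly_Mapping.lookup F k else 0)"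
    by (intro sum.cong) (auto simp: lookup_single when_def)
  also have "\<dots> = Poly_Mapping.lookup F k"
    by (simp add: in_keys_iff)
  finally show "Poly_Mapping.lookup F k =
      Poly_Mapping.lookup (\<Sum>m\<in>Poly_Mapping.keys F. Poly_Mapping.single m (Poly_Mapping.lookup F m)) k"
    by (rule sym)
qed

lemma mp_eval_mult: "mp_eval (F * G) v = mp_eval F v * mp_eval G v"
proof -
  have "F * G = (\<Sum>m\<in>Poly_Mapping.keys F. \<Sum>m'\<in>Poly_Mapping.keys G.
      Poly_Mapping.single (m + m') (Poly_Mapping.lookup F m * Poly_Mapping.lookup G m'))"
    using arg_cong2[of _ _ _ _ "(*)", OF mp_expand[of F] mp_expand[of G]]
    unfolding sum_product mult_single .
  then have "mp_eval (F * G) v = (\<Sum>m\<in>Poly_Mapping.keys F. \<Sum>m'\<in>Poly_Mapping.keys G.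
      (Poly_Mapping.lookup F m * mono_eval m v) * (Poly_Mapping.lookup G m' * mono_eval m' v))"
    by (simp only: mp_eval_sum mp_eval_single mono_eval_add mult_ac)
  then show ?thesis
    unfolding mp_eval_def sum_product .
qed

lemma homogeneous_mult:
  assumes "homogeneous d F" "homogeneous e G"
  shows "homogeneous (d + e) (F * G)"
  unfolding homogeneous_def
proof
  fix m assume "m \<in> Poly_Mapping.keys (F * G)"
  then obtain a b where "a \<in> Poly_Mapping.keys F" "b \<in> Poly_Mapping.keys G" "m = a + b"
    using keys_mult[of F G] by blast
  with assms show "(\<Sum>i\<in>UNIV. Poly_Mapping.lookup m i) = d + e"
    by (simp add: homogeneous_def lookup_add sum.distrib)
qed

section \<open>Projective space and its Zariski topology\<close>

text \<open>
  The points of the projective space of dimension \<open>CARD('n) - 1\<close> are the one-dimensional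
  subspaces of \<open>'k ^ 'n\<close>.
\<close>

typedef (overloaded) ('k::field, 'n::finite) proj =
  "{vec.span {v} | v :: 'k ^ 'n. v \<noteq> 0}"
proof -
  have "(\<chi> i. 1) \<noteq> (0 :: 'k ^ 'n)"
    by (simp add: vec_eq_iff)
  then show ?thesis by blast
qed

text \<open>Homogeneous coordinates of a point; only used where the choice does not matter.\<close>

definition coords :: "('k::field, 'n::finite) proj \<Rightarrow> 'k ^ 'n" where
  "coords P = (SOME v. v \<in> Rep_proj P \<and> v \<noteq> 0)"

text \<open>The map induced by \<open>A\<close>; only meaningful at points not contained in the kernel of \<open>A\<close>.\<close>

definition proj_map :: "'k::field ^ 'n::finite ^ 'm::finite \<Rightarrow> ('k, 'n) proj \<Rightarrow> ('k, 'm) proj" where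
  "proj_map A P = Abs_proj ((*v) A ` Rep_proj P)"

definition zeros :: "('k::field, 'n::finite) mpol set \<Rightarrow> ('k, 'n) proj set" where
  "zeros S = {P. \<forall>F\<in>S. mp_eval F (coords P) = 0}"

definition forms :: "('k::field, 'n::finite) mpol set" where
  "forms = {F. \<exists>d. homogeneous d F}"

instantiation proj :: (field, finite) topological_space
begin

definition open_proj :: "('a, 'b) proj set \<Rightarrow> bool" where
  "open_proj U \<longleftrightarrow> (\<exists>S\<subseteq>forms. - U = zeros S)"

instance
proof
  show "open (UNIV :: ('a, 'b) proj set)"
    unfolding open_proj_def
    by (intro exI[of _ "{1}"]) (auto simp: zeros_def forms_def homogeneous_def)
next
  fix U V :: "('a, 'b) proj set"
  assume "open U" "open V"
  then obtain S T where S: "S \<subseteq> forms" "- U = zeros S" and T: "T \<subseteq> forms" "- V = zeros T"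
    unfolding open_proj_def by blast
  have "- (U \<inter> V) = zeros S \<union> zeros T"
    by (simp only: Compl_Int S(2) T(2))
  also have "\<dots> = zeros {F * G | F G. F \<in> S \<and> G \<in> T}"
  proof
    show "zeros S \<union> zeros T \<subseteq> zeros {F * G | F G. F \<in> S \<and> G \<in> T}"
      by (auto simp: zeros_def mp_eval_mult)
    show "zeros {F * G | F G. F \<in> S \<and> G \<in> T} \<subseteq> zeros S \<union> zeros T"
    proof
      fix P assume P: "P \<in> zeros {F * G | F G. F \<in> S \<and> G \<in> T}"
      have "mp_eval F (coords P) * mp_eval G (coords P) = 0" if "F \<in> S" "G \<in> T" for F G
        using P that unfolding zeros_def mp_eval_mult[symmetric] by blast
      then show "P \<in> zeros S \<union> zeros T"
        unfolding zeros_def mult_eq_0_iff by blast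
    qed
  qed
  finally have "- (U \<inter> V) = zeros {F * G | F G. F \<in> S \<and> G \<in> T}" .
  moreover have "{F * G | F G. F \<in> S \<and> G \<in> T} \<subseteq> forms"
    using S(1) T(1) homogeneous_mult unfolding forms_def by blast
  ultimately show "open (U \<inter> V)"
    unfolding open_proj_def by blast
next
  fix K :: "('a, 'b) proj set set"
  assume "\<forall>U\<in>K. open U"
  then have "\<forall>U\<in>K. \<exists>S. S \<subseteq> forms \<and> - U = zeros S"
    unfolding open_proj_def by blast
  then obtain S where S: "\<forall>U\<in>K. S U \<subseteq> forms \<and> - U = zeros (S U)"
    by (rule bchoice[THEN exE])
  have "- \<Union>K = (\<Inter>U\<in>K. - U)"
    by blast
  also have "\<dots> = (\<Inter>U\<in>K. zeros (S U))"
    using S by (intro INF_cong) simp_all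
  also have "\<dots> = zeros (\<Union>U\<in>K. S U)"
    by (auto simp: zeros_def)
  finally have "- \<Union>K = zeros (\<Union>U\<in>K. S U)" .
  moreover have "(\<Union>U\<in>K. S U) \<subseteq> forms"
    using S by blast
  ultimately show "open (\<Union>K)"
    unfolding open_proj_def by blast
qed

end

section \<open>Varieties, smoothness, morphisms\<close>

definition zariski_irreducible :: "('k::field, 'n::finite) proj set \<Rightarrow> bool" where
  "zariski_irreducible V \<longleftrightarrow> V \<noteq> {} \<and>
     (\<forall>A B. closed A \<and> closed B \<and> V \<subseteq> A \<union> B \<longrightarrow> V \<subseteq> A \<or> V \<subseteq> B)"

definition variety :: "('k::field, 'n::finite) proj set \<Rightarrow> bool" where
  "variety V \<longleftrightarrow> closed V \<and> zariski_irreducible V"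

definition variety_chain :: "('k::field, 'n::finite) proj set \<Rightarrow> nat \<Rightarrow> bool" where
  "variety_chain V d \<longleftrightarrow> (\<exists>Z :: nat \<Rightarrow> ('k, 'n) proj set.
     (\<forall>i\<le>d. variety (Z i) \<and> Z i \<subseteq> V) \<and> (\<forall>i<d. Z i \<subset> Z (Suc i)))"

definition has_dim :: "('k::field, 'n::finite) proj set \<Rightarrow> nat \<Rightarrow> bool" where
  "has_dim V d \<longleftrightarrow> variety_chain V d \<and> \<not> variety_chain V (Suc d)"

definition curve :: "('k::field, 'n::finite) proj set \<Rightarrow> bool" where
  "curve X \<longleftrightarrow> variety X \<and> has_dim X 1"

text \<open>
  The linear subspace whose projectivization is the embedded projective tangent space of
  \<open>V\<close> at \<open>P\<close>; the forms range over the whole homogeneous ideal of \<open>V\<close>.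
\<close>

definition tangent_space :: "('k::field, 'n::finite) proj set \<Rightarrow> ('k, 'n) proj \<Rightarrow> ('k ^ 'n) set" where
  "tangent_space V P = {v. \<forall>F\<in>forms. V \<subseteq> zeros {F} \<longrightarrow>
     (\<Sum>i\<in>UNIV. mp_eval (mp_deriv i F) (coords P) * v $ i) = 0}"

text \<open>The Jacobian criterion: the projective tangent space has the dimension of \<open>V\<close>.\<close>

definition smooth_at :: "('k::field, 'n::finite) proj set \<Rightarrow> ('k, 'n) proj \<Rightarrow> bool" where
  "smooth_at V P \<longleftrightarrow> P \<in> V \<and> (\<exists>d. has_dim V d \<and> vec.dim (tangent_space V P) = d + 1)"

definition Sing :: "('k::field, 'n::finite) proj set \<Rightarrow> ('k, 'n) proj set" where
  "Sing V = {P \<in> V. \<not> smooth_at V P}"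

definition smooth_curve :: "('k::field, 'n::finite) proj set \<Rightarrow> bool" where
  "smooth_curve X \<longleftrightarrow> curve X \<and> Sing X = {}"

definition regular_on :: "('k::field, 'n::finite) proj set \<Rightarrow> (('k, 'n) proj \<Rightarrow> 'k) \<Rightarrow> bool" where
  "regular_on U f \<longleftrightarrow> (\<forall>P\<in>U. \<exists>W d F G. openin (top_of_set U) W \<and> P \<in> W \<and>
     homogeneous d F \<and> homogeneous d G \<and>
     (\<forall>Q\<in>W. mp_eval G (coords Q) \<noteq> 0 \<and> f Q = mp_eval F (coords Q) / mp_eval G (coords Q)))"

definition morphism :: "('k::field, 'n::finite) proj set \<Rightarrow> ('k, 'm::finite) proj set \<Rightarrow>
    (('k, 'n) proj \<Rightarrow> ('k, 'm) proj) \<Rightarrow> bool" where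
  "morphism V W \<phi> \<longleftrightarrow> \<phi> \<in> V \<rightarrow> W \<and> continuous_on V \<phi> \<and>
     (\<forall>U f. openin (top_of_set W) U \<and> regular_on U f \<longrightarrow> regular_on (V \<inter> \<phi> -` U) (f \<circ> \<phi>))"

text \<open>Elements are functions on all of projective space; only their restriction to \<open>X\<close> matters.\<close>

definition automorphisms :: "('k::field, 'n::finite) proj set \<Rightarrow>
    (('k, 'n) proj \<Rightarrow> ('k, 'n) proj) set" where
  "automorphisms X = {\<sigma>. morphism X X \<sigma> \<and>
     (\<exists>\<rho>. morphism X X \<rho> \<and> (\<forall>P\<in>X. \<rho> (\<sigma> P) = P \<and> \<sigma> (\<rho> P) = P))}"

text \<open>There is a rational inverse, defined on a nonempty open subset of the image.\<close>

definition birational_onto_image :: "('k::field, 'n::finite) proj set \<Rightarrow>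
    (('k, 'n) proj \<Rightarrow> ('k, 'm::finite) proj) \<Rightarrow> bool" where
  "birational_onto_image X \<phi> \<longleftrightarrow> (\<exists>W \<psi>. openin (top_of_set (\<phi> ` X)) W \<and> W \<noteq> {} \<and>
     morphism W X \<psi> \<and> (\<forall>Q\<in>W. \<phi> (\<psi> Q) = Q) \<and> (\<forall>P\<in>X. \<phi> P \<in> W \<longrightarrow> \<psi> (\<phi> P) = P))"

section \<open>Function fields and local rings\<close>

text \<open>
  A pair of a nonempty open subset \<open>U\<close> of \<open>V\<close> and a regular function on \<open>U\<close> is encoded as a
  partial function with domain \<open>U\<close>. Rational functions are classes of such pairs, two of them
  being identified if they agree on the intersection of their domains (an equivalence relation
  for irreducible \<open>V\<close>).
\<close>

type_synonym ('k, 'n) pfun = "('k, 'n) proj \<Rightarrow> 'k option"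

definition rat_reps :: "('k::field, 'n::finite) proj set \<Rightarrow> ('k, 'n) pfun set" where
  "rat_reps V = {f. openin (top_of_set V) (dom f) \<and> dom f \<noteq> {} \<and> regular_on (dom f) (the \<circ> f)}"

definition rat_rel :: "('k::field, 'n::finite) proj set \<Rightarrow> ('k, 'n) pfun rel" where
  "rat_rel V = {(f, g). f \<in> rat_reps V \<and> g \<in> rat_reps V \<and> (\<forall>P\<in>dom f \<inter> dom g. f P = g P)}"

definition pointwise :: "('k \<Rightarrow> 'k \<Rightarrow> 'k) \<Rightarrow> ('k::field, 'n::finite) pfun \<Rightarrow> ('k, 'n) pfun \<Rightarrow> ('k, 'n) pfun" where
  "pointwise h f g = (\<lambda>P. if P \<in> dom f \<inter> dom g then Some (h (the (f P)) (the (g P))) else None)"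

definition rat_op :: "('k \<Rightarrow> 'k \<Rightarrow> 'k) \<Rightarrow> ('k::field, 'n::finite) proj set \<Rightarrow>
    ('k, 'n) pfun set \<Rightarrow> ('k, 'n) pfun set \<Rightarrow> ('k, 'n) pfun set" where
  "rat_op h V a b = (\<Union>f\<in>a. \<Union>g\<in>b. rat_rel V `` {pointwise h f g})"

definition rat_const :: "('k::field, 'n::finite) proj set \<Rightarrow> 'k \<Rightarrow> ('k, 'n) pfun set" where
  "rat_const V c = rat_rel V `` {(\<lambda>_. Some c) |` V}"

definition function_field :: "('k::field, 'n::finite) proj set \<Rightarrow> ('k, 'n) pfun set ring" where
  "function_field V = \<lparr>carrier = rat_reps V // rat_rel V, mult = rat_op (*) V,
     one = rat_const V 1, zero = rat_const V 0, add = rat_op (+) V\<rparr>"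

text \<open>
  Pullback of rational functions along a dominant rational map from \<open>V\<close> that is given by
  \<open>\<phi>\<close> on the open subset \<open>W\<close> of \<open>V\<close>.
\<close>

definition pullback :: "('k::field, 'n::finite) proj set \<Rightarrow> ('k, 'n) proj set \<Rightarrow>
    (('k, 'n) proj \<Rightarrow> ('k, 'm::finite) proj) \<Rightarrow> ('k, 'm) pfun set \<Rightarrow> ('k, 'n) pfun set" where
  "pullback V W \<phi> a = (\<Union>f\<in>a. rat_rel V `` {(f \<circ> \<phi>) |` W})"

definition local_ring :: "('k::field, 'n::finite) proj set \<Rightarrow> ('k, 'n) proj \<Rightarrow> ('k, 'n) pfun set ring" where
  "local_ring V Q = (function_field V)
     \<lparr>carrier := {a \<in> carrier (function_field V). \<exists>f\<in>a. Q \<in> dom f}\<rparr>"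

section \<open>Plane curves\<close>

definition defining_form :: "('k::field, 'n::finite) proj set \<Rightarrow> nat \<Rightarrow> ('k, 'n) mpol \<Rightarrow> bool" where
  "defining_form C d F \<longleftrightarrow> homogeneous d F \<and> Factorial_Ring.irreducible F \<and> C = zeros {F}"

text \<open>
  The local equations at \<open>Q\<close> of the curve given by a form: the germs \<open>F / H\<close> with \<open>H\<close> a form of
  the same degree that does not vanish at \<open>Q\<close> (they are associated in the local ring at \<open>Q\<close>).
\<close>

definition local_equations :: "('k::field, 'n::finite) proj \<Rightarrow> ('k, 'n) mpol \<Rightarrow> ('k, 'n) pfun set set" where
  "local_equations Q F =
     {rat_rel UNIV `` {\<lambda>P. if mp_eval H (coords P) \<noteq> 0
          then Some (mp_eval F (coords P) / mp_eval H (coords P)) else None} | H d.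
        homogeneous d F \<and> homogeneous d H \<and> mp_eval H (coords Q) \<noteq> 0}"

text \<open>The intersection multiplicity at \<open>Q\<close> is finite and equal to \<open>m\<close>: the quotient of the
  local ring of the plane at \<open>Q\<close> by the two local equations has dimension \<open>m\<close> over the constants.\<close>

definition intersection_mult :: "('k::field, 3) mpol \<Rightarrow> ('k, 3) mpol \<Rightarrow> ('k, 3) proj \<Rightarrow> nat \<Rightarrow> bool" where
  "intersection_mult F G Q m \<longleftrightarrow>
     (let R = local_ring UNIV Q;
          I = Idl\<^bsub>R\<^esub> (local_equations Q F \<union> local_equations Q G)
      in ring.dimension (R Quot I) m (range (\<lambda>c. I +>\<^bsub>R\<^esub> rat_const UNIV c)) (carrier (R Quot I)))"

definition tangent_line :: "('k::field, 3) proj set \<Rightarrow> ('k, 3) proj \<Rightarrow> ('k, 3) proj set" where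
  "tangent_line C Q = {R. Rep_proj R \<subseteq> tangent_space C Q}"

text \<open>Here \<open>d\<close> is the degree of \<open>C\<close> and \<open>L\<close> is the linear form defining the tangent line.\<close>

definition total_inflection_point :: "('k::field, 3) proj set \<Rightarrow> ('k, 3) proj \<Rightarrow> bool" where
  "total_inflection_point C Q \<longleftrightarrow> smooth_at C Q \<and>
     (\<exists>d F L. defining_form C d F \<and> defining_form (tangent_line C Q) 1 L \<and>
        intersection_mult F L Q d)"

section \<open>Galois points\<close>

definition galois_group :: "('a, 'b) ring_scheme \<Rightarrow> 'a set \<Rightarrow> ('a \<Rightarrow> 'a) set" where
  "galois_group L K = {\<tau> \<in> ring_iso L L. \<forall>x\<in>K. \<tau> x = x}"

definition galois_extension :: "('a, 'b) ring_scheme \<Rightarrow> 'a set \<Rightarrow> bool" where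
  "galois_extension L K \<longleftrightarrow> field L \<and> subfield K L \<and> ring.finite_dimension L K (carrier L) \<and>
     {x \<in> carrier L. \<forall>\<tau>\<in>galois_group L K. \<tau> x = x} = K"

text \<open>
  A matrix \<open>A\<close> of rank two whose kernel is the point \<open>P\<close> gives the projection from \<open>P\<close>; two such
  matrices differ by an automorphism of the projective line.
\<close>

definition projection_from :: "('k::field, 3) proj \<Rightarrow> 'k ^ 3 ^ 2 \<Rightarrow> bool" where
  "projection_from P A \<longleftrightarrow> {v. A *v v = 0} = Rep_proj P"

definition projection_subfield :: "('k::field, 3) proj set \<Rightarrow> 'k ^ 3 ^ 2 \<Rightarrow> ('k, 3) proj \<Rightarrow>
    ('k, 3) pfun set set" where
  "projection_subfield C A P =
     pullback C (C - {P}) (proj_map A) ` carrier (function_field (UNIV :: ('k, 2) proj set))"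

definition galois_point :: "('k::field, 3) proj set \<Rightarrow> ('k, 3) proj \<Rightarrow> bool" where
  "galois_point C P \<longleftrightarrow> (\<exists>A. projection_from P A \<and> closure (proj_map A ` (C - {P})) = UNIV \<and>
     galois_extension (function_field C) (projection_subfield C A P))"

definition inner_galois_point :: "('k::field, 3) proj set \<Rightarrow> ('k, 3) proj \<Rightarrow> bool" where
  "inner_galois_point C P \<longleftrightarrow> galois_point C P \<and> P \<in> C - Sing C"

text \<open>
  The Galois group at \<open>P\<close> as a set of automorphisms of \<open>X\<close>: those which correspond, under the
  isomorphism \<open>\<phi>\<^sup>*\<close> of function fields, to elements of the Galois group.
\<close>

definition point_group :: "('k::field, 'n::finite) proj set \<Rightarrow>
    (('k, 'n) proj \<Rightarrow> ('k, 3) proj) \<Rightarrow> ('k, 3) proj \<Rightarrow> (('k, 'n) proj \<Rightarrow> ('k, 'n) proj) set" where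
  "point_group X \<phi> P = {\<sigma> \<in> automorphisms X. \<exists>A. projection_from P A \<and>
     (\<exists>\<tau>\<in>galois_group (function_field (\<phi> ` X)) (projection_subfield (\<phi> ` X) A P).
        \<forall>a\<in>carrier (function_field (\<phi> ` X)).
          pullback X X \<sigma> (pullback X X \<phi> a) = pullback X X \<phi> (\<tau> a))}"

end

theory Submission
  imports Defs
begin

text \<open>
  Let \<open>d = e + 1\<close> be the degree of the curve and \<open>Q\<^sub>i = \<phi>(P\<^sub>i)\<close>. Choose coordinates in which \<open>Q\<^sub>1\<close>
  and \<open>Q\<^sub>2\<close> are \<open>(0 : 1 : 0)\<close> and \<open>(0 : 0 : 1)\<close> and their tangent lines are \<open>z = 0\<close> and \<open>y = 0\<close>. As an
  element of the Galois group at \<open>Q\<^sub>1\<close>, \<open>\<sigma>\<close> fixes the function \<open>x\<close>; let \<open>y'\<close> be the image of \<open>y\<close>.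
  Since \<open>\<sigma>\<close> maps \<open>P\<^sub>2\<close> to \<open>P\<^sub>3\<close>, the point \<open>Q\<^sub>3\<close> lies on \<open>x = 0\<close>; let \<open>y + \<alpha> x + \<beta> = 0\<close> be its tangent line.

  Total inflection at \<open>Q\<^sub>2\<close> and \<open>Q\<^sub>3\<close> gives the equation \<open>f\<close> of the curve the two forms
  \<open>c\<^sub>2 x\<^sup>d + y h\<^sub>2 = c\<^sub>3 x\<^sup>d + (y + \<alpha> x + \<beta>) h\<^sub>3\<close>, so that \<open>y\<close> and \<open>u = y' + \<alpha> x + \<beta>\<close> both divide \<open>x\<^sup>d\<close>,
  with cofactors that do not vanish at \<open>P\<^sub>2\<close>. Hence \<open>w = u / y\<close> is regular on the affine part of the
  curve, and integral over its coordinate ring. By total inflection at \<open>Q\<^sub>1\<close> there is one place at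
  infinity, where \<open>x\<close> and \<open>y\<close> have poles of order \<open>e\<close> and \<open>d\<close>, and \<open>y'\<close> has the same order as \<open>y\<close>; so \<open>w\<close>
  has no pole there either and is a constant. Therefore \<open>y'\<close> is a linear function of \<open>x\<close> and \<open>y\<close>.

  Orders of poles are replaced by weighted degrees with \<open>x\<close> of weight \<open>e\<close> and \<open>y\<close> of weight \<open>d\<close>: powers
  of \<open>w\<close>, multiplied by a fixed denominator, stay in a finite-dimensional space of polynomials,
  so \<open>w\<close> is algebraic over the field of constants.
\<close>

text \<open>The image curve may be singular, so k[x, y] on it need not be integrally closed: w is
  integral without being a polynomial in x and y. What is available is w = a y' + b with a, b in
  k[x, y], and y' = V / g with g nonzero at P_2. As \<kappa> y^e is the only monomial of y-degree e
  in f, y' satisfies an equation of degree e over k[x] with constant leading coefficient; so all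
  powers of w reduce to 1, y', ..., y'^(e-1), and the single denominator g^e serves for all of them.
  That g(P_2) \<noteq> 0 is possible comes from smoothness at Q_2, where x is a uniformizer; it
  makes the cofactor of u, times a power of g, a unit modulo y, because x^d is a multiple of y.

  The weights come from the shape of f: smoothness at Q_1 makes \<kappa> nonzero, total inflection
  there leaves c x^(e+1) as the only term of degree d, and with weights e and e + 1 these two terms
  are the leading part of f. It vanishes at (1, \<zeta>) if \<kappa> \<zeta>^e + c = 0, which
  describes the place at infinity without power series and in every characteristic.\<close>

hide_const (open) UnivPoly.coeff UnivPoly.monom Module.smult

section \<open>Polynomials in two variables\<close>

text \<open>Over a finite field, 1 plus the product of all X - x takes the value 1 everywhere, so it
  is a polynomial of positive degree without a root.\<close>

lemma infinite_alg_closed_field: "infinite (UNIV :: 'k::alg_closed_field set)"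
proof
  assume fin: "finite (UNIV :: 'k set)"
  define p :: "'k poly" where "p = 1 + (\<Prod>x\<in>UNIV. [:-x, 1:])"
  have deg: "degree (\<Prod>x\<in>(UNIV::'k set). [:-x, 1:]) = card (UNIV :: 'k set)"
    by (subst degree_prod_eq_sum_degree) auto
  have "0 < card (UNIV :: 'k set)"
    using fin by (simp add: card_gt_0_iff)
  then have "degree p > 0"
    unfolding p_def using deg by (subst degree_add_eq_right) auto
  then obtain x where "poly p x = 0"
    using alg_closed_imp_poly_has_root by blast
  moreover have "poly p x = 1"
    unfolding p_def using fin by (auto simp: poly_prod intro!: prod_zero)
  ultimately show False by simp
qed

lemma poly_eq_0I_infinite:
  fixes p :: "'k::idom poly"
  assumes "infinite A" "\<And>x. x \<in> A \<Longrightarrow> poly p x = 0"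
  shows "p = 0"
proof (rule ccontr)
  assume "p \<noteq> 0"
  then have "finite {x. poly p x = 0}"
    by (rule poly_roots_finite)
  moreover have "A \<subseteq> {x. poly p x = 0}"
    using assms(2) by auto
  ultimately show False
    using assms(1) finite_subset by blast
qed

lemma poly_eqI_alg_closed:
  fixes p q :: "'k::alg_closed_field poly"
  assumes "\<And>x. poly p x = poly q x"
  shows "p = q"
  using poly_eq_0I_infinite[OF infinite_alg_closed_field, of "p - q"] assms by auto

lemma infinite_nonzero: "infinite {x :: 'k::alg_closed_field. x \<noteq> 0}"
proof -
  have "UNIV = insert 0 {x :: 'k. x \<noteq> 0}" by auto
  then show ?thesis
    using infinite_alg_closed_field[where 'k='k] by (metis finite_insert)
qed

text \<open>The outer variable is y and the inner one x, so pseudo-division lowers the degree in y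
  at the price of factors in k[x]. The abbreviation \<open>cf\<close> restores the usual order of
  exponents: \<open>cf a i j\<close> belongs to x^i y^j.\<close>

definition ev2 :: "'k::comm_ring_1 poly poly \<Rightarrow> 'k \<Rightarrow> 'k \<Rightarrow> 'k" where
  "ev2 a x y = poly (poly a [:y:]) x"

abbreviation cf :: "'k::zero poly poly \<Rightarrow> nat \<Rightarrow> nat \<Rightarrow> 'k" where
  "cf a i j \<equiv> coeff (coeff a j) i"

lemma ev2_simps [simp]:
  "ev2 0 x y = 0" "ev2 1 x y = 1"
  "ev2 (a + b) x y = ev2 a x y + ev2 b x y"
  "ev2 (a - b) x y = ev2 a x y - ev2 b x y"
  "ev2 (- a) x y = - ev2 a x y"
  "ev2 (a * b) x y = ev2 a x y * ev2 b x y"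
  "ev2 (a ^ n) x y = ev2 a x y ^ n"
  "ev2 (pCons u a) x y = poly u x + y * ev2 a x y"
  "ev2 (smult u a) x y = poly u x * ev2 a x y"
  by (simp_all add: ev2_def)

lemma ev2_sum [simp]: "ev2 (sum g A) x y = (\<Sum>a\<in>A. ev2 (g a) x y)"
  by (induction A rule: infinite_finite_induct) auto

lemma ev2_altdef:
  "ev2 a x y = (\<Sum>j\<le>degree a. \<Sum>i\<le>degree (coeff a j). cf a i j * x ^ i * y ^ j)"
proof -
  have "ev2 a x y = (\<Sum>j\<le>degree a. poly (coeff a j) x * y ^ j)"
    by (simp add: ev2_def poly_altdef[of a] poly_sum)
  then show ?thesis
    by (simp add: poly_altdef sum_distrib_right)
qed

lemma ev2_eq_0_imp:
  fixes a :: "'k::alg_closed_field poly poly"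
  assumes "\<And>x y. ev2 a x y = 0"
  shows "a = 0"
proof -
  have "poly a [:y:] = 0" for y
    using assms poly_eqI_alg_closed[of "poly a [:y:]" 0] by (simp add: ev2_def)
  moreover have "infinite (range (\<lambda>y::'k. [:y:]))"
    using infinite_alg_closed_field[where 'k='k] by (subst finite_image_iff) (auto intro: injI)
  ultimately show ?thesis
    by (intro poly_eq_0I_infinite[of "range (\<lambda>y. [:y:])" a]) auto
qed

section \<open>Weighted degrees\<close>

lemma finite_cf_support: "finite {(i, j). cf a i j \<noteq> 0}"
proof (rule finite_subset)
  show "{(i, j). cf a i j \<noteq> 0} \<subseteq> (\<Union>j\<in>{..degree a}. {..degree (coeff a j)} \<times> {j})"
    by (auto intro!: le_degree)
qed auto

text \<open>With weights (1, 1) this is the ordinary degree bound behind homogenization, with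
  weights (e, e + 1) the bound for the pole order at infinity. Being a bound, it holds for the zero
  polynomial with every N.\<close>

definition wle :: "nat \<Rightarrow> nat \<Rightarrow> nat \<Rightarrow> 'k::zero poly poly \<Rightarrow> bool" where
  "wle \<alpha> \<beta> N a \<longleftrightarrow> (\<forall>i j. cf a i j \<noteq> 0 \<longrightarrow> \<alpha> * i + \<beta> * j \<le> N)"

lemma wle_mono: "wle \<alpha> \<beta> N a \<Longrightarrow> N \<le> M \<Longrightarrow> wle \<alpha> \<beta> M a"
  unfolding wle_def by (meson le_trans)

lemma wle_0 [simp]: "wle \<alpha> \<beta> N 0"
  by (simp add: wle_def)

lemma wle_add: "wle \<alpha> \<beta> N a \<Longrightarrow> wle \<alpha> \<beta> N b \<Longrightarrow> wle \<alpha> \<beta> N (a + b)"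
  unfolding wle_def by (metis add.right_neutral coeff_add)

lemma wle_diff: "wle \<alpha> \<beta> N a \<Longrightarrow> wle \<alpha> \<beta> N b \<Longrightarrow> wle \<alpha> \<beta> N (a - b)"
  for a b :: "'k::ab_group_add poly poly"
  unfolding wle_def by (metis cancel_comm_monoid_add_class.diff_zero coeff_diff diff_0 neg_equal_0_iff_equal)

lemma wle_sum: "(\<And>i. i \<in> A \<Longrightarrow> wle \<alpha> \<beta> N (g i)) \<Longrightarrow> wle \<alpha> \<beta> N (sum g A)"
  by (induction A rule: infinite_finite_induct) (auto intro: wle_add)

lemma wle_mult:
  fixes a b :: "'k::comm_semiring_0 poly poly"
  assumes "wle \<alpha> \<beta> N a" "wle \<alpha> \<beta> M b"
  shows "wle \<alpha> \<beta> (N + M) (a * b)"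
  unfolding wle_def
proof (intro allI impI)
  fix i j assume nz: "cf (a * b) i j \<noteq> 0"
  have "cf (a * b) i j = (\<Sum>k\<le>j. \<Sum>l\<le>i. cf a l k * cf b (i - l) (j - k))"
    by (simp add: coeff_mult coeff_sum)
  then obtain k l where kl: "k \<le> j" "l \<le> i" "cf a l k * cf b (i - l) (j - k) \<noteq> 0"
    using nz by (metis (no_types, lifting) atMost_iff sum.not_neutral_contains_not_neutral)
  then have "cf a l k \<noteq> 0" "cf b (i - l) (j - k) \<noteq> 0"
    by auto
  then have "\<alpha> * l + \<beta> * k \<le> N" "\<alpha> * (i - l) + \<beta> * (j - k) \<le> M"
    using assms by (auto simp: wle_def)
  moreover have "\<alpha> * i = \<alpha> * l + \<alpha> * (i - l)" "\<beta> * j = \<beta> * k + \<beta> * (j - k)"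
    using kl by (simp_all flip: distrib_left)
  ultimately show "\<alpha> * i + \<beta> * j \<le> N + M"
    by simp
qed

lemma wle_one: "wle \<alpha> \<beta> 0 (1 :: 'k::comm_semiring_1 poly poly)"
  by (auto simp: wle_def coeff_1 split: if_splits)

lemma wle_power:
  fixes a :: "'k::comm_semiring_1 poly poly"
  shows "wle \<alpha> \<beta> N a \<Longrightarrow> wle \<alpha> \<beta> (n * N) (a ^ n)"
  by (induction n) (auto intro: wle_one wle_mult)

lemma wle_pCons: 
  assumes "\<And>i. coeff u i \<noteq> 0 \<Longrightarrow> \<alpha> * i \<le> N" "a = 0 \<or> wle \<alpha> \<beta> (N - \<beta>) a \<and> \<beta> \<le> N"
  shows "wle \<alpha> \<beta> N (pCons u a)"
  unfolding wle_def
proof (intro allI impI)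
  fix i j assume nz: "cf (pCons u a) i j \<noteq> 0"
  show "\<alpha> * i + \<beta> * j \<le> N"
  proof (cases j)
    case 0
    then show ?thesis using nz assms(1) by auto
  next
    case (Suc k)
    with nz have "cf a i k \<noteq> 0" by simp
    moreover from this have "a \<noteq> 0" by auto
    ultimately have "\<alpha> * i + \<beta> * k \<le> N - \<beta>" "\<beta> \<le> N"
      using assms(2) by (auto simp: wle_def)
    then show ?thesis using Suc by simp
  qed
qed

lemma exact_weight:
  assumes "a \<noteq> 0"
  obtains N i j where "wle \<alpha> \<beta> N a" "cf a i j \<noteq> 0" "\<alpha> * i + \<beta> * j = N"
proof -
  let ?T = "(\<lambda>(i, j). \<alpha> * i + \<beta> * j) ` {(i, j). cf a i j \<noteq> 0}"
  have fin: "finite ?T"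
    using finite_cf_support[of a] by (rule finite_imageI)
  obtain j where "coeff a j \<noteq> 0"
    using assms by (auto simp: poly_eq_iff)
  then obtain i where "cf a i j \<noteq> 0"
    by (auto simp: poly_eq_iff)
  then have "?T \<noteq> {}" by auto
  then have "Max ?T \<in> ?T"
    using fin by (rule Max_in[rotated])
  then obtain i j where "cf a i j \<noteq> 0" "\<alpha> * i + \<beta> * j = Max ?T"
    by auto
  moreover have "wle \<alpha> \<beta> (Max ?T) a"
    unfolding wle_def using fin by (auto intro!: Max_ge)
  ultimately show ?thesis using that by blast
qed

text \<open>The substitution of (t^\<alpha>, \<zeta> t^\<beta>), which turns weighted degree into
  degree in t. If \<open>a\<close> has weight at most N, the coefficient of t^N is the part of
  weight N of \<open>a\<close>, evaluated at (1, \<zeta>); the sum over monomials is chosen to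
  expose it.\<close>

definition theta :: "nat \<Rightarrow> nat \<Rightarrow> 'k \<Rightarrow> 'k::comm_ring_1 poly poly \<Rightarrow> 'k poly" where
  "theta \<alpha> \<beta> \<zeta> a = (\<Sum>j\<le>degree a. \<Sum>i\<le>degree (coeff a j). monom (cf a i j * \<zeta> ^ j) (\<alpha> * i + \<beta> * j))"

lemma poly_theta: "poly (theta \<alpha> \<beta> \<zeta> a) t = ev2 a (t ^ \<alpha>) (\<zeta> * t ^ \<beta>)"
  unfolding theta_def ev2_altdef
  by (simp add: poly_sum poly_monom power_mult_distrib power_add mult_ac flip: power_mult)

lemma theta_mult:
  fixes a b :: "'k::alg_closed_field poly poly"
  shows "theta \<alpha> \<beta> \<zeta> (a * b) = theta \<alpha> \<beta> \<zeta> a * theta \<alpha> \<beta> \<zeta> b"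
  by (rule poly_eqI_alg_closed) (simp add: poly_theta)

lemma theta_diff:
  fixes a b :: "'k::alg_closed_field poly poly"
  shows "theta \<alpha> \<beta> \<zeta> (a - b) = theta \<alpha> \<beta> \<zeta> a - theta \<alpha> \<beta> \<zeta> b"
  by (rule poly_eqI_alg_closed) (simp add: poly_theta)

lemma coeff_theta:
  "coeff (theta \<alpha> \<beta> \<zeta> a) N = (\<Sum>j\<le>degree a. \<Sum>i\<le>degree (coeff a j).
     if \<alpha> * i + \<beta> * j = N then cf a i j * \<zeta> ^ j else 0)"
  by (simp add: theta_def coeff_sum)

lemma coeff_theta_gt:
  assumes "wle \<alpha> \<beta> N a" "N < M"
  shows "coeff (theta \<alpha> \<beta> \<zeta> a) M = 0"
  unfolding coeff_theta
proof (intro sum.neutral ballI)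
  fix j i
  show "(if \<alpha> * i + \<beta> * j = M then cf a i j * \<zeta> ^ j else 0) = 0"
    using assms unfolding wle_def by (cases "cf a i j = 0") (auto simp: not_le[symmetric])
qed

lemma degree_theta_le: "wle \<alpha> \<beta> N a \<Longrightarrow> degree (theta \<alpha> \<beta> \<zeta> a) \<le> N"
  by (auto intro!: degree_le coeff_theta_gt)

text \<open>The bounds need not be attained: every other pair of indices with sum n + m exceeds one
  of them. So coefficients at a bound multiply even when they may be zero.\<close>

lemma coeff_mult_at_bounds:
  fixes p q :: "'k::comm_semiring_0 poly"
  assumes "degree p \<le> n" "degree q \<le> m"
  shows "coeff (p * q) (n + m) = coeff p n * coeff q m"
proof -
  have "coeff (p * q) (n + m) = (\<Sum>i\<le>n+m. coeff p i * coeff q (n + m - i))"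
    by (simp add: coeff_mult)
  also have "\<dots> = (\<Sum>i\<in>{n}. coeff p i * coeff q (n + m - i))"
  proof (rule sum.mono_neutral_right)
    show "\<forall>i\<in>{..n + m} - {n}. coeff p i * coeff q (n + m - i) = 0"
    proof
      fix i assume i: "i \<in> {..n + m} - {n}"
      show "coeff p i * coeff q (n + m - i) = 0"
      proof (cases "i < n")
        case True
        then have "coeff q (n + m - i) = 0"
          using assms(2) by (intro coeff_eq_0) auto
        then show ?thesis by simp
      next
        case False
        then have "coeff p i = 0"
          using i assms(1) by (intro coeff_eq_0) auto
        then show ?thesis by simp
      qed
    qed
  qed auto
  finally show ?thesis by simp
qed

text \<open>As a function of \<zeta> the coefficient at N is a polynomial. Its coefficient at j0 is
  the single number \<open>cf a i0 j0\<close>, because \<alpha> > 0 lets the weight N and j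
  determine i.\<close>

lemma finite_bad_slope:
  fixes a :: "'k::alg_closed_field poly poly"
  assumes "\<alpha> > 0" "cf a i0 j0 \<noteq> 0" "\<alpha> * i0 + \<beta> * j0 = N"
  shows "finite {\<zeta>. coeff (theta \<alpha> \<beta> \<zeta> a) N = 0}"
proof -
  define p where "p = (\<Sum>j\<le>degree a. \<Sum>i\<le>degree (coeff a j).
     if \<alpha> * i + \<beta> * j = N then monom (cf a i j) j else 0)"
  have "poly p \<zeta> = coeff (theta \<alpha> \<beta> \<zeta> a) N" for \<zeta>
    unfolding p_def coeff_theta
    by (simp add: poly_sum poly_monom if_distrib[of "\<lambda>q. poly q \<zeta>"] cong: if_cong)
  moreover have "coeff p j0 = cf a i0 j0"
  proof -
    have j0: "j0 \<le> degree a" "i0 \<le> degree (coeff a j0)"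
      using assms(2) by (auto intro: le_degree)
    have inner: "(if \<alpha> * i + \<beta> * j = N then if j = j0 then cf a i j else 0 else 0) =
        (if j = j0 then if i = i0 then cf a i j else 0 else 0)" for i j
      using assms(1,3) by auto
    have "coeff p j0 = (\<Sum>j\<le>degree a. \<Sum>i\<le>degree (coeff a j).
        if \<alpha> * i + \<beta> * j = N then if j = j0 then cf a i j else 0 else 0)"
      unfolding p_def by (simp add: coeff_sum if_distrib[of "\<lambda>q. coeff q j0"] cong: if_cong)
    also have "\<dots> = (\<Sum>j\<le>degree a. if j = j0 then \<Sum>i\<le>degree (coeff a j). if i = i0 then cf a i j else 0 else 0)"
      unfolding inner by (intro sum.cong) auto
    also have "\<dots> = cf a i0 j0"
      using j0 by simp
    finally show ?thesis .
  qed
  ultimately show ?thesis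
    using poly_roots_finite[of p] assms(2) by (metis (mono_tags, lifting) Collect_cong coeff_0)
qed

text \<open>A generic slope keeps the leading weighted parts of both factors alive.\<close>

lemma wle_factor:
  fixes a b :: "'k::alg_closed_field poly poly"
  assumes "\<alpha> > 0" "a \<noteq> 0" "cf b i j \<noteq> 0" "\<alpha> * i + \<beta> * j = M" "wle \<alpha> \<beta> M b" "wle \<alpha> \<beta> N (a * b)"
  shows "M \<le> N" "wle \<alpha> \<beta> (N - M) a"
proof -
  obtain W i' j' where W: "wle \<alpha> \<beta> W a" "cf a i' j' \<noteq> 0" "\<alpha> * i' + \<beta> * j' = W"
    using exact_weight[OF assms(2)] by blast
  have "finite ({\<zeta>. coeff (theta \<alpha> \<beta> \<zeta> a) W = 0} \<union> {\<zeta>. coeff (theta \<alpha> \<beta> \<zeta> b) M = 0})"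
    using finite_bad_slope[OF assms(1) W(2,3)] finite_bad_slope[OF assms(1,3,4)] by simp
  then obtain \<zeta> where "coeff (theta \<alpha> \<beta> \<zeta> a) W \<noteq> 0" "coeff (theta \<alpha> \<beta> \<zeta> b) M \<noteq> 0"
    using ex_new_if_finite[OF infinite_alg_closed_field[where 'k='k]] by blast
  then have "coeff (theta \<alpha> \<beta> \<zeta> (a * b)) (W + M) \<noteq> 0"
    using coeff_mult_at_bounds[OF degree_theta_le[OF W(1)] degree_theta_le[OF assms(5)], of \<zeta> \<zeta>]
    by (simp add: theta_mult)
  then have "W + M \<le> N"
    using coeff_theta_gt[OF assms(6)] by (meson not_le)
  then show "M \<le> N" "wle \<alpha> \<beta> (N - M) a"
    using W(1) by (auto intro: wle_mono)
qed

text \<open>Gaussian elimination: a pivot \<open>m0\<close> with nonzero entry at i removes one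
  equation and one unknown, and \<open>c0\<close> then solves the equation at i for the unknown of
  the pivot.\<close>

lemma linear_dependence:
  fixes v :: "'m \<Rightarrow> 'i \<Rightarrow> 'k::field"
  assumes "finite I" "finite M" "card I < card M"
  shows "\<exists>c. (\<exists>m\<in>M. c m \<noteq> 0) \<and> (\<forall>i\<in>I. (\<Sum>m\<in>M. c m * v m i) = 0)"
  using assms
proof (induction I arbitrary: M v rule: finite_induct)
  case empty
  then have "M \<noteq> {}" by auto
  then show ?case by (intro exI[of _ "\<lambda>_. 1"]) auto
next
  case (insert i I)
  show ?case
  proof (cases "\<forall>m\<in>M. v m i = 0")
    case True
    obtain c where "\<exists>m\<in>M. c m \<noteq> 0" "\<forall>i\<in>I. (\<Sum>m\<in>M. c m * v m i) = 0"
      using insert.IH[of M v] insert.prems insert.hyps by (metis card_insert_disjoint Suc_lessD)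
    with True show ?thesis
      by (intro exI[of _ c]) auto
  next
    case False
    then obtain m0 where m0: "m0 \<in> M" "v m0 i \<noteq> 0" by blast
    define v' where "v' m k = v m k - v m i / v m0 i * v m0 k" for m k
    have "card I < card (M - {m0})"
      using insert m0 by simp
    then obtain c where c: "\<exists>m\<in>M - {m0}. c m \<noteq> 0" "\<forall>k\<in>I. (\<Sum>m\<in>M - {m0}. c m * v' m k) = 0"
      using insert.IH[of "M - {m0}" v'] insert.prems by (metis finite_Diff)
    define c0 where "c0 = - (\<Sum>m\<in>M - {m0}. c m * v m i) / v m0 i"
    define c' where "c' m = (if m = m0 then c0 else c m)" for m
    have split: "(\<Sum>m\<in>M. c' m * v m k) = c0 * v m0 k + (\<Sum>m\<in>M - {m0}. c m * v m k)" for k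
    proof -
      have "(\<Sum>m\<in>M. c' m * v m k) = c' m0 * v m0 k + (\<Sum>m\<in>M - {m0}. c' m * v m k)"
        using insert.prems(1) m0(1) by (rule sum.remove)
      then show ?thesis by (simp add: c'_def)
    qed
    have "(\<Sum>m\<in>M. c' m * v m k) = 0" if "k \<in> insert i I" for k
    proof (cases "k = i")
      case True
      then show ?thesis unfolding split c0_def using m0 by simp
    next
      case False
      with that have "(\<Sum>m\<in>M - {m0}. c m * v' m k) = 0" using c(2) by blast
      moreover have "(\<Sum>m\<in>M - {m0}. c m * v' m k) =
          (\<Sum>m\<in>M - {m0}. c m * v m k) - (\<Sum>m\<in>M - {m0}. c m * v m i) / v m0 i * v m0 k"
        by (simp add: v'_def right_diff_distrib sum_subtractf sum_distrib_right sum_divide_distrib mult.assoc)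
      ultimately show ?thesis unfolding split c0_def by simp
    qed
    moreover have "\<exists>m\<in>M. c' m \<noteq> 0"
      using c(1) by (auto simp: c'_def)
    ultimately show ?thesis by blast
  qed
qed

text \<open>Positive weights leave only finitely many monomials of weight at most N, all with
  exponents in {0..N}. The relation is packed into a polynomial \<open>p\<close>, since for r m =
  g^e w^m it will say that p(w) is killed by g^e.\<close>

lemma wle_linear_dependence:
  fixes r :: "nat \<Rightarrow> 'k::field poly poly"
  assumes "\<alpha> > 0" "\<beta> > 0" "\<And>m. wle \<alpha> \<beta> N (r m)"
  obtains p :: "'k poly" where "p \<noteq> 0" "(\<Sum>m\<le>degree p. smult [:coeff p m:] (r m)) = 0"
proof -
  let ?I = "{..N} \<times> {..N}"
  define n where "n = card ?I"
  obtain c where c: "\<exists>m\<in>{..n}. c m \<noteq> 0" "\<forall>k\<in>?I. (\<Sum>m\<le>n. c m * cf (r m) (fst k) (snd k)) = 0"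
    using linear_dependence[of ?I "{..n}" "\<lambda>m k. cf (r m) (fst k) (snd k)"] by (auto simp: n_def)
  define p where "p = (\<Sum>m\<le>n. monom (c m) m)"
  have coeff_p: "coeff p m = (if m \<le> n then c m else 0)" for m
    by (simp add: p_def coeff_sum)
  have deg: "degree p \<le> n"
    by (rule degree_le) (simp add: coeff_p)
  have "(\<Sum>m\<le>degree p. smult [:coeff p m:] (r m)) = (\<Sum>m\<le>n. smult [:coeff p m:] (r m))"
    using deg by (intro sum.mono_neutral_left) (auto simp: coeff_eq_0)
  also have "\<dots> = 0"
  proof (intro poly_eqI)
    fix j i
    show "cf (\<Sum>m\<le>n. smult [:coeff p m:] (r m)) i j = cf 0 i j"
    proof (cases "i \<le> N \<and> j \<le> N")
      case True
      then have "(\<Sum>m\<le>n. c m * cf (r m) i j) = 0"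
        using c(2) by auto
      then show ?thesis by (simp add: coeff_sum coeff_p)
    next
      case False
      have "cf (r m) i j = 0" for m
      proof (rule ccontr)
        assume "cf (r m) i j \<noteq> 0"
        then have "\<alpha> * i + \<beta> * j \<le> N"
          using assms(3)[of m] by (simp add: wle_def)
        moreover have "i \<le> \<alpha> * i" "j \<le> \<beta> * j"
          using assms by auto
        ultimately show False using False le_trans[of i "\<alpha> * i"] le_trans[of j "\<beta> * j"]
        by (meson add_leE)
      qed
      then show ?thesis by (simp add: coeff_sum)
    qed
  qed
  finally have "(\<Sum>m\<le>degree p. smult [:coeff p m:] (r m)) = 0" .
  moreover have "p \<noteq> 0"
    using c(1) coeff_p by (metis atMost_iff coeff_0)
  ultimately show ?thesis using that by blast
qed

text \<open>Finite geometric series: after scaling by the inverse of \<eta>(0), the difference 1 - s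
  is divisible by X, so its n-th power is the error of the truncated inverse.\<close>

lemma inverse_mod_power:
  fixes \<eta> :: "'k::field poly"
  assumes "poly \<eta> 0 \<noteq> 0"
  obtains \<iota> where "[:0, 1:] ^ n dvd 1 - \<iota> * \<eta>"
proof -
  define s where "s = smult (inverse (poly \<eta> 0)) \<eta>"
  have "poly (1 - s) 0 = 0"
    using assms by (simp add: s_def)
  then have "[:0, 1:] dvd 1 - s"
    using dvd_iff_poly_eq_0[of 0 "1 - s"] by simp
  then have "[:0, 1:] ^ n dvd (1 - s) ^ n"
    by (rule dvd_power_same)
  moreover have "1 - (1 - s) ^ n = s * (\<Sum>i<n. (1 - s) ^ i)"
    using one_diff_power_eq[of "1 - s" n] by simp
  then have "(1 - s) ^ n = 1 - smult (inverse (poly \<eta> 0)) (\<Sum>i<n. (1 - s) ^ i) * \<eta>"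
    by (simp add: s_def algebra_simps)
  ultimately show ?thesis using that by metis
qed

section \<open>Translates of a linear function with the same norm\<close>

text \<open>The algebraic core, cut off from the geometry. \<open>S\<close> will be the set of
  points P of the curve X for which P and \<sigma>(P) both map into the affine chart,
  \<open>R\<close> the functions regular on it, considered up to equality on \<open>S\<close>; by
  \<open>R_domain\<close> they form an integral domain. \<open>yt\<close> is y' as a function on
  \<open>S\<close>, \<open>p2\<close> is the point P_2, and y' takes the value - \<beta> there
  because \<sigma>(P_2) = P_3 maps to the point of x = 0 on the tangent line y + \<alpha> x +
  \<beta> = 0. By \<open>yt_rational\<close>, y' is a rational function of x and y.\<close>

locale plane_model =
  fixes f h2 h3 :: "'k::alg_closed_field poly poly"
    and e :: nat and \<kappa> c c2 c3 \<alpha> \<beta> :: 'k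
    and S :: "'p set" and R :: "('p \<Rightarrow> 'k) set" and xx yy yt :: "'p \<Rightarrow> 'k" and p2 :: 'p
  assumes R_const: "(\<lambda>_. r) \<in> R"
    and R_add: "u \<in> R \<Longrightarrow> v \<in> R \<Longrightarrow> (\<lambda>P. u P + v P) \<in> R"
    and R_mult: "u \<in> R \<Longrightarrow> v \<in> R \<Longrightarrow> (\<lambda>P. u P * v P) \<in> R"
    and R_domain: "u \<in> R \<Longrightarrow> v \<in> R \<Longrightarrow> \<forall>P\<in>S. u P * v P = 0 \<Longrightarrow>
      (\<forall>P\<in>S. u P = 0) \<or> (\<forall>P\<in>S. v P = 0)"
    and in_R: "xx \<in> R" "yy \<in> R" "yt \<in> R"
    and e_pos: "e > 0"
    and f_y: "cf f 0 e = \<kappa>" "\<kappa> \<noteq> 0"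
    and f_x: "cf f (Suc e) 0 = c" "c \<noteq> 0"
    and f_rest: "\<And>i j. cf f i j \<noteq> 0 \<Longrightarrow> i + j \<le> e \<or> i = Suc e \<and> j = 0"
    and f_xx_yy: "\<And>P. P \<in> S \<Longrightarrow> ev2 f (xx P) (yy P) = 0"
    and f_xx_yt: "\<And>P. P \<in> S \<Longrightarrow> ev2 f (xx P) (yt P) = 0"
    and f_dvd: "\<And>a. (\<And>P. P \<in> S \<Longrightarrow> ev2 a (xx P) (yy P) = 0) \<Longrightarrow> f dvd a"
    and f_h2: "\<And>x y. ev2 f x y = c2 * x ^ Suc e + y * ev2 h2 x y"
    and h2_nz: "ev2 h2 0 0 \<noteq> 0" and c2_nz: "c2 \<noteq> 0"
    and f_h3: "\<And>x y. ev2 f x y = c3 * x ^ Suc e + (y + \<alpha> * x + \<beta>) * ev2 h3 x y"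
    and h3_nz: "ev2 h3 0 (- \<beta>) \<noteq> 0" and c3_nz: "c3 \<noteq> 0"
    and p2: "p2 \<in> S" "xx p2 = 0" "yy p2 = 0" "yt p2 = - \<beta>"
    and yt_rational: "\<exists>G U. \<not> f dvd G \<and> (\<forall>P\<in>S. ev2 G (xx P) (yy P) * yt P = ev2 U (xx P) (yy P))"
begin

abbreviation E :: "'k poly poly \<Rightarrow> 'p \<Rightarrow> 'k" where
  "E a P \<equiv> ev2 a (xx P) (yy P)"

lemma R_power: "u \<in> R \<Longrightarrow> (\<lambda>P. u P ^ n) \<in> R"
proof (induction n)
  case 0
  then show ?case using R_const[of 1] by simp
next
  case (Suc n)
  then show ?case using R_mult[OF Suc.prems Suc.IH] by simp
qed

lemma R_sum: "(\<And>i. i \<in> A \<Longrightarrow> u i \<in> R) \<Longrightarrow> (\<lambda>P. \<Sum>i\<in>A. u i P) \<in> R"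
proof (induction A rule: infinite_finite_induct)
  case (insert i A)
  then show ?case using R_add[of "u i" "\<lambda>P. \<Sum>i\<in>A. u i P"] by simp
qed (use R_const[of 0] in simp_all)

lemma R_diff: "u \<in> R \<Longrightarrow> v \<in> R \<Longrightarrow> (\<lambda>P. u P - v P) \<in> R"
  using R_add[OF _ R_mult[OF R_const[of "-1"]], of u v] by simp

lemma R_poly: "u \<in> R \<Longrightarrow> (\<lambda>P. poly q (u P)) \<in> R"
  unfolding poly_altdef by (rule R_sum, rule R_mult, rule R_const, rule R_power)

lemma R_ev2: "u \<in> R \<Longrightarrow> v \<in> R \<Longrightarrow> (\<lambda>P. ev2 a (u P) (v P)) \<in> R"
  unfolding ev2_altdef
  by (rule R_sum, rule R_sum, rule R_mult, rule R_mult, rule R_const, erule R_power, erule R_power)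

lemma E_in_R: "E a \<in> R"
  by (rule R_ev2[OF in_R(1,2)])

lemma E_f_dvd: "P \<in> S \<Longrightarrow> f dvd a \<Longrightarrow> E a P = 0"
  by (auto simp: f_xx_yy elim!: dvdE)

lemma f_dvd_iff: "f dvd a \<longleftrightarrow> (\<forall>P\<in>S. E a P = 0)"
proof
  show "f dvd a" if "\<forall>P\<in>S. E a P = 0"
    using that by (intro f_dvd) simp
qed (simp add: E_f_dvd)

lemma R_cancel:
  assumes "u \<in> R" "v \<in> R" "\<And>P. P \<in> S \<Longrightarrow> u P * v P = 0" "\<exists>P\<in>S. u P \<noteq> 0" "P \<in> S"
  shows "v P = 0"
proof -
  have "(\<forall>P\<in>S. u P = 0) \<or> (\<forall>P\<in>S. v P = 0)"
    using assms(3) by (intro R_domain assms(1,2)) simp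
  then show ?thesis using assms(4,5) by auto
qed

lemma f_prime: "f dvd a * b \<Longrightarrow> f dvd a \<or> f dvd b"
  unfolding f_dvd_iff ev2_simps by (rule R_domain[OF E_in_R E_in_R])

text \<open>By \<open>f_rest\<close> the only monomial of y-degree e is y^e, so f is monic in y up
  to the constant \<kappa>. This allows division by f without denominators in x and makes y'
  integral over k[x].\<close>

lemma degree_f: "degree f = e" "lead_coeff f = [:\<kappa>:]"
proof -
  have "coeff f e \<noteq> 0"
    using f_y by auto
  moreover have "coeff f j = 0" if "j > e" for j
  proof (rule poly_eqI)
    fix i
    show "cf f i j = coeff 0 i"
      using f_rest[where i=i and j=j] that by (cases "cf f i j = 0") auto
  qed
  ultimately show deg: "degree f = e"
    by (metis degree_le le_antisym le_degree)
  have "cf f i e = coeff [:\<kappa>:] i" for i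
  proof (cases i)
    case 0
    then show ?thesis using f_y by simp
  next
    case (Suc n)
    then show ?thesis using f_rest[where i=i and j=e] e_pos by auto
  qed
  then show "lead_coeff f = [:\<kappa>:]"
    unfolding deg by (intro poly_eqI) auto
qed

lemma f_nz: "f \<noteq> 0"
  using degree_f e_pos by auto

lemma not_f_dvd_const: "r \<noteq> 0 \<Longrightarrow> \<not> f dvd [:r:]"
  using dvd_imp_degree_le[of f "[:r:]"] degree_f e_pos by auto

text \<open>Euclid's algorithm over k(x), carried out with pseudo-division: an element h of least
  y-degree in the ideal of G and f has y-degree 0, since f is prime and does not divide G. It plays
  the role of the resultant.\<close>

lemma norm_multiple:
  assumes "\<not> f dvd G"
  obtains G' r where "r \<noteq> 0" "\<And>P. P \<in> S \<Longrightarrow> E (G' * G) P = poly r (xx P)"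
proof -
  define J where "J = {h. \<exists>a b. h = a * G + b * f}"
  have "f = 0 * G + 1 * f" "G = 1 * G + 0 * f" by simp_all
  then have J: "f \<in> J" "G \<in> J"
    unfolding J_def by blast+
  define h where "h = arg_min degree (\<lambda>h. h \<in> J \<and> h \<noteq> 0)"
  have h: "h \<in> J" "h \<noteq> 0" and h_min: "\<And>h'. h' \<in> J \<Longrightarrow> h' \<noteq> 0 \<Longrightarrow> degree h \<le> degree h'"
    using arg_min_nat_lemma[of "\<lambda>h. h \<in> J \<and> h \<noteq> 0" f degree] J f_nz unfolding h_def by auto
  have div: "\<exists>s q. s \<noteq> 0 \<and> [:s:] * a = h * q" if a: "a \<in> J" for a
  proof -
    define rem where "rem = pseudo_mod a h"
    obtain s q where s: "s \<noteq> 0" "smult s a = h * q + rem"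
      using pseudo_mod(1)[OF h(2), of a] rem_def by blast
    have "rem \<in> J"
    proof -
      obtain a1 b1 a2 b2 where "a = a1 * G + b1 * f" "h = a2 * G + b2 * f"
        using a h(1) unfolding J_def by blast
      moreover have "rem = [:s:] * a - h * q"
        using s(2) by simp
      ultimately have "rem = ([:s:] * a1 - a2 * q) * G + ([:s:] * b1 - b2 * q) * f"
        by (simp only: algebra_simps)
      then show ?thesis unfolding J_def by blast
    qed
    then have "rem = 0"
      using h_min[of rem] pseudo_mod(2)[OF h(2), of a] rem_def by fastforce
    then show ?thesis using s by auto
  qed
  have "degree h = 0"
  proof -
    obtain s q where s: "s \<noteq> 0" "[:s:] * f = h * q"
      using div[OF J(1)] by blast
    obtain s' q' where s': "s' \<noteq> 0" "[:s':] * G = h * q'"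
      using div[OF J(2)] by blast
    \<comment> \<open>Up to factors in k[x], h divides both f and G. As f is prime, either f divides
      h and therefore G, or f cancels and h divides the polynomial s in x.\<close>
    have "f dvd h \<or> f dvd q"
      using f_prime[of h q] s(2) by (metis dvd_triv_right)
    then show ?thesis
    proof
      assume "f dvd h"
      then have "f dvd [:s':] * G"
        using s'(2) by simp
      then show ?thesis
        using f_prime not_f_dvd_const[OF s'(1)] assms by blast
    next
      assume "f dvd q"
      then obtain q'' where "q = f * q''" by blast
      with s(2) have "f * [:s:] = f * (h * q'')" by (simp add: mult_ac)
      then have "[:s:] = h * q''"
        using f_nz by (metis mult_left_cancel)
      then show ?thesis
        using s(1) by (metis degree_pCons_0 dvd_imp_degree_le dvd_triv_left le_zero_eq pCons_eq_0_iff)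
    qed
  qed
  then obtain r where r: "h = [:r:]"
    by (metis degree_eq_zeroE)
  obtain a b where ab: "h = a * G + b * f"
    using h(1) unfolding J_def by blast
  have "E (a * G) P = poly r (xx P)" if "P \<in> S" for P
  proof -
    have "E h P = E (a * G) P"
      unfolding ab using f_xx_yy[OF that] by simp
    then show ?thesis by (simp add: r)
  qed
  moreover have "r \<noteq> 0" using h(2) r by simp
  ultimately show ?thesis using that by blast
qed

section \<open>Local analysis at the second inflection point\<close>

abbreviation X :: "'k poly poly" where "X \<equiv> [:[:0, 1:]:]"

lemma E_h2: "P \<in> S \<Longrightarrow> c2 * xx P ^ Suc e + yy P * E h2 P = 0"
  using f_xx_yy[of P] f_h2[of "xx P" "yy P"] by simp

text \<open>On the curve y h2 = - c2 x^(e+1), so the maximal ideal (x, y) of the origin is generated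
  by x once h2 is inverted: x is a uniformizer at \<open>p2\<close>. Multiplication by h2 takes the
  place of localizing.\<close>

lemma h2_times:
  assumes "ev2 a 0 0 = 0"
  obtains a' where "\<And>P. P \<in> S \<Longrightarrow> E (h2 * a) P = E (X * a') P"
proof -
  obtain u a2 where a: "a = pCons u a2" by (cases a)
  obtain r u1 where u: "u = pCons r u1" by (cases u)
  have "r = 0" using assms by (simp add: a u)
  have "E (h2 * a) P = E (X * (h2 * [:u1:] - [:[:c2:]:] * X ^ e * a2)) P" if "P \<in> S" for P
  proof -
    have "yy P * E h2 P = - (c2 * xx P ^ Suc e)"
      using E_h2[OF that] by (metis add_eq_0_iff)
    then have "E a2 P * (yy P * E h2 P) = - (E a2 P * (c2 * xx P ^ Suc e))"
      by simp
    then show ?thesis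
      by (simp add: a u \<open>r = 0\<close> algebra_simps)
  qed
  then show ?thesis using that by blast
qed

lemma X_not_0: "\<exists>P\<in>S. xx P \<noteq> 0"
  using not_f_dvd_const[of "[:0, 1:]"] f_dvd[of X] by auto

text \<open>Order of vanishing at \<open>p2\<close>, with the powers of h2 as units. If factors x
  could be split off without end, a multiple of G that is a nonzero polynomial r(x) would vanish at
  \<open>p2\<close> to a higher order than the multiplicity m of its root 0 permits.\<close>

lemma local_factorization:
  assumes "\<not> f dvd G"
  obtains n j G' where "ev2 G' 0 0 \<noteq> 0" "\<And>P. P \<in> S \<Longrightarrow> E (h2 ^ n * G) P = E (X ^ j * G') P"
proof (rule ccontr)
  assume contra: "\<not> thesis"
  obtain Gs r where r: "r \<noteq> 0" "\<And>P. P \<in> S \<Longrightarrow> E (Gs * G) P = poly r (xx P)"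
    using norm_multiple[OF assms] by blast
  define m where "m = Polynomial.order 0 r"
  obtain r1 where r1: "r = [:0, 1:] ^ m * r1" "poly r1 0 \<noteq> 0"
    using order_decomp[OF r(1), of 0] by (auto simp: m_def poly_eq_0_iff_dvd)
  have "\<exists>G'. \<forall>P\<in>S. E (h2 ^ n * G) P = E (X ^ n * G') P" for n
  proof (induction n)
    case 0
    then show ?case by (intro exI[of _ G]) simp
  next
    case (Suc n)
    then obtain G' where G': "\<forall>P\<in>S. E (h2 ^ n * G) P = E (X ^ n * G') P" by blast
    then have "ev2 G' 0 0 = 0"
      using contra that[of G' n n] by blast
    then obtain a' where a': "\<And>P. P \<in> S \<Longrightarrow> E (h2 * G') P = E (X * a') P"
      using h2_times by blast
    have "E (h2 ^ Suc n * G) P = E (X ^ Suc n * a') P" if P: "P \<in> S" for P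
    proof -
      have "E (h2 ^ Suc n * G) P = E h2 P * E (h2 ^ n * G) P" by (simp add: mult.assoc)
      also have "\<dots> = xx P ^ n * E (h2 * G') P"
        using G' P by (simp add: mult.left_commute)
      also have "\<dots> = E (X ^ Suc n * a') P"
        using a'[OF P] by (simp add: mult_ac)
      finally show ?thesis .
    qed
    then show ?case by blast
  qed
  then obtain G' where G': "\<forall>P\<in>S. E (h2 ^ Suc m * G) P = E (X ^ Suc m * G') P" by blast
  \<comment> \<open>Here x^m comes from r = x^m r1. After its cancellation the identity at
    \<open>p2\<close> reads h2^(m+1) r1 = 0, although neither factor vanishes there.\<close>
  have "E (X ^ m) P * E (h2 ^ Suc m * [:r1:] - X * Gs * G') P = 0" if P: "P \<in> S" for P
  proof -
    have "E (X ^ m) P * E (h2 ^ Suc m * [:r1:]) P = E h2 P ^ Suc m * (xx P ^ m * poly r1 (xx P))"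
      by simp
    also have "xx P ^ m * poly r1 (xx P) = E Gs P * E G P"
      using r(2)[OF P] by (simp add: r1(1))
    also have "E h2 P ^ Suc m * (E Gs P * E G P) = E Gs P * E (h2 ^ Suc m * G) P"
      by simp
    also have "\<dots> = E Gs P * E (X ^ Suc m * G') P"
      using G' P by simp
    also have "\<dots> = E (X ^ m) P * E (X * Gs * G') P"
      by simp
    finally show ?thesis by (simp only: ev2_simps(4) right_diff_distrib) simp
  qed
  moreover have "\<exists>P\<in>S. E (X ^ m) P \<noteq> 0"
    using X_not_0 by auto
  ultimately have "E (h2 ^ Suc m * [:r1:] - X * Gs * G') p2 = 0"
    using R_cancel[OF E_in_R E_in_R _ _ p2(1)] by blast
  then show False
    using r1(2) h2_nz p2 by simp
qed

text \<open>In y' = U / (x^j G) one factor x is removed at a time: y' is finite at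
  \<open>p2\<close>, so U vanishes there, h2 U is a multiple of x on the curve, and x cancels. Each
  step multiplies the denominator by h2, which does not vanish at \<open>p2\<close>.\<close>

lemma yt_regular_at_p2:
  obtains g V where "ev2 g 0 0 \<noteq> 0" "\<And>P. P \<in> S \<Longrightarrow> E g P * yt P = E V P"
proof -
  have lower: "\<exists>g V. ev2 g 0 0 \<noteq> 0 \<and> (\<forall>P\<in>S. E g P * yt P = E V P)"
    if "ev2 G 0 0 \<noteq> 0" "\<forall>P\<in>S. E (X ^ j * G) P * yt P = E U P" for j G U
    using that
  proof (induction j arbitrary: G U)
    case 0
    then show ?case by (intro exI[of _ G] exI[of _ U]) simp
  next
    case (Suc j)
    have "E U p2 = 0"
      using Suc.prems(2)[rule_format, OF p2(1)] p2 by simp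
    then have "ev2 U 0 0 = 0" using p2 by simp
    then obtain U' where U': "\<And>P. P \<in> S \<Longrightarrow> E (h2 * U) P = E (X * U') P"
      using h2_times by blast
    have cancel: "xx P * (E (X ^ j * (h2 * G)) P * yt P - E U' P) = 0" if P: "P \<in> S" for P
    proof -
      have "E h2 P * (xx P ^ Suc j * E G P * yt P) = E (h2 * U) P"
        unfolding ev2_simps(6) Suc.prems(2)[rule_format, OF P, symmetric] by simp
      also have "\<dots> = xx P * E U' P"
        unfolding U'[OF P] by simp
      finally have "xx P * (xx P ^ j * (E h2 P * E G P) * yt P) = xx P * E U' P"
        by (simp only: power_Suc mult_ac)
      then show ?thesis by (simp add: right_diff_distrib)
    qed
    have "\<forall>P\<in>S. E (X ^ j * (h2 * G)) P * yt P - E U' P = 0"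
    proof
      fix P assume P: "P \<in> S"
      let ?v = "\<lambda>P. E (X ^ j * (h2 * G)) P * yt P - E U' P"
      have v: "?v \<in> R"
        by (rule R_diff[OF R_mult[OF E_in_R in_R(3)] E_in_R])
      show "?v P = 0"
        by (rule R_cancel[where u=xx and v="?v"]) (use in_R(1) v cancel X_not_0 P in auto)
    qed
    moreover have "ev2 (h2 * G) 0 0 \<noteq> 0"
      using Suc.prems(1) h2_nz by simp
    ultimately show ?case
      by (intro Suc.IH[of "h2 * G" U']) simp_all
  qed
  obtain G U where GU: "\<not> f dvd G" "\<forall>P\<in>S. E G P * yt P = E U P"
    using yt_rational by meson
  obtain n j G' where G': "ev2 G' 0 0 \<noteq> 0" "\<And>P. P \<in> S \<Longrightarrow> E (h2 ^ n * G) P = E (X ^ j * G') P"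
    using local_factorization[OF GU(1)] by metis
  have "\<forall>P\<in>S. E (X ^ j * G') P * yt P = E (h2 ^ n * U) P"
  proof
    fix P assume P: "P \<in> S"
    have "E (X ^ j * G') P * yt P = E (h2 ^ n) P * (E G P * yt P)"
      unfolding G'(2)[OF P, symmetric] by (simp only: ev2_simps(6) mult.assoc)
    also have "\<dots> = E (h2 ^ n * U) P"
      by (simp only: GU(2)[rule_format, OF P] ev2_simps(6))
    finally show "E (X ^ j * G') P * yt P = E (h2 ^ n * U) P" .
  qed
  from lower[OF G'(1) this] obtain g V where "ev2 g 0 0 \<noteq> 0" "\<forall>P\<in>S. E g P * yt P = E V P"
    by blast
  then show ?thesis by (intro that[of g V]) simp_all
qed

end

lemma ev2_Y_expansion: "degree a \<le> n \<Longrightarrow> ev2 a x y = (\<Sum>j\<le>n. poly (coeff a j) x * y ^ j)"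
proof -
  assume n: "degree a \<le> n"
  have "ev2 a x y = (\<Sum>j\<le>degree a. poly (coeff a j) x * y ^ j)"
    by (simp add: ev2_def poly_altdef[of a] poly_sum)
  also have "\<dots> = (\<Sum>j\<le>n. poly (coeff a j) x * y ^ j)"
    using n by (intro sum.mono_neutral_left) (auto simp: coeff_eq_0)
  finally show ?thesis .
qed

lemma wle_const_coeff: "(\<And>i. coeff u i \<noteq> 0 \<Longrightarrow> \<alpha> * i \<le> N) \<Longrightarrow> wle \<alpha> \<beta> N [:u:]"
  by (rule wle_pCons) auto

lemma wle_const: "wle \<alpha> \<beta> N [:[:r:]:]"
  by (rule wle_const_coeff) (auto simp: coeff_pCons split: nat.splits)

section \<open>Integrality and a common denominator\<close>

context plane_model
begin

text \<open>The module over k[x, y] spanned by 1, y', ..., y'^(e-1). It is closed under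
  multiplication by y', because f(x, y') = 0 has degree e in y' and a constant leading
  coefficient.\<close>

definition finite_combination :: "('p \<Rightarrow> 'k) \<Rightarrow> bool" where
  "finite_combination u \<longleftrightarrow> (\<exists>a :: nat \<Rightarrow> _. \<forall>P\<in>S. u P = (\<Sum>i<e. E (a i) P * yt P ^ i))"

lemma finite_combinationI:
  "(\<And>P. P \<in> S \<Longrightarrow> u P = (\<Sum>i<e. E (a i) P * yt P ^ i)) \<Longrightarrow> finite_combination u"
  unfolding finite_combination_def by (rule exI[of _ a]) simp

lemma finite_combinationE:
  assumes "finite_combination u"
  obtains a :: "nat \<Rightarrow> 'k poly poly" where "\<forall>P\<in>S. u P = (\<Sum>i<e. E (a i) P * yt P ^ i)"
proof -
  from assms obtain a :: "nat \<Rightarrow> 'k poly poly"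
    where "\<forall>P\<in>S. u P = (\<Sum>i<e. E (a i) P * yt P ^ i)"
    unfolding finite_combination_def ..
  then show ?thesis by (rule that)
qed

lemma finite_combination_1: "finite_combination (\<lambda>_. 1)"
proof (rule finite_combinationI[where a="\<lambda>i. if i = 0 then 1 else 0"])
  fix P
  have "(\<Sum>i<e. E (if i = 0 then 1 else 0) P * yt P ^ i) = (\<Sum>i<e. if i = 0 then 1 else 0)"
    by (intro sum.cong) auto
  then show "1 = (\<Sum>i<e. E (if i = 0 then 1 else 0) P * yt P ^ i)"
    using e_pos by simp
qed

lemma finite_combination_add:
  assumes "finite_combination u" "finite_combination v"
  shows "finite_combination (\<lambda>P. u P + v P)"
proof -
  obtain a where a: "\<forall>P\<in>S. u P = (\<Sum>i<e. E (a i) P * yt P ^ i)"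
    by (rule finite_combinationE[OF assms(1)])
  obtain b where b: "\<forall>P\<in>S. v P = (\<Sum>i<e. E (b i) P * yt P ^ i)"
    by (rule finite_combinationE[OF assms(2)])
  show ?thesis
    by (rule finite_combinationI[where a="\<lambda>i. a i + b i"])
      (simp add: a b distrib_right sum.distrib)
qed

lemma finite_combination_E_mult:
  assumes "finite_combination u"
  shows "finite_combination (\<lambda>P. E b P * u P)"
proof -
  obtain a where a: "\<forall>P\<in>S. u P = (\<Sum>i<e. E (a i) P * yt P ^ i)"
    by (rule finite_combinationE[OF assms(1)])
  show ?thesis
    by (rule finite_combinationI[where a="\<lambda>i. b * a i"])
      (simp add: a sum_distrib_left mult.assoc)
qed

lemma yt_power_e:
  assumes "P \<in> S"
  shows "yt P ^ e = - (\<Sum>j<e. poly (smult (inverse \<kappa>) (coeff f j)) (xx P) * yt P ^ j)"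
proof -
  have lc: "coeff f e = [:\<kappa>:]"
    using degree_f by simp
  have "0 = (\<Sum>j\<le>e. poly (coeff f j) (xx P) * yt P ^ j)"
    using ev2_Y_expansion[of f e "xx P" "yt P"] degree_f(1) f_xx_yt[OF assms] by simp
  also have "\<dots> = (\<Sum>j<e. poly (coeff f j) (xx P) * yt P ^ j) + \<kappa> * yt P ^ e"
    by (simp add: lessThan_Suc_atMost[symmetric] lc)
  finally have "\<kappa> * yt P ^ e = - (\<Sum>j<e. poly (coeff f j) (xx P) * yt P ^ j)"
    by (simp add: eq_neg_iff_add_eq_0 add.commute)
  then have "inverse \<kappa> * (\<kappa> * yt P ^ e) = - (\<Sum>j<e. inverse \<kappa> * (poly (coeff f j) (xx P) * yt P ^ j))"
    by (simp add: sum_distrib_left)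
  moreover have "inverse \<kappa> * (\<kappa> * yt P ^ e) = yt P ^ e"
    using f_y(2) by (simp add: field_simps)
  ultimately show ?thesis
    by (simp add: mult.assoc)
qed

lemma finite_combination_yt_mult:
  assumes "finite_combination u"
  shows "finite_combination (\<lambda>P. yt P * u P)"
proof -
  obtain a where a: "\<forall>P\<in>S. u P = (\<Sum>i<e. E (a i) P * yt P ^ i)"
    by (rule finite_combinationE[OF assms(1)])
  obtain d where d: "e = Suc d"
    using e_pos gr0_conv_Suc by blast
  \<comment> \<open>Multiplication by y' shifts the coefficients; the overflow a(d) y'^e is
    rewritten by the equation of y'.\<close>
  define s where "s i = (case i of 0 \<Rightarrow> 0 | Suc k \<Rightarrow> a k)" for i
  show ?thesis
  proof (rule finite_combinationI[where a="\<lambda>i. s i - a d * [:smult (inverse \<kappa>) (coeff f i):]"])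
    fix P assume P: "P \<in> S"
    have "yt P * u P = (\<Sum>i<e. E (a i) P * yt P ^ Suc i)"
      by (simp add: a[rule_format, OF P] sum_distrib_left mult_ac)
    also have "\<dots> = (\<Sum>i<d. E (a i) P * yt P ^ Suc i) + E (a d) P * yt P ^ e"
      by (simp add: d)
    also have "(\<Sum>i<d. E (a i) P * yt P ^ Suc i) = (\<Sum>i<e. E (s i) P * yt P ^ i)"
      unfolding d sum.lessThan_Suc_shift by (simp add: s_def)
    also have "E (a d) P * yt P ^ e =
        - (\<Sum>i<e. E (a d) P * poly (smult (inverse \<kappa>) (coeff f i)) (xx P) * yt P ^ i)"
      by (simp add: yt_power_e[OF P] sum_distrib_left mult.assoc)
    finally show "yt P * u P =
        (\<Sum>i<e. E (s i - a d * [:smult (inverse \<kappa>) (coeff f i):]) P * yt P ^ i)"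
      by (simp add: left_diff_distrib sum_subtractf) (simp add: mult_ac)
  qed
qed

lemma finite_combination_power:
  assumes "\<And>P. P \<in> S \<Longrightarrow> w P = E a P * yt P + E b P"
  shows "finite_combination (\<lambda>P. w P ^ m)"
proof (induction m)
  case 0
  then show ?case using finite_combination_1 by simp
next
  case (Suc m)
  have "finite_combination (\<lambda>P. E a P * (yt P * w P ^ m) + E b P * w P ^ m)"
    by (intro finite_combination_add finite_combination_E_mult finite_combination_yt_mult Suc.IH)
  then obtain a' where a': "\<forall>P\<in>S.
      E a P * (yt P * w P ^ m) + E b P * w P ^ m = (\<Sum>i<e. E (a' i) P * yt P ^ i)"
    by (rule finite_combinationE)
  show ?case
  proof (rule finite_combinationI)
    fix P assume P: "P \<in> S"
    show "w P ^ Suc m = (\<Sum>i<e. E (a' i) P * yt P ^ i)"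
      unfolding a'[rule_format, OF P, symmetric] power_Suc by (simp add: assms[OF P] algebra_simps)
  qed
qed

text \<open>Only the powers y'^i with i < e occur, and g^e y'^i = V^i g^(e-i); so the exponent of g
  does not depend on u. All powers w^m share this denominator.\<close>

lemma clear_denominator:
  assumes "\<And>P. P \<in> S \<Longrightarrow> E g P * yt P = E V P" "finite_combination u"
  obtains A where "\<forall>P\<in>S. E g P ^ e * u P = E A P"
proof -
  obtain a where a: "\<forall>P\<in>S. u P = (\<Sum>i<e. E (a i) P * yt P ^ i)"
    by (rule finite_combinationE[OF assms(2)])
  have "E g P ^ e * u P = E (\<Sum>i<e. a i * V ^ i * g ^ (e - i)) P" if P: "P \<in> S" for P
  proof -
    have "E g P ^ e * (E (a i) P * yt P ^ i) = E (a i) P * E V P ^ i * E g P ^ (e - i)" if "i < e" for i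
    proof -
      have "E g P ^ e = E g P ^ i * E g P ^ (e - i)"
        using that by (simp flip: power_add)
      then show ?thesis
        by (simp add: assms(1)[OF P, symmetric] power_mult_distrib mult_ac)
    qed
    then have "(\<Sum>i<e. E g P ^ e * (E (a i) P * yt P ^ i)) = (\<Sum>i<e. E (a i) P * E V P ^ i * E g P ^ (e - i))"
      by (intro sum.cong) simp_all
    then show ?thesis
      by (simp only: a[rule_format, OF P] sum_distrib_left ev2_sum ev2_simps)
  qed
  then show ?thesis by (intro that[of "\<Sum>i<e. a i * V ^ i * g ^ (e - i)"]) (rule ballI)
qed

lemma clear_denominator_ev2:
  assumes "\<And>P. P \<in> S \<Longrightarrow> E g P * yt P = E V P"
  obtains n H where "\<forall>P\<in>S. E g P ^ n * ev2 q (xx P) (yt P) = E H P"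
proof -
  define n where "n = degree q"
  have "E g P ^ n * ev2 q (xx P) (yt P) = E (\<Sum>j\<le>n. [:coeff q j:] * V ^ j * g ^ (n - j)) P"
    if P: "P \<in> S" for P
  proof -
    have "E g P ^ n * (poly (coeff q j) (xx P) * yt P ^ j) =
        poly (coeff q j) (xx P) * E V P ^ j * E g P ^ (n - j)" if "j \<le> n" for j
    proof -
      have "E g P ^ n = E g P ^ j * E g P ^ (n - j)"
        using that by (simp flip: power_add)
      then show ?thesis
        by (simp add: assms(1)[OF P, symmetric] power_mult_distrib mult_ac)
    qed
    then have "(\<Sum>j\<le>n. E g P ^ n * (poly (coeff q j) (xx P) * yt P ^ j)) =
        (\<Sum>j\<le>n. poly (coeff q j) (xx P) * E V P ^ j * E g P ^ (n - j))"
      by (intro sum.cong) simp_all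
    then show ?thesis
      using ev2_Y_expansion[of q n "xx P" "yt P"] by (simp add: n_def sum_distrib_left mult.assoc)
  qed
  then show ?thesis by (intro that[of n "\<Sum>j\<le>n. [:coeff q j:] * V ^ j * g ^ (n - j)"]) (rule ballI)
qed

text \<open>
  The quotient \<open>w\<close> of the two linear functions is integral: both sides of the two norm equations
  \<open>f_h2\<close>, \<open>f_h3\<close> are the same multiple of \<open>x\<^sup>d\<close>, and \<open>H\<close> is invertible modulo \<open>y\<close>.
\<close>

lemma integral_quotient:
  assumes gV: "\<And>P. P \<in> S \<Longrightarrow> E g P * yt P = E V P" and g: "ev2 g 0 0 \<noteq> 0"
  obtains a b where "\<forall>P\<in>S. (E a P * yt P + E b P) * yy P = yt P + \<alpha> * xx P + \<beta>"
proof -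
  obtain n H where H: "\<forall>P\<in>S. E g P ^ n * ev2 h3 (xx P) (yt P) = E H P"
    by (rule clear_denominator_ev2[OF gV])
  obtain \<eta> H' where \<eta>: "H = pCons \<eta> H'" by (cases H)
  have "E H p2 \<noteq> 0"
    using H[rule_format, OF p2(1)] g h3_nz p2 by auto
  then have "poly \<eta> 0 \<noteq> 0"
    using p2 \<eta> by simp
  \<comment> \<open>Modulo y the polynomial H is \<eta>(x), which is invertible modulo x^(e+1); and
    x^(e+1) is itself a multiple of y on the curve by \<open>E_h2\<close>. So \<iota> inverts H
    modulo y.\<close>
  then obtain \<iota> where "[:0, 1:] ^ Suc e dvd 1 - \<iota> * \<eta>"
    by (rule inverse_mod_power)
  then obtain k where k: "1 - \<iota> * \<eta> = [:0, 1:] ^ Suc e * k" by blast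
  \<comment> \<open>\<open>a\<close> is the cofactor in the Bezout identity 1 = \<iota> H + a y on
    the curve. With u = y' + \<alpha> x + \<beta>, \<open>b\<close> is fixed so that a y' + b = a u
    + \<iota> g^n h2 c3 / c2; times y this is u (a y + \<iota> H) = u, since u h3(x, y') = (c3 / c2)
    y h2 and H = g^n h3(x, y').\<close>
  define a where "a = - ([:\<iota>:] * H' + [:smult (inverse c2) k:] * h2)"
  define b where "b = a * [:[:\<beta>, \<alpha>:]:] + [:\<iota>:] * g ^ n * h2 * [:[:c3 / c2:]:]"
  have "(E a P * yt P + E b P) * yy P = yt P + \<alpha> * xx P + \<beta>" if P: "P \<in> S" for P
  proof -
    define u where "u = yt P + \<alpha> * xx P + \<beta>"
    have xe: "xx P ^ Suc e = - (inverse c2 * (yy P * E h2 P))"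
    proof -
      have "c2 * xx P ^ Suc e = - (yy P * E h2 P)"
        using E_h2[OF P] by (metis add_eq_0_iff minus_equation_iff)
      then have "inverse c2 * (c2 * xx P ^ Suc e) = inverse c2 * (- (yy P * E h2 P))"
        by (rule arg_cong)
      then show ?thesis using c2_nz by (simp add: mult.assoc[symmetric])
    qed
    have "poly (1 - \<iota> * \<eta>) (xx P) = xx P ^ Suc e * poly k (xx P)"
      unfolding k by simp
    then have "1 = poly \<iota> (xx P) * poly \<eta> (xx P) - inverse c2 * (yy P * E h2 P) * poly k (xx P)"
      unfolding xe by (simp add: algebra_simps)
    moreover have "poly \<eta> (xx P) = E H P - yy P * E H' P"
      by (simp add: \<eta>)
    ultimately have bezout: "1 = poly \<iota> (xx P) * E H P + E a P * yy P"
      by (simp add: a_def algebra_simps)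
    have "c3 * xx P ^ Suc e + u * ev2 h3 (xx P) (yt P) = 0"
      using f_h3[of "xx P" "yt P"] f_xx_yt[OF P] by (simp only: u_def)
    then have "u * ev2 h3 (xx P) (yt P) = c3 * (inverse c2 * (yy P * E h2 P))"
      unfolding xe by (simp add: add_eq_0_iff2)
    then have norm: "c3 / c2 * (yy P * E h2 P) = u * ev2 h3 (xx P) (yt P)"
      by (simp add: divide_inverse mult.assoc)
    have "(E a P * yt P + E b P) * yy P =
        E a P * yy P * u + poly \<iota> (xx P) * E g P ^ n * (c3 / c2 * (yy P * E h2 P))"
      by (simp add: b_def u_def algebra_simps)
    also have "\<dots> = u * (poly \<iota> (xx P) * (E g P ^ n * ev2 h3 (xx P) (yt P)) + E a P * yy P)"
      unfolding norm by (simp add: algebra_simps)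
    also have "\<dots> = u"
      unfolding H[rule_format, OF P] bezout[symmetric] by simp
    finally show ?thesis unfolding u_def .
  qed
  then show ?thesis by (intro that[of a b]) (rule ballI)
qed

text \<open>
  The degree at the point at infinity: \<open>x\<close> and \<open>y\<close> have poles of order \<open>e\<close> and \<open>e + 1\<close> there,
  and \<open>\<zeta>\<close> is chosen such that the leading weighted part of \<open>f\<close> vanishes at \<open>(t\<^sup>e, \<zeta> t\<^sup>e\<^sup>+\<^sup>1)\<close>.
\<close>

definition \<zeta> :: 'k where "\<zeta> = (SOME z. z ^ e = - c / \<kappa>)"

lemma \<zeta>: "\<kappa> * \<zeta> ^ e + c = 0" "\<zeta> \<noteq> 0"
proof -
  have "\<zeta> ^ e = - c / \<kappa>"
    unfolding \<zeta>_def by (rule someI_ex) (rule nth_root_exists[OF e_pos])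
  then show *: "\<kappa> * \<zeta> ^ e + c = 0"
    using f_y(2) by simp
  show "\<zeta> \<noteq> 0"
    using * f_x(2) e_pos by (auto simp: power_0_left)
qed

section \<open>Pole orders at infinity\<close>

abbreviation weight_le :: "nat \<Rightarrow> 'k poly poly \<Rightarrow> bool" where "weight_le \<equiv> wle e (Suc e)"

abbreviation \<theta> :: "'k poly poly \<Rightarrow> 'k poly" where "\<theta> \<equiv> theta e (Suc e) \<zeta>"

text \<open>The order of the pole of \<open>a\<close> at the point at infinity. A representative r
  modulo f is needed, since the leading weighted part of \<open>a\<close> itself may vanish at (1,
  \<zeta>), as it does for f.\<close>

definition pole_order :: "nat \<Rightarrow> 'k poly poly \<Rightarrow> bool" where
  "pole_order N a \<longleftrightarrow> (\<exists>r. f dvd a - r \<and> weight_le N r \<and> coeff (\<theta> r) N \<noteq> 0)"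

lemma weight_f: "weight_le (e * Suc e) f"
  unfolding wle_def
proof (intro allI impI)
  fix i j assume "cf f i j \<noteq> 0"
  then have "i + j \<le> e \<or> i = Suc e \<and> j = 0"
    by (rule f_rest)
  then show "e * i + Suc e * j \<le> e * Suc e"
  proof
    assume "i + j \<le> e"
    then have "e * (i + j) \<le> e * e" "j \<le> e" by auto
    then show ?thesis by (simp add: algebra_simps)
  qed auto
qed

text \<open>The part of weight e (e + 1) is l = \<kappa> y^e + c x^(e+1), killed by the choice of
  \<zeta>. Every other monomial has i + j \<le> e and so weight e (i + j) + j, which is smaller
  unless j = e.\<close>

lemma \<theta>_f: "coeff (\<theta> f) (e * Suc e) = 0"
proof -
  define l where "l = monom [:\<kappa>:] e + [:monom c (Suc e):]"
  have cf_l: "cf l i j = (if i = 0 \<and> j = e then \<kappa> else 0) + (if i = Suc e \<and> j = 0 then c else 0)" for i j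
    unfolding l_def by (cases i; cases j) (auto simp: coeff_pCons)
  have "wle e (Suc e) (e * Suc e - 1) (f - l)"
    unfolding wle_def
  proof (intro allI impI)
    fix i j assume nz: "cf (f - l) i j \<noteq> 0"
    have "cf f i j \<noteq> 0"
      using nz e_pos f_x f_y by (auto simp: cf_l split: if_splits)
    then have "i + j \<le> e \<or> i = Suc e \<and> j = 0"
      by (rule f_rest)
    moreover have "cf (f - l) (Suc e) 0 = 0" "cf (f - l) 0 e = 0"
      using e_pos f_x(1) f_y(1) by (simp_all add: cf_l)
    then have "\<not> (i = Suc e \<and> j = 0)" "\<not> (i = 0 \<and> j = e)"
      using nz by metis+
    ultimately have ij: "i + j \<le> e" "\<not> (i = 0 \<and> j = e)" by auto
    have "e * i + Suc e * j < e * Suc e"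
    proof (cases "i + j = e")
      case True
      then have "e * i + Suc e * j = e * e + j"
        by (metis add.commute add.left_commute add_mult_distrib2 mult_Suc)
      then show ?thesis using True ij by auto
    next
      case False
      then have "Suc (i + j) \<le> e" using ij by simp
      then have "e * Suc (i + j) \<le> e * e" by (rule mult_le_mono2)
      then show ?thesis using ij e_pos by (simp add: algebra_simps)
    qed
    then show "e * i + Suc e * j \<le> e * Suc e - 1" by simp
  qed
  then have "coeff (\<theta> (f - l)) (e * Suc e) = 0"
    using e_pos by (intro coeff_theta_gt) auto
  moreover have "\<theta> l = 0"
  proof (rule poly_eqI_alg_closed)
    fix t
    have "poly (\<theta> l) t = (\<kappa> * \<zeta> ^ e + c) * t ^ (e * Suc e)"
      by (simp add: poly_theta l_def ev2_def poly_monom power_mult_distrib distrib_right power_add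
          flip: power_mult)
    then show "poly (\<theta> l) t = poly 0 t"
      by (simp add: \<zeta>)
  qed
  ultimately show ?thesis by (simp add: theta_diff)
qed

text \<open>Independence of the representative. Otherwise r - b = q f would have a nonzero
  coefficient at N after the substitution; but by \<open>wle_factor\<close> the weights of q and f
  add up to N, so this coefficient is a multiple of the one of f at its own weight, which is
  0.\<close>

lemma pole_order_le:
  assumes "f dvd a - b" "pole_order N a" "weight_le M b"
  shows "N \<le> M"
proof (rule ccontr)
  assume "\<not> N \<le> M"
  obtain r where r: "f dvd a - r" "weight_le N r" "coeff (\<theta> r) N \<noteq> 0"
    using assms(2) unfolding pole_order_def by (elim exE conjE)
  have "(a - b) - (a - r) = r - b"
    by simp
  then have "f dvd r - b"
    using dvd_diff[OF assms(1) r(1)] by simp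
  then obtain q where "r - b = f * q" ..
  then have q: "r - b = q * f"
    by (simp only: mult.commute)
  have coeff: "coeff (\<theta> (q * f)) N \<noteq> 0"
    unfolding q[symmetric] theta_diff
    using r(3) coeff_theta_gt[OF assms(3), of N \<zeta>] \<open>\<not> N \<le> M\<close> by simp
  then have "q \<noteq> 0"
    by (auto simp: theta_def)
  have "weight_le N (r - b)"
    using \<open>\<not> N \<le> M\<close> by (intro wle_diff r(2) wle_mono[OF assms(3)]) simp
  then have w: "weight_le N (q * f)"
    by (simp only: q)
  have fe: "cf f 0 e \<noteq> 0" "e * 0 + Suc e * e = e * Suc e"
    using f_y by simp_all
  note wf = wle_factor[OF e_pos \<open>q \<noteq> 0\<close> fe weight_f w]
  then have "coeff (\<theta> (q * f)) N = 0"
    using coeff_mult_at_bounds[OF degree_theta_le[OF wf(2)] degree_theta_le[OF weight_f], of \<zeta> \<zeta>]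
    by (simp only: theta_mult \<theta>_f mult_zero_right le_add_diff_inverse2)
  with coeff show False by blast
qed

lemma pole_order_mult: "pole_order N a \<Longrightarrow> pole_order M b \<Longrightarrow> pole_order (N + M) (a * b)"
proof -
  assume "pole_order N a" "pole_order M b"
  then obtain r s where r: "f dvd a - r" "weight_le N r" "coeff (\<theta> r) N \<noteq> 0"
    and s: "f dvd b - s" "weight_le M s" "coeff (\<theta> s) M \<noteq> 0"
    unfolding pole_order_def by (elim exE conjE)
  have "a * b - r * s = (a - r) * b + r * (b - s)"
    by (simp add: algebra_simps)
  then have "f dvd a * b - r * s"
    using r(1) s(1) by simp
  moreover have "coeff (\<theta> (r * s)) (N + M) \<noteq> 0"
    using coeff_mult_at_bounds[OF degree_theta_le[OF r(2)] degree_theta_le[OF s(2)], of \<zeta> \<zeta>] r(3) s(3)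
    by (simp add: theta_mult)
  ultimately show ?thesis
    unfolding pole_order_def using wle_mult[OF r(2) s(2)] by blast
qed

lemma pole_order_const: "r \<noteq> 0 \<Longrightarrow> pole_order 0 [:[:r:]:]"
  unfolding pole_order_def
  by (rule exI[of _ "[:[:r:]:]"]) (simp add: wle_const coeff_theta)

lemma pole_order_power: "pole_order N a \<Longrightarrow> pole_order (n * N) (a ^ n)"
proof (induction n)
  case 0
  then show ?case using pole_order_const[of 1] by (simp flip: one_pCons)
next
  case (Suc n)
  then show ?case using pole_order_mult[of N a "n * N" "a ^ n"] by simp
qed

lemma pole_order_Y: "pole_order (Suc e) [:0, 1:]"
proof -
  have "\<theta> [:0, 1:] = monom \<zeta> (Suc e)"
    by (rule poly_eqI_alg_closed) (simp add: poly_theta poly_monom)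
  moreover have "weight_le (Suc e) [:0, 1:]"
    by (rule wle_pCons) (auto simp: wle_one simp flip: one_pCons)
  ultimately show ?thesis
    unfolding pole_order_def using \<zeta>(2) by (intro exI[of _ "[:0, 1:]"]) simp
qed

text \<open>The remainder modulo f has y-degree below e, and monomials of y-degree below e have
  pairwise distinct weights, as e i + (e + 1) j is j modulo e. So its leading weighted part is a
  single monomial, which cannot vanish at (1, \<zeta>).\<close>

lemma pole_order_exists:
  assumes "\<not> f dvd a"
  obtains N where "pole_order N a"
proof -
  obtain q r where qr: "pseudo_divmod a f = (q, r)"
    by (metis surj_pair)
  define n where "n = Suc (degree a) - degree f"
  have "smult ([:\<kappa>:] ^ n) a = f * q + r" and "r = 0 \<or> degree r < e"
    using pseudo_divmod[OF f_nz qr] degree_f by (simp_all add: n_def)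
  moreover have "[:\<kappa>:] ^ n = [:\<kappa> ^ n:]"
    by (induction n) (simp_all add: one_pCons)
  ultimately have div: "smult [:\<kappa> ^ n:] a = f * q + r" and deg: "r = 0 \<or> degree r < e"
    by simp_all
  define r' where "r' = smult [:inverse (\<kappa> ^ n):] r"
  have "a = smult [:inverse (\<kappa> ^ n):] (smult [:\<kappa> ^ n:] a)"
    using f_y(2) by (simp flip: one_pCons)
  also have "\<dots> = f * smult [:inverse (\<kappa> ^ n):] q + r'"
    unfolding div by (simp add: smult_add_right r'_def)
  finally have a: "a - r' = f * smult [:inverse (\<kappa> ^ n):] q"
    by simp
  have "r' \<noteq> 0"
    using assms a by (metis dvd_triv_left diff_0_right)
  then have "r \<noteq> 0"
    unfolding r'_def by auto
  then have deg': "degree r' < e"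
    using deg degree_smult_le[of "[:inverse (\<kappa> ^ n):]" r] unfolding r'_def by simp
  obtain N i0 j0 where N: "weight_le N r'" "cf r' i0 j0 \<noteq> 0" "e * i0 + Suc e * j0 = N"
    by (rule exact_weight[OF \<open>r' \<noteq> 0\<close>])
  have le: "j0 \<le> degree r'" "i0 \<le> degree (coeff r' j0)"
    using N(2) by (auto intro: le_degree)
  then have "j0 < e"
    using deg' by simp
  have uniq: "i = i0 \<and> j = j0" if "j < e" "e * i + Suc e * j = N" for i j
  proof -
    have "e * i + Suc e * j = e * i0 + Suc e * j0"
      by (simp only: that(2) N(3))
    then have "j + e * (i + j) = j0 + e * (i0 + j0)"
      by (simp add: algebra_simps)
    then have "(j + e * (i + j)) mod e = (j0 + e * (i0 + j0)) mod e"
      by (rule arg_cong)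
    then have "j = j0"
      using that(1) \<open>j0 < e\<close> by simp
    moreover from this have "e * i = e * i0"
      using that(2) N(3) by (metis add_right_cancel)
    ultimately show ?thesis using e_pos by simp
  qed
  have "coeff (\<theta> r') N = (\<Sum>j\<le>degree r'. \<Sum>i\<le>degree (coeff r' j).
      if j = j0 then if i = i0 then cf r' i j * \<zeta> ^ j else 0 else 0)"
    unfolding coeff_theta
  proof (intro sum.cong refl)
    fix j i assume "j \<in> {..degree r'}"
    then have "j < e" using deg' by simp
    have "e * i + Suc e * j = N \<longleftrightarrow> j = j0 \<and> i = i0"
      using uniq[OF \<open>j < e\<close>, of i] N(3) by metis
    then show "(if e * i + Suc e * j = N then cf r' i j * \<zeta> ^ j else 0) =
        (if j = j0 then if i = i0 then cf r' i j * \<zeta> ^ j else 0 else 0)"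
      by simp
  qed
  also have "\<dots> = (\<Sum>j\<le>degree r'. if j = j0 then
      \<Sum>i\<le>degree (coeff r' j). if i = i0 then cf r' i j * \<zeta> ^ j else 0 else 0)"
    by (intro sum.cong) auto
  also have "\<dots> = cf r' i0 j0 * \<zeta> ^ j0"
    using le by simp
  finally have "coeff (\<theta> r') N \<noteq> 0"
    using N(2) \<zeta>(2) by simp
  then have "pole_order N a"
    unfolding pole_order_def using N(1) dvd_triv_left[of f] a by metis
  then show ?thesis by (rule that)
qed

end

section \<open>The quotient of the two linear functions is constant\<close>

context plane_model
begin

lemma f_dvd_diff_iff: "f dvd a - b \<longleftrightarrow> (\<forall>P\<in>S. E a P = E b P)"
  by (simp add: f_dvd_iff)

text \<open>\<open>V / g\<close> is a root of \<open>f(x, \<cdot>)\<close>, so its pole order cannot exceed that of \<open>y\<close>.\<close>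

lemma yt_pole_bound:
  assumes gV: "\<And>P. P \<in> S \<Longrightarrow> E g P * yt P = E V P"
    and rg: "f dvd g - rg" "weight_le \<delta> rg"
  obtains rV where "f dvd V - rV" "weight_le (\<delta> + Suc e) rV"
proof (cases "f dvd V")
  case True
  then show ?thesis by (intro that[of 0]) simp_all
next
  case False
  obtain \<nu> where \<nu>: "pole_order \<nu> V"
    by (rule pole_order_exists[OF False])
  then obtain rV where rV: "f dvd V - rV" "weight_le \<nu> rV" "coeff (\<theta> rV) \<nu> \<noteq> 0"
    unfolding pole_order_def by (elim exE conjE)
  have "\<nu> \<le> \<delta> + Suc e"
  proof (rule ccontr)
    assume "\<not> \<nu> \<le> \<delta> + Suc e"
    then have big: "\<delta> + Suc e < \<nu>" by simp
    \<comment> \<open>Multiplying f(x, y') = 0 by g^e gives \<kappa> V^e = - T with V = g y'; T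
      collects the lower powers of y'.\<close>
    define T where "T = (\<Sum>j<e. [:coeff f j:] * rV ^ j * rg ^ (e - j))"
    have "f dvd [:[:\<kappa>:]:] * V ^ e - (0 - T)"
      unfolding f_dvd_diff_iff
    proof
      fix P assume P: "P \<in> S"
      have rVP: "E rV P = E g P * yt P" "E rg P = E g P"
        using rV(1)[unfolded f_dvd_diff_iff] rg(1)[unfolded f_dvd_diff_iff] P gV[OF P] by simp_all
      have "E T P = (\<Sum>j<e. E g P ^ e * (poly (coeff f j) (xx P) * yt P ^ j))"
        unfolding T_def ev2_sum
      proof (rule sum.cong[OF refl])
        fix j assume "j \<in> {..<e}"
        then have "E g P ^ e = E g P ^ j * E g P ^ (e - j)"
          by (simp flip: power_add)
        then show "E ([:coeff f j:] * rV ^ j * rg ^ (e - j)) P =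
            E g P ^ e * (poly (coeff f j) (xx P) * yt P ^ j)"
          by (simp add: rVP power_mult_distrib mult_ac)
      qed
      also have "\<dots> = E g P ^ e * (\<Sum>j<e. poly (coeff f j) (xx P) * yt P ^ j)"
        by (simp add: sum_distrib_left)
      finally have T: "E T P = E g P ^ e * (\<Sum>j<e. poly (coeff f j) (xx P) * yt P ^ j)" .
      have "coeff f e = [:\<kappa>:]"
        using degree_f by simp
      then have "0 = (\<Sum>j<e. poly (coeff f j) (xx P) * yt P ^ j) + \<kappa> * yt P ^ e"
        using ev2_Y_expansion[of f e "xx P" "yt P"] degree_f(1) f_xx_yt[OF P]
        by (simp add: lessThan_Suc_atMost[symmetric])
      then have "E g P ^ e * 0 = E g P ^ e * ((\<Sum>j<e. poly (coeff f j) (xx P) * yt P ^ j) + \<kappa> * yt P ^ e)"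
        by (rule arg_cong)
      also have "\<dots> = E T P + \<kappa> * (E g P * yt P) ^ e"
        unfolding T power_mult_distrib distrib_left by (simp only: mult.left_commute)
      finally have "\<kappa> * E V P ^ e = - E T P"
        unfolding gV[OF P] by (simp add: eq_neg_iff_add_eq_0 add.commute)
      then show "E ([:[:\<kappa>:]:] * V ^ e) P = E (0 - T) P"
        by simp
    qed
    moreover have "pole_order (0 + e * \<nu>) ([:[:\<kappa>:]:] * V ^ e)"
      by (intro pole_order_mult pole_order_const pole_order_power f_y \<nu>)
    moreover have "weight_le (e * \<nu> - 1) (0 - T)"
    proof (rule wle_diff, simp, unfold T_def, rule wle_sum)
      fix j assume j: "j \<in> {..<e}"
      then obtain k where k: "e = j + k" "k > 0"
        by (metis lessThan_iff less_imp_add_positive)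
      have kb: "k * (e + \<delta>) < k * \<nu>"
        using big k(2) by simp
      \<comment> \<open>In f the coefficient of y^j has degree at most k = e - j in x, except for
        x^(e+1) at j = 0. Both bounds keep the term of T below e \<nu> once \<nu> > \<delta> + e +
        1.\<close>
      have "weight_le ((if j = 0 then e * Suc e else e * k) + j * \<nu> + k * \<delta>)
          ([:coeff f j:] * rV ^ j * rg ^ (e - j))"
      proof (intro wle_mult)
        show "weight_le (if j = 0 then e * Suc e else e * k) [:coeff f j:]"
        proof (rule wle_const_coeff)
          fix i assume "cf f i j \<noteq> 0"
          then have "i + j \<le> e \<or> i = Suc e \<and> j = 0"
            by (rule f_rest)
          then have "i \<le> (if j = 0 then Suc e else k)"
            using k(1) by auto
          then show "e * i \<le> (if j = 0 then e * Suc e else e * k)"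
            by (auto simp del: mult_Suc_right split: if_splits intro: mult_le_mono2)
        qed
        show "weight_le (j * \<nu>) (rV ^ j)"
          by (rule wle_power[OF rV(2)])
        show "weight_le (k * \<delta>) (rg ^ (e - j))"
          using wle_power[OF rg(2), of k] k(1) by simp
      qed
      moreover have "(if j = 0 then e * Suc e else e * k) + j * \<nu> + k * \<delta> < e * \<nu>"
      proof (cases "j = 0")
        case True
        have "e * (Suc e + \<delta>) < e * \<nu>"
          using big e_pos by (simp only: mult_less_cancel1 add.commute simp_thms)
        then show ?thesis using True k(1) by (simp add: distrib_left)
      next
        case False
        have "e * k + k * \<delta> < k * \<nu>"
          using kb by (simp add: algebra_simps)
        then have "e * k + j * \<nu> + k * \<delta> < j * \<nu> + k * \<nu>"
          by simp
        also have "\<dots> = e * \<nu>"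
          by (simp add: k(1) algebra_simps)
        finally show ?thesis using False by simp
      qed
      ultimately show "weight_le (e * \<nu> - 1) ([:coeff f j:] * rV ^ j * rg ^ (e - j))"
        by (elim wle_mono) simp
    qed
    ultimately have "0 + e * \<nu> \<le> e * \<nu> - 1"
      by (rule pole_order_le)
    moreover have "0 < e * \<nu>"
      using big e_pos by simp
    ultimately show False by linarith
  qed
  with rV(2) have "weight_le (\<delta> + Suc e) rV"
    by (rule wle_mono)
  with rV(1) show ?thesis
    by (rule that)
qed

text \<open>\<open>p\<close> splits into linear factors over an algebraically closed field, and in a
  domain of functions one of the factors w - r must vanish on all of \<open>S\<close>.\<close>

lemma algebraic_imp_constant:
  assumes "w \<in> R" "p \<noteq> 0" "\<And>P. P \<in> S \<Longrightarrow> poly p (w P) = 0"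
  shows "\<exists>r. \<forall>P\<in>S. w P = r"
  using assms(2,3)
proof (induction "degree p" arbitrary: p)
  case 0
  then obtain r where "p = [:r:]"
    by (metis degree_eq_zeroE)
  then show ?case
    using 0 p2(1) by auto
next
  case (Suc n)
  then obtain r where "poly p r = 0"
    using alg_closed_imp_poly_has_root[of p] by auto
  then obtain q where q: "p = [:- r, 1:] * q"
    using poly_eq_0_iff_dvd by blast
  then have "q \<noteq> 0" using Suc.prems(1) by auto
  then have "degree p = degree [:- r, 1:] + degree q"
    unfolding q by (intro degree_mult_eq) auto
  then have deg: "n = degree q"
    using Suc.hyps(2) by simp
  have "(\<lambda>P. w P - r) \<in> R"
    by (rule R_diff[OF assms(1) R_const])
  moreover have "(\<lambda>P. poly q (w P)) \<in> R"
    by (rule R_poly[OF assms(1)])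
  moreover have "\<forall>P\<in>S. (w P - r) * poly q (w P) = 0"
  proof
    fix P assume "P \<in> S"
    then have "poly p (w P) = 0"
      by (rule Suc.prems(2))
    then show "(w P - r) * poly q (w P) = 0"
      by (simp add: q algebra_simps)
  qed
  ultimately have "(\<forall>P\<in>S. w P - r = 0) \<or> (\<forall>P\<in>S. poly q (w P) = 0)"
    by (rule R_domain)
  then show ?case
  proof
    assume "\<forall>P\<in>S. w P - r = 0"
    then have "\<forall>P\<in>S. w P = r" by simp
    then show ?thesis ..
  next
    assume *: "\<forall>P\<in>S. poly q (w P) = 0"
    show ?thesis
      by (rule Suc.hyps(1)[OF deg \<open>q \<noteq> 0\<close>]) (use * in simp)
  qed
qed

theorem translate_proportional: "\<exists>r. \<forall>P\<in>S. yt P + \<alpha> * xx P + \<beta> = r * yy P"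
proof -
  obtain g V where g: "ev2 g 0 0 \<noteq> 0" and gV: "\<And>P. P \<in> S \<Longrightarrow> E g P * yt P = E V P"
    by (rule yt_regular_at_p2) (rule that)
  obtain a b where ab: "\<forall>P\<in>S. (E a P * yt P + E b P) * yy P = yt P + \<alpha> * xx P + \<beta>"
    by (rule integral_quotient[OF gV g])
  define w where "w P = E a P * yt P + E b P" for P
  have w_R: "w \<in> R"
    unfolding w_def by (rule R_add[OF R_mult[OF E_in_R in_R(3)] E_in_R])
  have w_yy: "w P * yy P = yt P + \<alpha> * xx P + \<beta>" if "P \<in> S" for P
    using ab that by (simp add: w_def)
  have "\<exists>A. \<forall>P\<in>S. E g P ^ e * w P ^ m = E A P" for m
  proof -
    have fc: "finite_combination (\<lambda>P. w P ^ m)"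
      by (rule finite_combination_power) (rule w_def)
    obtain A where "\<forall>P\<in>S. E g P ^ e * w P ^ m = E A P"
      by (rule clear_denominator[OF gV fc])
    then show ?thesis ..
  qed
  then have "\<exists>A. \<forall>m. \<forall>P\<in>S. E g P ^ e * w P ^ m = E (A m) P"
    by (intro choice allI)
  then obtain A where A: "\<forall>m. \<forall>P\<in>S. E g P ^ e * w P ^ m = E (A m) P" ..
  have "\<not> f dvd g"
    using f_dvd_iff g p2 by metis
  then obtain \<delta> where \<delta>: "pole_order \<delta> g"
    by (rule pole_order_exists)
  then obtain rg where rg: "f dvd g - rg" "weight_le \<delta> rg" "coeff (\<theta> rg) \<delta> \<noteq> 0"
    unfolding pole_order_def by (elim exE conjE)
  obtain rV where rV: "f dvd V - rV" "weight_le (\<delta> + Suc e) rV"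
    by (rule yt_pole_bound[OF gV rg(1,2)])
  \<comment> \<open>On the curve \<open>rU\<close> equals g u with u = y' + \<alpha> x + \<beta>;
    its weight is bounded by \<delta> + e + 1, which is the pole order of g y.\<close>
  define rU where "rU = rV + [:[:\<beta>, \<alpha>:]:] * rg"
  have "weight_le (Suc e) [:[:\<beta>, \<alpha>:]:]"
    by (rule wle_const_coeff) (auto simp: coeff_pCons split: nat.splits)
  then have rU_weight: "weight_le (\<delta> + Suc e) rU"
    unfolding rU_def using wle_mult[OF _ rg(2), of "Suc e" "[:[:\<beta>, \<alpha>:]:]"]
    by (intro wle_add rV(2)) (simp add: add.commute)
  have E_rg: "E rg P = E g P" and E_rU: "E rU P = E g P * (yt P + \<alpha> * xx P + \<beta>)" if "P \<in> S" for P
    using rg(1) rV(1) gV[OF that, symmetric] that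
    by (simp_all add: f_dvd_diff_iff rU_def algebra_simps)
  \<comment> \<open>The identity g^m (g^e w^m) y^m = g^e (g u)^m bounds the pole order N of
    \<open>A m\<close>: the contributions proportional to m cancel and leave N \<le> e \<delta>,
    uniformly in m.\<close>
  have "\<exists>r. f dvd A m - r \<and> weight_le (e * \<delta>) r" for m
  proof (cases "f dvd A m")
    case True
    then show ?thesis by (intro exI[of _ 0]) simp
  next
    case False
    then obtain N where N: "pole_order N (A m)"
      by (rule pole_order_exists)
    have "f dvd g ^ m * A m * [:0, 1:] ^ m - rg ^ e * rU ^ m"
      unfolding f_dvd_diff_iff
    proof
      fix P assume P: "P \<in> S"
      have "E (g ^ m * A m * [:0, 1:] ^ m) P = E g P ^ m * (E g P ^ e * w P ^ m) * yy P ^ m"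
        using A P by simp
      also have "\<dots> = E g P ^ e * (E g P * (w P * yy P)) ^ m"
        by (simp add: power_mult_distrib mult_ac)
      also have "\<dots> = E (rg ^ e * rU ^ m) P"
        using w_yy[OF P] E_rg[OF P] E_rU[OF P] by simp
      finally show "E (g ^ m * A m * [:0, 1:] ^ m) P = E (rg ^ e * rU ^ m) P" .
    qed
    moreover have "pole_order (m * \<delta> + N + m * Suc e) (g ^ m * A m * [:0, 1:] ^ m)"
      by (intro pole_order_mult pole_order_power \<delta> N pole_order_Y)
    moreover have "weight_le (e * \<delta> + m * (\<delta> + Suc e)) (rg ^ e * rU ^ m)"
      by (intro wle_mult wle_power rg(2) rU_weight)
    ultimately have "m * \<delta> + N + m * Suc e \<le> e * \<delta> + m * (\<delta> + Suc e)"
      by (rule pole_order_le)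
    then have "N \<le> e * \<delta>"
      by (simp add: algebra_simps)
    obtain r where "f dvd A m - r" "weight_le N r"
      using N unfolding pole_order_def by (elim exE conjE)
    then show ?thesis
      using wle_mono[OF _ \<open>N \<le> e * \<delta>\<close>] by blast
  qed
  then have "\<exists>r. \<forall>m. f dvd A m - r m \<and> weight_le (e * \<delta>) (r m)"
    by (intro choice allI)
  then obtain r where r: "\<forall>m. f dvd A m - r m \<and> weight_le (e * \<delta>) (r m)" ..
  \<comment> \<open>The representatives of all g^e w^m lie in one finite-dimensional space, and a
    linear relation between them is a polynomial p with g^e p(w) = 0.\<close>
  obtain p :: "'k poly" where p: "p \<noteq> 0" "(\<Sum>m\<le>degree p. smult [:coeff p m:] (r m)) = 0"
    by (rule wle_linear_dependence[OF e_pos, of "Suc e" "e * \<delta>" r]) (use r in auto)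
  have "E (g ^ e) P * poly p (w P) = 0" if P: "P \<in> S" for P
  proof -
    have "0 = E (\<Sum>m\<le>degree p. smult [:coeff p m:] (r m)) P"
      by (simp add: p(2))
    also have "\<dots> = (\<Sum>m\<le>degree p. coeff p m * E (r m) P)"
      by simp
    also have "\<dots> = (\<Sum>m\<le>degree p. coeff p m * (E g P ^ e * w P ^ m))"
    proof (rule sum.cong[OF refl])
      fix m
      have "E (A m) P = E (r m) P"
        using r P f_dvd_diff_iff by blast
      then show "coeff p m * E (r m) P = coeff p m * (E g P ^ e * w P ^ m)"
        using A P by simp
    qed
    also have "\<dots> = E (g ^ e) P * poly p (w P)"
      by (simp add: poly_altdef sum_distrib_left mult_ac)
    finally show ?thesis by simp
  qed
  moreover have "\<exists>P\<in>S. E (g ^ e) P \<noteq> 0"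
    using g p2 by (intro bexI[of _ p2]) simp_all
  ultimately have "poly p (w P) = 0" if "P \<in> S" for P
    using R_cancel[OF E_in_R R_poly[OF w_R] _ _ that, of "g ^ e" p] by simp
  then obtain r where "\<forall>P\<in>S. w P = r"
    using algebraic_imp_constant[OF w_R p(1)] by auto
  then show ?thesis
    using w_yy by (intro exI[of _ r]) auto
qed

end

section \<open>Forms as functions\<close>

text \<open>Polynomial functions in place of forms make sums, products and linear substitutions
  immediate. Ternary forms over an algebraically closed field are recovered from their functions by
  \<open>mp_eval_inject\<close>.\<close>

definition form_fun :: "nat \<Rightarrow> ('k::field ^ 'n::finite \<Rightarrow> 'k) \<Rightarrow> bool" where
  "form_fun d h \<longleftrightarrow> (\<exists>F. homogeneous d F \<and> h = mp_eval F)"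

lemma form_funI: "homogeneous d F \<Longrightarrow> form_fun d (mp_eval F)"
  by (auto simp: form_fun_def)

lemma form_funE:
  assumes "form_fun d h"
  obtains F where "homogeneous d F" "\<And>v. h v = mp_eval F v"
  using assms by (auto simp: form_fun_def)

lemma form_fun_const: "form_fun 0 (\<lambda>_. r)"
  unfolding form_fun_def
  by (intro exI[of _ "Poly_Mapping.single 0 r"])
    (auto simp: homogeneous_def mp_eval_single mono_eval_def fun_eq_iff)

lemma form_fun_zero: "form_fun d (\<lambda>_. 0)"
  unfolding form_fun_def by (intro exI[of _ 0]) (auto simp: homogeneous_def fun_eq_iff)

lemma form_fun_add: "form_fun d h \<Longrightarrow> form_fun d h' \<Longrightarrow> form_fun d (\<lambda>v. h v + h' v)"
proof -
  assume "form_fun d h" "form_fun d h'"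
  then obtain F G where "homogeneous d F" "h = mp_eval F" "homogeneous d G" "h' = mp_eval G"
    by (auto simp: form_fun_def)
  moreover from this have "homogeneous d (F + G)"
    using Poly_Mapping.keys_add[of F G] by (auto simp: homogeneous_def)
  ultimately show ?thesis
    unfolding form_fun_def by (intro exI[of _ "F + G"]) (auto simp: mp_eval_add)
qed

lemma form_fun_mult: "form_fun d h \<Longrightarrow> form_fun e h' \<Longrightarrow> form_fun (d + e) (\<lambda>v. h v * h' v)"
proof -
  assume "form_fun d h" "form_fun e h'"
  then obtain F G where "homogeneous d F" "h = mp_eval F" "homogeneous e G" "h' = mp_eval G"
    by (auto simp: form_fun_def)
  then show ?thesis
    unfolding form_fun_def by (intro exI[of _ "F * G"]) (auto simp: mp_eval_mult homogeneous_mult)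
qed

lemma form_fun_sum: "(\<And>i. i \<in> A \<Longrightarrow> form_fun d (h i)) \<Longrightarrow> form_fun d (\<lambda>v. \<Sum>i\<in>A. h i v)"
  by (induction A rule: infinite_finite_induct) (simp_all add: form_fun_zero form_fun_add)

lemma form_fun_power: "form_fun d h \<Longrightarrow> form_fun (n * d) (\<lambda>v. h v ^ n)"
proof (induction n)
  case 0
  then show ?case using form_fun_const[of 1] by simp
next
  case (Suc n)
  then show ?case using form_fun_mult[of d h "n * d" "\<lambda>v. h v ^ n"] by simp
qed

lemma form_fun_prod:
  "(\<And>i. i \<in> A \<Longrightarrow> form_fun (d i) (h i)) \<Longrightarrow> form_fun (\<Sum>i\<in>A. d i) (\<lambda>v. \<Prod>i\<in>A. h i v)"
proof (induction A rule: infinite_finite_induct)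
  case (insert i A)
  then show ?case
    using form_fun_mult[of "d i" "h i" "\<Sum>i\<in>A. d i" "\<lambda>v. \<Prod>i\<in>A. h i v"] by simp
qed (use form_fun_const[of 1] in simp_all)

lemma form_fun_cmult: "form_fun d h \<Longrightarrow> form_fun d (\<lambda>v. r * h v)"
  using form_fun_mult[OF form_fun_const, of d h r] by simp

lemma form_fun_coord: "form_fun 1 (\<lambda>v :: 'k::field ^ 'n::finite. v $ i)"
  unfolding form_fun_def
proof (intro exI conjI)
  have "mono_eval (Poly_Mapping.single i 1) v = v $ i" for v :: "'k ^ 'n"
  proof -
    have "mono_eval (Poly_Mapping.single i 1) v = (\<Prod>j\<in>UNIV. if j = i then v $ i else 1)"
      unfolding mono_eval_def by (intro prod.cong) (auto simp: lookup_single when_def)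
    then show ?thesis by simp
  qed
  then show "(\<lambda>v :: 'k ^ 'n. v $ i) = mp_eval (Poly_Mapping.single (Poly_Mapping.single i 1) 1)"
    by (simp add: mp_eval_single fun_eq_iff del: One_nat_def)
  show "homogeneous 1 (Poly_Mapping.single (Poly_Mapping.single i 1) 1)"
    by (simp add: homogeneous_def lookup_single when_def)
qed

lemma form_fun_linear: "form_fun 1 (\<lambda>v. \<Sum>i\<in>UNIV. a i * v $ i)"
  by (intro form_fun_sum form_fun_cmult form_fun_coord)

lemma form_fun_compose:
  assumes "form_fun d h" "\<And>i. form_fun e (\<lambda>v. l v $ i)"
  shows "form_fun (d * e) (\<lambda>v. h (l v))"
proof -
  obtain F where F: "homogeneous d F" "\<And>v. h v = mp_eval F v"
    by (rule form_funE[OF assms(1)]) (rule that)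
  have "form_fun (d * e) (\<lambda>v. \<Sum>m\<in>Poly_Mapping.keys F. Poly_Mapping.lookup F m * mono_eval m (l v))"
  proof (intro form_fun_sum form_fun_cmult)
    fix m assume "m \<in> Poly_Mapping.keys F"
    then have "d = (\<Sum>i\<in>UNIV. Poly_Mapping.lookup m i)"
      using F(1) by (simp add: homogeneous_def)
    then have de: "d * e = (\<Sum>i\<in>UNIV. Poly_Mapping.lookup m i * e)"
      by (simp add: sum_distrib_right)
    show "form_fun (d * e) (\<lambda>v. mono_eval m (l v))"
      unfolding mono_eval_def de
      by (rule form_fun_prod) (rule form_fun_power[OF assms(2)])
  qed
  then show ?thesis
    by (simp add: F(2) mp_eval_def)
qed

lemma mono_eval_scale: "mono_eval m (c *s v) = c ^ (\<Sum>i\<in>UNIV. Poly_Mapping.lookup m i) * mono_eval m v"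
  by (simp add: mono_eval_def power_mult_distrib prod.distrib power_sum)

lemma form_fun_scale: "form_fun d h \<Longrightarrow> h (c *s v) = c ^ d * h v"
proof -
  assume "form_fun d h"
  then obtain F where F: "homogeneous d F" "h = mp_eval F"
    by (auto simp: form_fun_def)
  then show ?thesis
    unfolding F(2) mp_eval_def sum_distrib_left
    by (intro sum.cong) (auto simp: mono_eval_scale homogeneous_def mult_ac)
qed

lemma homogeneous_scale: "homogeneous d F \<Longrightarrow> mp_eval F (c *s v) = c ^ d * mp_eval F v"
  using form_fun_scale[OF form_funI] .

lemma homogeneous_1_linear:
  assumes "homogeneous 1 F"
  obtains a where "\<And>v. mp_eval F v = (\<Sum>i\<in>UNIV. a i * v $ i)"
proof -
  have "\<exists>i. m = Poly_Mapping.single i 1" if m: "m \<in> Poly_Mapping.keys F" for m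
  proof -
    have 1: "(\<Sum>i\<in>UNIV. Poly_Mapping.lookup m i) = 1"
      using assms m by (simp add: homogeneous_def)
    then obtain i where i: "Poly_Mapping.lookup m i = 1" "\<And>j. j \<noteq> i \<Longrightarrow> Poly_Mapping.lookup m j = 0"
      using sum_eq_1_iff[of UNIV "Poly_Mapping.lookup m"] by auto
    then show ?thesis
      by (intro exI[of _ i] poly_mapping_eqI) (auto simp: lookup_single when_def)
  qed
  then obtain \<iota> where \<iota>: "\<And>m. m \<in> Poly_Mapping.keys F \<Longrightarrow> m = Poly_Mapping.single (\<iota> m) 1"
    by metis
  have mono: "mono_eval m v = v $ \<iota> m" if "m \<in> Poly_Mapping.keys F" for m v
  proof -
    have "mono_eval m v = (\<Prod>j\<in>UNIV. if j = \<iota> m then v $ j else 1)"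
      unfolding mono_eval_def using \<iota>[OF that]
      by (intro prod.cong refl) (metis lookup_single_eq lookup_single_not_eq power_0 power_one_right)
    then show ?thesis by simp
  qed
  define a where "a i = (\<Sum>m\<in>Poly_Mapping.keys F. if \<iota> m = i then Poly_Mapping.lookup F m else 0)" for i
  have "mp_eval F v = (\<Sum>i\<in>UNIV. a i * v $ i)" for v
  proof -
    have "(\<Sum>i\<in>UNIV. a i * v $ i) =
        (\<Sum>m\<in>Poly_Mapping.keys F. \<Sum>i\<in>UNIV. (if \<iota> m = i then Poly_Mapping.lookup F m else 0) * v $ i)"
      unfolding a_def sum_distrib_right by (rule sum.swap)
    also have "\<dots> = (\<Sum>m\<in>Poly_Mapping.keys F. Poly_Mapping.lookup F m * mono_eval m v)"
      by (intro sum.cong) (auto simp: mono if_distrib[of "\<lambda>x. x * _"] cong: if_cong)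
    finally show ?thesis by (simp add: mp_eval_def)
  qed
  then show ?thesis by (rule that)
qed

text \<open>The restriction of F to the line v + t w. Its formal derivative at t = 0 gives the
  differential of F in every characteristic, and its order at 0 measures contact with the
  line.\<close>

definition line_poly :: "('k::field, 'n::finite) mpol \<Rightarrow> 'k ^ 'n \<Rightarrow> 'k ^ 'n \<Rightarrow> 'k poly" where
  "line_poly F v w = (\<Sum>m\<in>Poly_Mapping.keys F. smult (Poly_Mapping.lookup F m)
     (\<Prod>i\<in>UNIV. [:v $ i, w $ i:] ^ Poly_Mapping.lookup m i))"

lemma poly_line_poly: "poly (line_poly F v w) t = mp_eval F (v + t *s w)"
  by (simp add: line_poly_def mp_eval_def mono_eval_def poly_sum poly_prod mult.commute)

text \<open>The subtraction in \<open>m - Poly_Mapping.single i 1\<close> is truncated when the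
  exponent of i is 0; the factor \<open>of_nat\<close> then removes the term.\<close>

lemma pderiv_monomial_0:
  fixes v w :: "'k::field ^ 'n::finite"
  shows "poly (pderiv (\<Prod>i\<in>UNIV. [:v $ i, w $ i:] ^ Poly_Mapping.lookup m i)) 0 =
    (\<Sum>i\<in>UNIV. of_nat (Poly_Mapping.lookup m i) * mono_eval (m - Poly_Mapping.single i 1) v * w $ i)"
proof -
  have "poly (pderiv (\<Prod>i\<in>UNIV. [:v $ i, w $ i:] ^ Poly_Mapping.lookup m i)) 0 =
      (\<Sum>i\<in>UNIV. (\<Prod>j\<in>UNIV - {i}. v $ j ^ Poly_Mapping.lookup m j) *
        (of_nat (Poly_Mapping.lookup m i) * v $ i ^ (Poly_Mapping.lookup m i - 1) * w $ i))"
    unfolding pderiv_prod poly_sum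
  proof (rule sum.cong[OF refl])
    fix i
    have "poly (pderiv ([:v $ i, w $ i:] ^ n)) 0 = of_nat n * v $ i ^ (n - 1) * w $ i" for n
      by (cases n) (simp_all add: pderiv_power_Suc pderiv_pCons del: power_Suc)
    then show "poly (prod (\<lambda>i. [:v $ i, w $ i:] ^ Poly_Mapping.lookup m i) (UNIV - {i}) *
        pderiv ([:v $ i, w $ i:] ^ Poly_Mapping.lookup m i)) 0 =
        (\<Prod>j\<in>UNIV - {i}. v $ j ^ Poly_Mapping.lookup m j) *
        (of_nat (Poly_Mapping.lookup m i) * v $ i ^ (Poly_Mapping.lookup m i - 1) * w $ i)"
      by (simp add: poly_prod)
  qed
  also have "\<dots> = (\<Sum>i\<in>UNIV. of_nat (Poly_Mapping.lookup m i) * mono_eval (m - Poly_Mapping.single i 1) v * w $ i)"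
  proof (rule sum.cong[OF refl])
    fix i
    have "mono_eval (m - Poly_Mapping.single i 1) v =
        v $ i ^ (Poly_Mapping.lookup m i - 1) * (\<Prod>j\<in>UNIV - {i}. v $ j ^ Poly_Mapping.lookup m j)"
      unfolding mono_eval_def
      by (subst prod.remove[of _ i]) (auto simp: lookup_minus lookup_single when_def intro!: prod.cong)
    then show "(\<Prod>j\<in>UNIV - {i}. v $ j ^ Poly_Mapping.lookup m j) *
        (of_nat (Poly_Mapping.lookup m i) * v $ i ^ (Poly_Mapping.lookup m i - 1) * w $ i) =
        of_nat (Poly_Mapping.lookup m i) * mono_eval (m - Poly_Mapping.single i 1) v * w $ i"
      by (simp add: mult_ac)
  qed
  finally show ?thesis .
qed

lemma directional_derivative:
  fixes v w :: "'k::field ^ 'n::finite"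
  shows "(\<Sum>i\<in>UNIV. mp_eval (mp_deriv i F) v * w $ i) = poly (pderiv (line_poly F v w)) 0"
proof -
  have "pderiv (line_poly F v w) = (\<Sum>m\<in>Poly_Mapping.keys F. smult (Poly_Mapping.lookup F m)
      (pderiv (\<Prod>i\<in>UNIV. [:v $ i, w $ i:] ^ Poly_Mapping.lookup m i)))"
    unfolding line_poly_def by (simp add: higher_pderiv_sum[of 1, simplified] pderiv_smult)
  then have "poly (pderiv (line_poly F v w)) 0 = (\<Sum>m\<in>Poly_Mapping.keys F. Poly_Mapping.lookup F m *
      (\<Sum>i\<in>UNIV. of_nat (Poly_Mapping.lookup m i) * mono_eval (m - Poly_Mapping.single i 1) v * w $ i))"
    by (simp add: poly_sum pderiv_monomial_0)
  also have "\<dots> = (\<Sum>i\<in>UNIV. \<Sum>m\<in>Poly_Mapping.keys F. Poly_Mapping.lookup F m *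
      (of_nat (Poly_Mapping.lookup m i) * mono_eval (m - Poly_Mapping.single i 1) v * w $ i))"
    unfolding sum_distrib_left by (rule sum.swap)
  also have "\<dots> = (\<Sum>i\<in>UNIV. mp_eval (mp_deriv i F) v * w $ i)"
    unfolding mp_deriv_def mp_eval_sum mp_eval_single sum_distrib_right
    by (intro sum.cong refl) (simp add: mult_ac)
  finally show ?thesis by simp
qed

section \<open>Points of projective space\<close>

definition point :: "'k::field ^ 'n::finite \<Rightarrow> ('k, 'n) proj" where
  "point v = Abs_proj (vec.span {v})"

lemma Rep_point: "v \<noteq> 0 \<Longrightarrow> Rep_proj (point v) = vec.span {v}"
  unfolding point_def by (rule Abs_proj_inverse) blast

lemma span_singleton_eq:
  fixes v w :: "'k::field ^ 'n::finite"
  assumes "w \<in> vec.span {v}" "w \<noteq> 0"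
  shows "vec.span {w} = vec.span {v}"
proof -
  obtain c where c: "w = c *s v"
    using assms(1) by (auto simp: vec.span_singleton)
  then have "c \<noteq> 0" using assms(2) by auto
  then have "v = (1 / c) *s w"
    by (simp add: c vector_smult_assoc)
  then have "v \<in> vec.span {w}"
    by (metis vec.span_base vec.span_scale singletonI)
  then show ?thesis
    using assms(1) by (simp add: vec.span_eq)
qed

lemma coords_in: "coords P \<in> Rep_proj P" and coords_nonzero [simp]: "coords P \<noteq> 0"
proof -
  obtain v where "Rep_proj P = vec.span {v}" "v \<noteq> 0"
    using Rep_proj[of P] by auto
  then have "\<exists>v. v \<in> Rep_proj P \<and> v \<noteq> 0"
    by (intro exI[of _ v]) (simp add: vec.span_base)
  then have "coords P \<in> Rep_proj P \<and> coords P \<noteq> 0"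
    unfolding coords_def by (rule someI_ex)
  then show "coords P \<in> Rep_proj P" "coords P \<noteq> 0" by auto
qed

lemma Rep_coords: "Rep_proj P = vec.span {coords P}"
proof -
  obtain v where v: "Rep_proj P = vec.span {v}" "v \<noteq> 0"
    using Rep_proj[of P] by auto
  then show ?thesis
    using span_singleton_eq[of "coords P" v] coords_in[of P] by simp
qed

lemma point_coords [simp]: "point (coords P) = P"
  unfolding point_def Rep_coords[symmetric] by (rule Rep_proj_inverse)

lemma coords_point:
  assumes "v \<noteq> 0"
  obtains c where "c \<noteq> 0" "coords (point v) = c *s v"
proof -
  have "coords (point v) \<in> vec.span {v}"
    using coords_in[of "point v"] Rep_point[OF assms] by simp
  then obtain c where c: "coords (point v) = c *s v"
    by (auto simp: vec.span_singleton)
  moreover have "c \<noteq> 0"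
    using c coords_nonzero[of "point v"] by auto
  ultimately show ?thesis using that by blast
qed

lemma point_scale: "c \<noteq> 0 \<Longrightarrow> v \<noteq> 0 \<Longrightarrow> point (c *s v) = point v"
  unfolding point_def
  by (subst span_singleton_eq[of "c *s v" v]) (simp_all add: vec.span_scale vec.span_base)

text \<open>\<open>coords\<close> picks an arbitrary representative, which differs from a given
  vector by a nonzero scalar. Neither the zeros of a form nor a quotient of two forms of equal
  degree depends on it.\<close>

lemma form_zero_point:
  assumes "form_fun d h" "v \<noteq> 0"
  shows "h (coords (point v)) = 0 \<longleftrightarrow> h v = 0"
proof -
  obtain c where "c \<noteq> 0" "coords (point v) = c *s v"
    by (rule coords_point[OF assms(2)])
  then show ?thesis
    using form_fun_scale[OF assms(1)] by simp
qed

lemma form_quotient_point: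
  assumes "form_fun d h" "form_fun d h'" "v \<noteq> 0"
  shows "h (coords (point v)) / h' (coords (point v)) = h v / h' v"
proof -
  obtain c where "c \<noteq> 0" "coords (point v) = c *s v"
    by (rule coords_point[OF assms(3)])
  then show ?thesis
    using form_fun_scale[OF assms(1)] form_fun_scale[OF assms(2)] by simp
qed

lemma proj_map_point:
  assumes "A *v v \<noteq> 0"
  shows "proj_map A (point v) = point (A *v v)"
proof -
  have "v \<noteq> 0" using assms by auto
  then have "(*v) A ` Rep_proj (point v) = range (\<lambda>k. k *s (A *v v))"
    by (auto simp: Rep_point vec.span_singleton vec.scale image_image)
  then show ?thesis
    by (simp add: proj_map_def point_def vec.span_singleton)
qed

section \<open>Zariski topology and regular functions\<close>

lemma homogeneous_forms: "homogeneous d F \<Longrightarrow> F \<in> forms"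
  by (auto simp: forms_def)

lemma open_form_nonzero: "form_fun d h \<Longrightarrow> open {P. h (coords P) \<noteq> 0}"
proof -
  assume "form_fun d h"
  then obtain F where F: "homogeneous d F" "h = mp_eval F"
    by (auto simp: form_fun_def)
  have "{F} \<subseteq> forms"
    using F(1) homogeneous_forms by simp
  moreover have "- {P. h (coords P) \<noteq> 0} = zeros {F}"
    using F(2) by (auto simp: zeros_def)
  ultimately show ?thesis
    unfolding open_proj_def by blast
qed

lemma openin_inter_nonempty:
  assumes "zariski_irreducible V" "openin (top_of_set V) A" "openin (top_of_set V) B" "A \<noteq> {}" "B \<noteq> {}"
  shows "A \<inter> B \<noteq> {}"
proof
  assume AB: "A \<inter> B = {}"
  obtain S T where S: "open S" "A = V \<inter> S" and T: "open T" "B = V \<inter> T"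
    using assms(2,3) by (auto simp: openin_open)
  have "V \<subseteq> - S \<union> - T" using AB S T by auto
  moreover have "closed (- S)" "closed (- T)"
    using S T by (auto simp: closed_def)
  ultimately have "V \<subseteq> - S \<or> V \<subseteq> - T"
    using assms(1) unfolding zariski_irreducible_def by blast
  then show False using assms(4,5) S T by auto
qed

lemma openin_irreducible:
  assumes "zariski_irreducible V" "openin (top_of_set V) U" "openin (top_of_set U) A" "openin (top_of_set U) B"
    "A \<noteq> {}" "B \<noteq> {}"
  shows "A \<inter> B \<noteq> {}"
  using openin_inter_nonempty[OF assms(1) openin_trans[OF assms(3,2)] openin_trans[OF assms(4,2)] assms(5,6)] .

lemma regular_onI:
  assumes "\<And>P. P \<in> U \<Longrightarrow> \<exists>W d h h'. openin (top_of_set U) W \<and> P \<in> W \<and> form_fun d h \<and> form_fun d h' \<and>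
     (\<forall>Q\<in>W. h' (coords Q) \<noteq> 0 \<and> f Q = h (coords Q) / h' (coords Q))"
  shows "regular_on U f"
  unfolding regular_on_def
proof
  fix P assume "P \<in> U"
  from assms[OF this] obtain W d h h' where W: "openin (top_of_set U) W" "P \<in> W" "form_fun d h" "form_fun d h'"
    "\<forall>Q\<in>W. h' (coords Q) \<noteq> 0 \<and> f Q = h (coords Q) / h' (coords Q)"
    by (elim exE conjE)
  then obtain F G where "homogeneous d F" "h = mp_eval F" "homogeneous d G" "h' = mp_eval G"
    by (auto simp: form_fun_def)
  then show "\<exists>W d F G. openin (top_of_set U) W \<and> P \<in> W \<and> homogeneous d F \<and> homogeneous d G \<and>
     (\<forall>Q\<in>W. mp_eval G (coords Q) \<noteq> 0 \<and> f Q = mp_eval F (coords Q) / mp_eval G (coords Q))"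
    using W by (intro exI[of _ W] exI[of _ d] exI[of _ F] exI[of _ G]) simp
qed

lemma regular_onE:
  assumes "regular_on U f" "P \<in> U"
  obtains W d h h' where "openin (top_of_set U) W" "P \<in> W" "form_fun d h" "form_fun d h'"
    "\<And>Q. Q \<in> W \<Longrightarrow> h' (coords Q) \<noteq> 0" "\<And>Q. Q \<in> W \<Longrightarrow> f Q = h (coords Q) / h' (coords Q)"
proof -
  obtain W d F G where "openin (top_of_set U) W" "P \<in> W" "homogeneous d F" "homogeneous d G"
    "\<forall>Q\<in>W. mp_eval G (coords Q) \<noteq> 0 \<and> f Q = mp_eval F (coords Q) / mp_eval G (coords Q)"
    using bspec[OF assms(1)[unfolded regular_on_def] assms(2)] by (elim exE conjE)
  then show ?thesis
    by (intro that[of W d "mp_eval F" "mp_eval G"]) (simp_all add: form_funI)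
qed

lemma regular_on_cong: "regular_on U f \<Longrightarrow> (\<And>P. P \<in> U \<Longrightarrow> f P = g P) \<Longrightarrow> regular_on U g"
proof (rule regular_onI)
  fix P assume f: "regular_on U f" and P: "P \<in> U" and fg: "\<And>P. P \<in> U \<Longrightarrow> f P = g P"
  obtain W d h h' where W: "openin (top_of_set U) W" "P \<in> W" "form_fun d h" "form_fun d h'"
    "\<And>Q. Q \<in> W \<Longrightarrow> h' (coords Q) \<noteq> 0" "\<And>Q. Q \<in> W \<Longrightarrow> f Q = h (coords Q) / h' (coords Q)"
    by (rule regular_onE[OF f P]) (rule that)
  moreover have "\<And>Q. Q \<in> W \<Longrightarrow> g Q = h (coords Q) / h' (coords Q)"
    using W(6) fg subsetD[OF openin_imp_subset[OF W(1)]] by simp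
  ultimately show "\<exists>W d h h'. openin (top_of_set U) W \<and> P \<in> W \<and> form_fun d h \<and> form_fun d h' \<and>
     (\<forall>Q\<in>W. h' (coords Q) \<noteq> 0 \<and> g Q = h (coords Q) / h' (coords Q))"
    by (intro exI[of _ W] exI[of _ d] exI[of _ h] exI[of _ h']) simp
qed

lemma regular_on_quotient:
  assumes "form_fun d h" "form_fun d h'" "\<And>P. P \<in> U \<Longrightarrow> h' (coords P) \<noteq> 0"
  shows "regular_on U (\<lambda>P. h (coords P) / h' (coords P))"
  using assms by (intro regular_onI exI[of _ U] exI[of _ d] exI[of _ h] exI[of _ h']) auto

lemma regular_on_const: "regular_on U (\<lambda>_. r)"
  using regular_on_quotient[OF form_fun_const[of r] form_fun_const[of 1], of U] by simp

lemma regular_on_subset: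
  assumes "regular_on U f" "V \<subseteq> U"
  shows "regular_on V f"
proof (rule regular_onI)
  fix P assume "P \<in> V"
  then have "P \<in> U" using assms(2) by blast
  obtain W d h h' where W: "openin (top_of_set U) W" "P \<in> W" "form_fun d h" "form_fun d h'"
    "\<And>Q. Q \<in> W \<Longrightarrow> h' (coords Q) \<noteq> 0" "\<And>Q. Q \<in> W \<Longrightarrow> f Q = h (coords Q) / h' (coords Q)"
    by (rule regular_onE[OF assms(1) \<open>P \<in> U\<close>]) (rule that)
  obtain T where "open T" "W = U \<inter> T"
    using W(1) by (auto simp: openin_open)
  then have "openin (top_of_set V) (V \<inter> T)" "V \<inter> T \<subseteq> W"
    using assms(2) by auto
  with W \<open>P \<in> V\<close> \<open>W = U \<inter> T\<close> show "\<exists>W d h h'. openin (top_of_set V) W \<and> P \<in> W \<and> form_fun d h \<and> form_fun d h' \<and>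
     (\<forall>Q\<in>W. h' (coords Q) \<noteq> 0 \<and> f Q = h (coords Q) / h' (coords Q))"
    by (intro exI[of _ "V \<inter> T"] exI[of _ d] exI[of _ h] exI[of _ h']) auto
qed

lemma regular_on_local:
  assumes "\<And>P. P \<in> U \<Longrightarrow> \<exists>W. openin (top_of_set U) W \<and> P \<in> W \<and> regular_on W f"
  shows "regular_on U f"
proof (rule regular_onI)
  fix P assume "P \<in> U"
  then obtain W where W: "openin (top_of_set U) W" "P \<in> W" "regular_on W f"
    using assms by blast
  obtain W' d h h' where W': "openin (top_of_set W) W'" "P \<in> W'" "form_fun d h" "form_fun d h'"
    "\<And>Q. Q \<in> W' \<Longrightarrow> h' (coords Q) \<noteq> 0" "\<And>Q. Q \<in> W' \<Longrightarrow> f Q = h (coords Q) / h' (coords Q)"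
    by (rule regular_onE[OF W(3,2)]) (rule that)
  with openin_trans[OF W'(1) W(1)] show "\<exists>W d h h'. openin (top_of_set U) W \<and> P \<in> W \<and> form_fun d h \<and> form_fun d h' \<and>
     (\<forall>Q\<in>W. h' (coords Q) \<noteq> 0 \<and> f Q = h (coords Q) / h' (coords Q))"
    by (intro exI[of _ W'] exI[of _ d] exI[of _ h] exI[of _ h']) simp
qed

text \<open>Sum and product share the denominator \<open>k1 v * k2 v\<close> and the degree d + e;
  the premise \<open>op\<close> asks only for the numerator.\<close>

lemma regular_on_binop:
  fixes U :: "('k::field, 'n::finite) proj set"
  assumes "regular_on U f" "regular_on U g"
    and op: "\<And>d e (h1 :: 'k ^ 'n \<Rightarrow> 'k) k1 h2 k2.
      \<lbrakk>form_fun d h1; form_fun d k1; form_fun e h2; form_fun e k2\<rbrakk> \<Longrightarrow> \<exists>h. form_fun (d + e) h \<and> (\<forall>v. k1 v \<noteq> 0 \<longrightarrow> k2 v \<noteq> 0 \<longrightarrow> H (h1 v / k1 v) (h2 v / k2 v) = h v / (k1 v * k2 v))"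
  shows "regular_on U (\<lambda>P. H (f P) (g P))"
proof (rule regular_onI)
  fix P assume P: "P \<in> U"
  obtain W1 d h1 k1 where W1: "openin (top_of_set U) W1" "P \<in> W1" "form_fun d h1" "form_fun d k1"
    "\<And>Q. Q \<in> W1 \<Longrightarrow> k1 (coords Q) \<noteq> 0" "\<And>Q. Q \<in> W1 \<Longrightarrow> f Q = h1 (coords Q) / k1 (coords Q)"
    by (rule regular_onE[OF assms(1) P]) (rule that)
  obtain W2 e h2 k2 where W2: "openin (top_of_set U) W2" "P \<in> W2" "form_fun e h2" "form_fun e k2"
    "\<And>Q. Q \<in> W2 \<Longrightarrow> k2 (coords Q) \<noteq> 0" "\<And>Q. Q \<in> W2 \<Longrightarrow> g Q = h2 (coords Q) / k2 (coords Q)"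
    by (rule regular_onE[OF assms(2) P]) (rule that)
  obtain h where h: "form_fun (d + e) h"
    "\<forall>v. k1 v \<noteq> 0 \<longrightarrow> k2 v \<noteq> 0 \<longrightarrow> H (h1 v / k1 v) (h2 v / k2 v) = h v / (k1 v * k2 v)"
    using op[OF W1(3,4) W2(3,4)] by blast
  show "\<exists>W d h h'. openin (top_of_set U) W \<and> P \<in> W \<and> form_fun d h \<and> form_fun d h' \<and>
     (\<forall>Q\<in>W. h' (coords Q) \<noteq> 0 \<and> H (f Q) (g Q) = h (coords Q) / h' (coords Q))"
  proof (rule exI[of _ "W1 \<inter> W2"], rule exI[of _ "d + e"], rule exI[of _ h],
      rule exI[of _ "\<lambda>v. k1 v * k2 v"], intro conjI)
    show "openin (top_of_set U) (W1 \<inter> W2)"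
      using W1(1) W2(1) by (rule openin_Int)
    show "form_fun (d + e) (\<lambda>v. k1 v * k2 v)"
      using W1(4) W2(4) by (rule form_fun_mult)
    show "form_fun (d + e) h" by (rule h(1))
    show "\<forall>Q\<in>W1 \<inter> W2. k1 (coords Q) * k2 (coords Q) \<noteq> 0 \<and>
        H (f Q) (g Q) = h (coords Q) / (k1 (coords Q) * k2 (coords Q))"
      using W1(5,6) W2(5,6) h(2) by auto
  qed (use W1(2) W2(2) in auto)
qed

lemma regular_on_mult:
  fixes U :: "('k::field, 'n::finite) proj set"
  shows "regular_on U f \<Longrightarrow> regular_on U g \<Longrightarrow> regular_on U (\<lambda>P. f P * g P)"
proof (rule regular_on_binop[where H="(*)"])
  fix d e :: nat and h1 k1 h2 k2 :: "'k ^ 'n \<Rightarrow> 'k"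
  assume "form_fun d h1" "form_fun e h2"
  then have "form_fun (d + e) (\<lambda>v. h1 v * h2 v)" by (rule form_fun_mult)
  then show "\<exists>h. form_fun (d + e) h \<and>
      (\<forall>v. k1 v \<noteq> 0 \<longrightarrow> k2 v \<noteq> 0 \<longrightarrow> h1 v / k1 v * (h2 v / k2 v) = h v / (k1 v * k2 v))"
    by (intro exI conjI) auto
qed

lemma regular_on_add:
  fixes U :: "('k::field, 'n::finite) proj set"
  shows "regular_on U f \<Longrightarrow> regular_on U g \<Longrightarrow> regular_on U (\<lambda>P. f P + g P)"
proof (rule regular_on_binop[where H="(+)"])
  fix d e :: nat and h1 k1 h2 k2 :: "'k ^ 'n \<Rightarrow> 'k"
  assume "form_fun d h1" "form_fun d k1" "form_fun e h2" "form_fun e k2"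
  then have "form_fun (d + e) (\<lambda>v. h1 v * k2 v + k1 v * h2 v)"
    by (intro form_fun_add form_fun_mult)
  then show "\<exists>h. form_fun (d + e) h \<and>
      (\<forall>v. k1 v \<noteq> 0 \<longrightarrow> k2 v \<noteq> 0 \<longrightarrow> h1 v / k1 v + h2 v / k2 v = h v / (k1 v * k2 v))"
    by (intro exI conjI) (auto simp: field_simps)
qed

lemma regular_on_diff: "regular_on U f \<Longrightarrow> regular_on U g \<Longrightarrow> regular_on U (\<lambda>P. f P - g P)"
  using regular_on_add[OF _ regular_on_mult[OF regular_on_const[of U "-1"]], of f g] by simp

lemma openin_regular_nonzero:
  assumes "regular_on U f"
  shows "openin (top_of_set U) {P \<in> U. f P \<noteq> 0}"
proof (subst openin_subopen, rule ballI)
  fix P assume P: "P \<in> {P \<in> U. f P \<noteq> 0}"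
  then have "P \<in> U" by simp
  obtain W d h h' where W: "openin (top_of_set U) W" "P \<in> W" "form_fun d h" "form_fun d h'"
    "\<And>Q. Q \<in> W \<Longrightarrow> h' (coords Q) \<noteq> 0" "\<And>Q. Q \<in> W \<Longrightarrow> f Q = h (coords Q) / h' (coords Q)"
    by (rule regular_onE[OF assms(1) \<open>P \<in> U\<close>]) (rule that)
  have "openin (top_of_set U) (W \<inter> {P. h (coords P) \<noteq> 0})"
    using W(1) open_form_nonzero[OF W(3)] by (rule openin_Int_open)
  moreover have "P \<in> W \<inter> {P. h (coords P) \<noteq> 0}"
    using P W(2) W(6)[OF W(2)] by auto
  moreover have "W \<inter> {P. h (coords P) \<noteq> 0} \<subseteq> {P \<in> U. f P \<noteq> 0}"
    using openin_imp_subset[OF W(1)] W(5,6) by auto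
  ultimately show "\<exists>T. openin (top_of_set U) T \<and> P \<in> T \<and> T \<subseteq> {P \<in> U. f P \<noteq> 0}"
    by blast
qed

lemma regular_on_domain:
  assumes "zariski_irreducible V" "openin (top_of_set V) U" "regular_on U f" "regular_on U g"
    "\<forall>P\<in>U. f P * g P = 0"
  shows "(\<forall>P\<in>U. f P = 0) \<or> (\<forall>P\<in>U. g P = 0)"
proof (rule ccontr)
  assume "\<not> ?thesis"
  then have "{P \<in> U. f P \<noteq> 0} \<noteq> {}" "{P \<in> U. g P \<noteq> 0} \<noteq> {}" by auto
  then have "{P \<in> U. f P \<noteq> 0} \<inter> {P \<in> U. g P \<noteq> 0} \<noteq> {}"
    by (rule openin_irreducible[OF assms(1,2) openin_regular_nonzero[OF assms(3)] openin_regular_nonzero[OF assms(4)]])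
  then show False using assms(5) by auto
qed

text \<open>The locus f \<noteq> g is open in \<open>U\<close>, since f - g is regular; if it were
  nonempty, irreducibility would make it meet \<open>W\<close>.\<close>

lemma regular_on_eq:
  assumes "zariski_irreducible V" "openin (top_of_set V) U" "regular_on U f" "regular_on U g"
    "openin (top_of_set V) W" "W \<noteq> {}" "W \<subseteq> U" "\<And>P. P \<in> W \<Longrightarrow> f P = g P" "P \<in> U"
  shows "f P = g P"
proof (rule ccontr)
  assume "f P \<noteq> g P"
  then have ne: "{P \<in> U. f P - g P \<noteq> 0} \<noteq> {}" using assms(9) by auto
  have "openin (top_of_set U) W"
    using assms(5,7) openin_imp_subset[OF assms(2)] by (rule openin_subset_trans)
  from openin_irreducible[OF assms(1,2) this openin_regular_nonzero[OF regular_on_diff[OF assms(3,4)]] assms(6) ne]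
  show False using assms(8) by auto
qed

text \<open>Two proper closed sets are avoided at points P and Q by forms F and G. Restricted to the
  line joining P and Q, both are nonzero polynomials, so some point of the line avoids both sets at
  once.\<close>

lemma irreducible_UNIV: "zariski_irreducible (UNIV :: ('k::alg_closed_field, 'n::finite) proj set)"
  unfolding zariski_irreducible_def
proof (intro conjI allI impI)
  fix A B :: "('k, 'n) proj set"
  assume AB: "closed A \<and> closed B \<and> UNIV \<subseteq> A \<union> B"
  then obtain S T where S: "S \<subseteq> forms" "A = zeros S" and T: "T \<subseteq> forms" "B = zeros T"
    unfolding closed_def open_proj_def by auto
  show "UNIV \<subseteq> A \<or> UNIV \<subseteq> B"
  proof (rule ccontr)
    assume "\<not> (UNIV \<subseteq> A \<or> UNIV \<subseteq> B)"
    then obtain P Q where "P \<notin> A" "Q \<notin> B" by auto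
    then obtain F G where F: "F \<in> S" "mp_eval F (coords P) \<noteq> 0" and G: "G \<in> T" "mp_eval G (coords Q) \<noteq> 0"
      unfolding S(2) T(2) zeros_def by auto
    obtain i where i: "coords P $ i \<noteq> 0"
      using coords_nonzero[of P] by (auto simp: vec_eq_iff)
    define w where "w = coords Q - coords P"
    \<comment> \<open>The third factor keeps the i-th coordinate of v away from 0, so that v
      represents a point.\<close>
    define p where "p = line_poly F (coords P) w * line_poly G (coords P) w * [:coords P $ i, w $ i:]"
    have "poly (line_poly F (coords P) w) 0 \<noteq> 0" "poly (line_poly G (coords P) w) 1 \<noteq> 0"
      using F(2) G(2) by (simp_all add: poly_line_poly w_def)
    then have "p \<noteq> 0" unfolding p_def using i by (auto simp del: mult_pCons_right)
    then obtain t where t: "poly p t \<noteq> 0"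
      using poly_eq_0I_infinite[OF infinite_alg_closed_field, of p] by blast
    define v where "v = coords P + t *s w"
    have "poly (line_poly F (coords P) w) t \<noteq> 0" "poly (line_poly G (coords P) w) t \<noteq> 0"
      "poly [:coords P $ i, w $ i:] t \<noteq> 0"
      using t unfolding p_def poly_mult by auto
    then have "v \<noteq> 0" "mp_eval F v \<noteq> 0" "mp_eval G v \<noteq> 0"
      by (auto simp: poly_line_poly v_def vec_eq_iff)
    moreover obtain d e where "homogeneous d F" "homogeneous e G"
      using F(1) G(1) S(1) T(1) unfolding forms_def by blast
    ultimately have "mp_eval F (coords (point v)) \<noteq> 0" "mp_eval G (coords (point v)) \<noteq> 0"
      using form_zero_point[OF form_funI] by blast+
    then have "point v \<notin> A \<union> B"
      unfolding S(2) T(2) zeros_def using F(1) G(1) by blast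
    then show False using AB by auto
  qed
qed simp

section \<open>Morphisms\<close>

lemma morphism_openin_preimage:
  assumes "morphism X Y \<phi>" "open T"
  shows "openin (top_of_set X) {P \<in> X. \<phi> P \<in> T}"
proof -
  have "openin (top_of_set X) (X \<inter> \<phi> -` T)"
    using assms by (intro continuous_openin_preimage_gen) (auto simp: morphism_def)
  moreover have "X \<inter> \<phi> -` T = {P \<in> X. \<phi> P \<in> T}" by auto
  ultimately show ?thesis by simp
qed

lemma morphism_openin_preimage':
  assumes "morphism X Y \<phi>" "openin (top_of_set Y) W"
  shows "openin (top_of_set X) {P \<in> X. \<phi> P \<in> W}"
proof -
  obtain T where T: "open T" "W = Y \<inter> T"
    using assms(2) by (auto simp: openin_open)
  have "{P \<in> X. \<phi> P \<in> W} = {P \<in> X. \<phi> P \<in> T}"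
    using assms(1) T(2) by (auto simp: morphism_def)
  then show ?thesis using morphism_openin_preimage[OF assms(1) T(1)] by simp
qed

lemma morphism_regular:
  assumes "morphism X Y \<phi>" "openin (top_of_set Y) U" "regular_on U f"
  shows "regular_on {P \<in> X. \<phi> P \<in> U} (\<lambda>P. f (\<phi> P))"
proof -
  have "X \<inter> \<phi> -` U = {P \<in> X. \<phi> P \<in> U}" by auto
  then show ?thesis
    using assms unfolding morphism_def comp_def by fastforce
qed

lemma morphism_quotient:
  assumes "morphism X UNIV \<phi>" "form_fun d h" "form_fun d h'"
  shows "regular_on {P \<in> X. h' (coords (\<phi> P)) \<noteq> 0} (\<lambda>P. h (coords (\<phi> P)) / h' (coords (\<phi> P)))"
proof -
  have "openin (top_of_set UNIV) {P. h' (coords P) \<noteq> 0}"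
    using open_form_nonzero[OF assms(3)] by (simp add: openin_open)
  moreover have "regular_on {P. h' (coords P) \<noteq> 0} (\<lambda>P. h (coords P) / h' (coords P))"
    using assms(2,3) by (rule regular_on_quotient) simp
  ultimately show ?thesis
    using morphism_regular[OF assms(1)] by fastforce
qed

lemma morphism_compose:
  assumes "morphism X Y \<sigma>" "morphism Y Z \<phi>"
  shows "morphism X Z (\<lambda>P. \<phi> (\<sigma> P))"
  unfolding morphism_def
proof (intro conjI allI impI)
  show "(\<lambda>P. \<phi> (\<sigma> P)) \<in> X \<rightarrow> Z"
    using assms by (auto simp: morphism_def)
  have "continuous_on X \<sigma>" "continuous_on (\<sigma> ` X) \<phi>"
    using assms by (auto simp: morphism_def elim: continuous_on_subset)
  then show "continuous_on X (\<lambda>P. \<phi> (\<sigma> P))"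
    using continuous_on_compose by (fastforce simp: comp_def)
next
  fix U f assume U: "openin (top_of_set Z) U \<and> regular_on U f"
  have "regular_on {P \<in> X. \<sigma> P \<in> {Q \<in> Y. \<phi> Q \<in> U}} (\<lambda>P. f (\<phi> (\<sigma> P)))"
    using U by (intro morphism_regular[OF assms(1)] morphism_openin_preimage'[OF assms(2)]
        morphism_regular[OF assms(2), of U f]) auto
  moreover have "{P \<in> X. \<sigma> P \<in> {Q \<in> Y. \<phi> Q \<in> U}} = X \<inter> (\<lambda>P. \<phi> (\<sigma> P)) -` U"
    using assms(1) by (auto simp: morphism_def)
  ultimately show "regular_on (X \<inter> (\<lambda>P. \<phi> (\<sigma> P)) -` U) (f \<circ> (\<lambda>P. \<phi> (\<sigma> P)))"
    by (simp add: comp_def)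
qed

text \<open>Projective space is separated.\<close>

lemma morphisms_eq:
  fixes \<phi> \<psi> :: "('k::alg_closed_field, 'n::finite) proj \<Rightarrow> ('k, 'm::finite) proj"
  assumes "zariski_irreducible X" "morphism X UNIV \<phi>" "morphism X UNIV \<psi>"
    "openin (top_of_set X) W" "W \<noteq> {}" "\<And>P. P \<in> W \<Longrightarrow> \<phi> P = \<psi> P" "P \<in> X"
  shows "\<phi> P = \<psi> P"
proof -
  let ?v = "coords (\<phi> P)" and ?w = "coords (\<psi> P)"
  obtain i where i: "?v $ i \<noteq> 0"
    using coords_nonzero[of "\<phi> P"] by (auto simp: vec_eq_iff)
  obtain j where j: "?w $ j \<noteq> 0"
    using coords_nonzero[of "\<psi> P"] by (auto simp: vec_eq_iff)
  \<comment> \<open>A generic t makes the linear form m = v_i + t v_j nonzero at both images of P,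
    so near P the quotients of coordinates by m are regular functions for both morphisms.\<close>
  define p where "p = [:?v $ i, ?v $ j:] * [:?w $ i, ?w $ j:]"
  have "p \<noteq> 0"
    unfolding p_def using i j by (simp del: mult_pCons_left mult_pCons_right)
  then obtain t where "poly p t \<noteq> 0"
    using poly_eq_0I_infinite[OF infinite_alg_closed_field, of p] by blast
  then have t: "poly [:?v $ i, ?v $ j:] t \<noteq> 0" "poly [:?w $ i, ?w $ j:] t \<noteq> 0"
    unfolding p_def poly_mult by auto
  define m where "m = (\<lambda>v :: 'k ^ 'm. v $ i + t * v $ j)"
  have m: "m ?v \<noteq> 0" "m ?w \<noteq> 0"
    using t by (simp_all add: m_def)
  have m_form: "form_fun 1 m"
    unfolding m_def by (intro form_fun_add form_fun_coord form_fun_cmult)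
  define N where "N = {P \<in> X. m (coords (\<phi> P)) \<noteq> 0} \<inter> {P \<in> X. m (coords (\<psi> P)) \<noteq> 0}"
  have N: "openin (top_of_set X) N"
    unfolding N_def using morphism_openin_preimage[OF assms(2) open_form_nonzero[OF m_form]]
      morphism_openin_preimage[OF assms(3) open_form_nonzero[OF m_form]] by (intro openin_Int) simp_all
  have P: "P \<in> N" using m assms(7) by (simp add: N_def)
  have "N \<inter> W \<noteq> {}"
    using openin_inter_nonempty[OF assms(1) N assms(4) _ assms(5)] P by blast
  have eq: "?v $ r / m ?v = ?w $ r / m ?w" for r
  proof (rule regular_on_eq[OF assms(1) N _ _ openin_Int[OF N assms(4)]])
    show "regular_on N (\<lambda>P. coords (\<phi> P) $ r / m (coords (\<phi> P)))"
      by (rule regular_on_subset[OF morphism_quotient[OF assms(2) form_fun_coord m_form]]) (auto simp: N_def)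
    show "regular_on N (\<lambda>P. coords (\<psi> P) $ r / m (coords (\<psi> P)))"
      by (rule regular_on_subset[OF morphism_quotient[OF assms(3) form_fun_coord m_form]]) (auto simp: N_def)
  qed (use \<open>N \<inter> W \<noteq> {}\<close> assms(6) P in auto)
  have "?v $ r = m ?v / m ?w * ?w $ r" for r
  proof -
    have "?v $ r = m ?v * (?v $ r / m ?v)" using m(1) by simp
    also have "\<dots> = m ?v / m ?w * ?w $ r" unfolding eq by simp
    finally show ?thesis .
  qed
  then have "?v = (m ?v / m ?w) *s ?w"
    by (simp add: vec_eq_iff)
  then have "point ?v = point ?w"
    using point_scale[of "m ?v / m ?w" ?w] m by simp
  then show ?thesis by simp
qed

section \<open>Homogenization\<close>

text \<open>The homogenization of degree D, as a function of x, y, z. Terms of degree above D are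
  dropped, which is why \<open>wle 1 1 D a\<close> accompanies it.\<close>

definition hv :: "nat \<Rightarrow> 'k::comm_ring_1 poly poly \<Rightarrow> 'k \<Rightarrow> 'k \<Rightarrow> 'k \<Rightarrow> 'k" where
  "hv D a x y z = (\<Sum>j\<le>D. \<Sum>i\<le>D - j. cf a i j * x ^ i * y ^ j * z ^ (D - i - j))"

lemma ev2_bounded:
  assumes "wle 1 1 D a"
  shows "ev2 a x y = (\<Sum>j\<le>D. \<Sum>i\<le>D - j. cf a i j * x ^ i * y ^ j)"
proof -
  have z: "cf a i j = 0" if "D < i + j" for i j
  proof (rule ccontr)
    assume "cf a i j \<noteq> 0"
    then have "1 * i + 1 * j \<le> D"
      using assms unfolding wle_def by blast
    then show False using that by simp
  qed
  have "degree (coeff a j) \<le> D - j" if "j \<le> D" for j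
    using that by (intro degree_le) (auto intro: z)
  then have "poly (coeff a j) x = (\<Sum>i\<le>D - j. cf a i j * x ^ i)" if "j \<le> D" for j
    using that unfolding poly_altdef
    by (intro sum.mono_neutral_left) (auto simp: coeff_eq_0)
  moreover have "degree a \<le> D"
    by (intro degree_le allI impI poly_eqI) (auto intro: z)
  ultimately show ?thesis
    by (simp add: ev2_Y_expansion sum_distrib_right)
qed

lemma hv_1: "wle 1 1 D a \<Longrightarrow> hv D a x y 1 = ev2 a x y"
  by (simp add: hv_def ev2_bounded)

lemma hv_nonzero:
  fixes z :: "'k::field"
  assumes "z \<noteq> 0" "wle 1 1 D a"
  shows "hv D a x y z = z ^ D * ev2 a (x / z) (y / z)"
  unfolding hv_def ev2_bounded[OF assms(2)] sum_distrib_left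
proof (intro sum.cong refl)
  fix j i assume "j \<in> {..D}" "i \<in> {..D - j}"
  then have D: "(D - i - j) + i + j = D" by simp
  have "z ^ D = z ^ (D - i - j) * z ^ i * z ^ j"
    unfolding power_add[symmetric] D ..
  then show "cf a i j * x ^ i * y ^ j * z ^ (D - i - j) = z ^ D * (cf a i j * (x / z) ^ i * (y / z) ^ j)"
    using assms(1) by (simp add: power_divide)
qed

text \<open>Identities proved by dividing by z extend to the line z = 0, since both sides are
  polynomials in z that agree at infinitely many values.\<close>

lemma poly_in_z_eq:
  fixes h h' :: "'k::alg_closed_field \<Rightarrow> 'k"
  assumes "\<And>t. h t = poly p t" "\<And>t. h' t = poly q t" "\<And>t. t \<noteq> 0 \<Longrightarrow> h t = h' t"
  shows "h t = h' t"
proof -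
  have "p - q = 0"
    using assms(3) by (intro poly_eq_0I_infinite[OF infinite_nonzero]) (simp add: assms(1,2)[symmetric])
  then show ?thesis by (simp add: assms(1,2))
qed

lemma hv_poly: "hv D a x y z = poly (\<Sum>j\<le>D. \<Sum>i\<le>D - j. monom (cf a i j * x ^ i * y ^ j) (D - i - j)) z"
  by (simp add: hv_def poly_sum poly_monom)

lemma hv_mult:
  fixes a b :: "'k::alg_closed_field poly poly"
  assumes "wle 1 1 D a" "wle 1 1 E b"
  shows "hv (D + E) (a * b) x y z = hv D a x y z * hv E b x y z"
proof -
  define p where "p = (\<Sum>j\<le>D + E. \<Sum>i\<le>D + E - j. monom (cf (a * b) i j * x ^ i * y ^ j) (D + E - i - j))"
  define q where "q = (\<Sum>j\<le>D. \<Sum>i\<le>D - j. monom (cf a i j * x ^ i * y ^ j) (D - i - j)) *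
      (\<Sum>j\<le>E. \<Sum>i\<le>E - j. monom (cf b i j * x ^ i * y ^ j) (E - i - j))"
  have p: "hv (D + E) (a * b) x y t = poly p t" for t
    unfolding p_def by (rule hv_poly)
  have q: "hv D a x y t * hv E b x y t = poly q t" for t
    unfolding q_def poly_mult hv_poly[of D] hv_poly[of E] ..
  have "hv (D + E) (a * b) x y t = hv D a x y t * hv E b x y t" if "t \<noteq> 0" for t
    using hv_nonzero[OF that wle_mult[OF assms]] hv_nonzero[OF that assms(1)] hv_nonzero[OF that assms(2)]
    by (simp add: power_add)
  with p q show ?thesis
    by (rule poly_in_z_eq)
qed

lemma hv_0: "hv D a x y 0 = (\<Sum>j\<le>D. cf a (D - j) j * x ^ (D - j) * y ^ j)"
proof -
  have "(\<Sum>i\<le>D - j. cf a i j * x ^ i * y ^ j * 0 ^ (D - i - j)) = cf a (D - j) j * x ^ (D - j) * y ^ j"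
    if "j \<le> D" for j
  proof -
    have "(\<Sum>i\<le>D - j. cf a i j * x ^ i * y ^ j * 0 ^ (D - i - j)) =
        (\<Sum>i\<le>D - j. if i = D - j then cf a (D - j) j * x ^ (D - j) * y ^ j else 0)"
    proof (intro sum.cong refl)
      fix i assume "i \<in> {..D - j}"
      then show "cf a i j * x ^ i * y ^ j * 0 ^ (D - i - j) =
          (if i = D - j then cf a (D - j) j * x ^ (D - j) * y ^ j else 0)"
        using that by (cases "i = D - j") (simp_all add: power_0_left)
    qed
    then show ?thesis by simp
  qed
  then show ?thesis by (simp add: hv_def)
qed

lemma mono_eval_3: "mono_eval m v = v $ 1 ^ Poly_Mapping.lookup m 1 * v $ 2 ^ Poly_Mapping.lookup m 2 *
    v $ (3::3) ^ Poly_Mapping.lookup m 3"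
  unfolding mono_eval_def UNIV_3 by (simp add: mult.assoc)

text \<open>Kronecker substitution: a form vanishing at \<open>(t, t\<^sup>N, t\<^sup>N\<^sup>N)\<close> for large \<open>N\<close> is zero.\<close>

lemma mp_eval_eq_0_imp:
  fixes F :: "('k::alg_closed_field, 3) mpol"
  assumes "\<And>v. mp_eval F v = 0"
  shows "F = 0"
proof (rule ccontr)
  assume "F \<noteq> 0"
  have "\<exists>m. Poly_Mapping.lookup F m \<noteq> 0"
  proof (rule ccontr)
    assume "\<not> ?thesis"
    then have "F = 0" by (intro poly_mapping_eqI) simp
    then show False using \<open>F \<noteq> 0\<close> by simp
  qed
  then obtain m0 where m0: "m0 \<in> Poly_Mapping.keys F"
    by (auto simp: in_keys_iff)
  \<comment> \<open>N exceeds all exponents, so \<open>code m\<close> has the exponents of m as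
    digits in base N and determines m.\<close>
  define N where "N = Suc (\<Sum>m\<in>Poly_Mapping.keys F. \<Sum>i\<in>UNIV. Poly_Mapping.lookup m i)"
  have small: "Poly_Mapping.lookup m i < N" if "m \<in> Poly_Mapping.keys F" for m i
  proof -
    have "Poly_Mapping.lookup m i \<le> (\<Sum>i\<in>UNIV. Poly_Mapping.lookup m i)"
      by (rule member_le_sum) auto
    also have "\<dots> \<le> (\<Sum>m\<in>Poly_Mapping.keys F. \<Sum>i\<in>UNIV. Poly_Mapping.lookup m i)"
      using that by (intro member_le_sum) auto
    finally show ?thesis by (simp add: N_def)
  qed
  define code where "code m = Poly_Mapping.lookup m 1 + N * (Poly_Mapping.lookup m 2 + N * Poly_Mapping.lookup m (3::3))"
    for m :: "3 \<Rightarrow>\<^sub>0 nat"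
  have code_inj: "m = m'" if mm: "m \<in> Poly_Mapping.keys F" "m' \<in> Poly_Mapping.keys F" "code m = code m'" for m m'
  proof -
    have "code m mod N = Poly_Mapping.lookup m 1"
      unfolding code_def using small[OF mm(1), of 1] by simp
    moreover have "code m' mod N = Poly_Mapping.lookup m' 1"
      unfolding code_def using small[OF mm(2), of 1] by simp
    ultimately have 1: "Poly_Mapping.lookup m 1 = Poly_Mapping.lookup m' 1"
      using mm(3) by simp
    have "N > 0" by (simp add: N_def)
    then have 23: "Poly_Mapping.lookup m 2 + N * Poly_Mapping.lookup m 3 = Poly_Mapping.lookup m' 2 + N * Poly_Mapping.lookup m' 3"
      using mm(3) 1 by (simp add: code_def)
    then have "(Poly_Mapping.lookup m 2 + N * Poly_Mapping.lookup m 3) mod N =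
        (Poly_Mapping.lookup m' 2 + N * Poly_Mapping.lookup m' 3) mod N"
      by (rule arg_cong)
    then have 2: "Poly_Mapping.lookup m 2 = Poly_Mapping.lookup m' 2"
      using small[OF mm(1), of 2] small[OF mm(2), of 2] by simp
    then have 3: "Poly_Mapping.lookup m 3 = Poly_Mapping.lookup m' 3"
      using 23 \<open>N > 0\<close> by simp
    show ?thesis
    proof (rule poly_mapping_eqI)
      fix k :: 3
      show "Poly_Mapping.lookup m k = Poly_Mapping.lookup m' k"
        using exhaust_3[of k] by (elim disjE) (simp_all only: 1 2 3)
    qed
  qed
  define p where "p = (\<Sum>m\<in>Poly_Mapping.keys F. monom (Poly_Mapping.lookup F m) (code m))"
  have "t ^ code m = mono_eval m (vector [t, t ^ N, t ^ (N * N)])" for t :: 'k and m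
    unfolding code_def mono_eval_3 vector_3
    by (simp only: power_add power_mult distrib_left mult.assoc[symmetric])
  then have "poly p t = mp_eval F (vector [t, t ^ N, t ^ (N * N)])" for t
    unfolding p_def mp_eval_def by (simp add: poly_sum poly_monom)
  then have "p = 0"
    using assms by (intro poly_eqI_alg_closed) simp
  moreover have "coeff p (code m0) = Poly_Mapping.lookup F m0"
  proof -
    have "coeff p (code m0) = (\<Sum>m\<in>Poly_Mapping.keys F. if m = m0 then Poly_Mapping.lookup F m else 0)"
      unfolding p_def coeff_sum
    proof (intro sum.cong refl)
      fix m assume m: "m \<in> Poly_Mapping.keys F"
      have "code m = code m0 \<longleftrightarrow> m = m0"
        using code_inj[OF m m0] by metis
      then show "coeff (monom (Poly_Mapping.lookup F m) (code m)) (code m0) =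
          (if m = m0 then Poly_Mapping.lookup F m else 0)"
        by simp
    qed
    then show ?thesis using m0 by simp
  qed
  ultimately show False
    using m0 by (simp add: in_keys_iff)
qed

lemma mp_eval_inject:
  fixes F G :: "('k::alg_closed_field, 3) mpol"
  assumes "\<And>v. mp_eval F v = mp_eval G v"
  shows "F = G"
proof -
  have "mp_eval F v = mp_eval (F - G) v + mp_eval G v" for v
    by (simp flip: mp_eval_add)
  then have "F - G = 0"
    using assms by (intro mp_eval_eq_0_imp) simp
  then show ?thesis by simp
qed

text \<open>A basis of k^3, that is, homogeneous coordinates (x : y : z). In the application v1 and
  v2 represent Q_1 and Q_2, so Q_2 is the origin of the chart z \<noteq> 0 and Q_1 lies at infinity
  in the direction of y.\<close>

locale frame =
  fixes v0 v1 v2 :: "'k::alg_closed_field ^ 3"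
  assumes independent: "\<And>x y z. x *s v0 + y *s v1 + z *s v2 = 0 \<Longrightarrow> x = 0 \<and> y = 0 \<and> z = 0"
begin

definition comb :: "'k \<Rightarrow> 'k \<Rightarrow> 'k \<Rightarrow> 'k ^ 3" where
  "comb x y z = x *s v0 + y *s v1 + z *s v2"

definition frame_matrix :: "'k ^ 3 ^ 3" where
  "frame_matrix = (\<chi> i j. if j = 1 then v0 $ i else if j = 2 then v1 $ i else v2 $ i)"

lemma frame_matrix_mult: "frame_matrix *v u = comb (u $ 1) (u $ 2) (u $ 3)"
  by (simp add: frame_matrix_def comb_def matrix_vector_mult_def vec_eq_iff sum_3 mult.commute)

definition coord_matrix :: "'k ^ 3 ^ 3" where
  "coord_matrix = (SOME M. M ** frame_matrix = mat 1)"

lemma coord_matrix: "coord_matrix ** frame_matrix = mat 1" "frame_matrix ** coord_matrix = mat 1"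
proof -
  have "\<forall>x. frame_matrix *v x = 0 \<longrightarrow> x = 0"
    unfolding frame_matrix_mult comb_def
    by (intro allI impI) (metis (mono_tags) independent exhaust_3 vec_eq_iff zero_index)
  then have "\<exists>M. M ** frame_matrix = mat 1"
    by (simp add: matrix_left_invertible_ker)
  then show "coord_matrix ** frame_matrix = mat 1"
    unfolding coord_matrix_def by (rule someI_ex)
  then show "frame_matrix ** coord_matrix = mat 1"
    by (rule matrix_left_right_inverse1)
qed

abbreviation cx :: "'k ^ 3 \<Rightarrow> 'k" where "cx v \<equiv> (coord_matrix *v v) $ 1"
abbreviation cy :: "'k ^ 3 \<Rightarrow> 'k" where "cy v \<equiv> (coord_matrix *v v) $ 2"
abbreviation cz :: "'k ^ 3 \<Rightarrow> 'k" where "cz v \<equiv> (coord_matrix *v v) $ 3"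

lemma comb_coords: "comb (cx v) (cy v) (cz v) = v"
proof -
  have "frame_matrix *v (coord_matrix *v v) = v"
    by (simp add: matrix_vector_mul_assoc coord_matrix)
  then show ?thesis by (simp add: frame_matrix_mult)
qed

lemma coords_comb [simp]: "cx (comb x y z) = x" "cy (comb x y z) = y" "cz (comb x y z) = z"
proof -
  have "coord_matrix *v (frame_matrix *v vector [x, y, z]) = vector [x, y, z]"
    by (simp add: matrix_vector_mul_assoc coord_matrix)
  then have "coord_matrix *v comb x y z = vector [x, y, z]"
    by (simp add: frame_matrix_mult)
  then show "cx (comb x y z) = x" "cy (comb x y z) = y" "cz (comb x y z) = z" by simp_all
qed

lemma comb_scale: "c *s comb x y z = comb (c * x) (c * y) (c * z)"
  by (simp add: comb_def vector_add_ldistrib vector_smult_assoc)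

lemma form_fun_matrix: "form_fun 1 (\<lambda>v :: 'k ^ 'm. (M *v v) $ i)" for M :: "'k ^ 'm::finite ^ 'n"
  unfolding matrix_vector_mult_def using form_fun_linear[of "\<lambda>j. M $ i $ j"] by simp

lemma form_fun_hv: "wle 1 1 D a \<Longrightarrow> form_fun D (\<lambda>v. hv D a (cx v) (cy v) (cz v))"
  unfolding hv_def
proof (intro form_fun_sum)
  fix j i assume "j \<in> {..D}" "i \<in> {..D - j}"
  then have D: "i * 1 + j * 1 + (D - i - j) * 1 = D" by simp
  have "form_fun (i * 1 + j * 1 + (D - i - j) * 1) (\<lambda>v. cf a i j * cx v ^ i * cy v ^ j * cz v ^ (D - i - j))"
    by (intro form_fun_mult form_fun_cmult form_fun_power form_fun_matrix)
  then show "form_fun D (\<lambda>v. cf a i j * cx v ^ i * cy v ^ j * cz v ^ (D - i - j))"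
    unfolding D .
qed

text \<open>Substituting z = 1 keeps all information: for z \<noteq> 0 by homogeneity, and for z = 0
  because both sides are polynomial in z.\<close>

lemma dehomogenize:
  assumes "form_fun D h"
  obtains a where "wle 1 1 D a" "\<And>x y z. h (comb x y z) = hv D a x y z"
proof -
  have "form_fun (D * 1) (\<lambda>u. h (frame_matrix *v u))"
    by (intro form_fun_compose[OF assms] form_fun_matrix)
  then obtain G where G: "homogeneous D G" "\<And>u. h (frame_matrix *v u) = mp_eval G u"
    by (rule form_funE) simp
  define a where "a = (\<Sum>m\<in>Poly_Mapping.keys G.
      monom (monom (Poly_Mapping.lookup G m) (Poly_Mapping.lookup m 1)) (Poly_Mapping.lookup m 2))"
  have wle_a: "wle 1 1 D a"
    unfolding a_def
  proof (rule wle_sum)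
    fix m assume "m \<in> Poly_Mapping.keys G"
    then have "Poly_Mapping.lookup m 1 + Poly_Mapping.lookup m 2 + Poly_Mapping.lookup m (3::3) = D"
      using G(1) by (simp add: homogeneous_def sum_3)
    then show "wle 1 1 D (monom (monom (Poly_Mapping.lookup G m) (Poly_Mapping.lookup m 1)) (Poly_Mapping.lookup m 2))"
      by (auto simp: wle_def)
  qed
  have ev_a: "ev2 a x y = mp_eval G (vector [x, y, 1])" for x y
    unfolding a_def mp_eval_def by (simp add: ev2_def poly_sum poly_monom mono_eval_3 mult.assoc flip: monom_0)
  have nz: "mp_eval G (vector [x, y, z]) = hv D a x y z" if "z \<noteq> 0" for x y z
  proof -
    have "vector [x, y, z] = z *s (vector [x / z, y / z, 1] :: 'k ^ 3)"
      using that by (simp add: vec_eq_iff forall_3)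
    then show ?thesis
      using homogeneous_scale[OF G(1), of z] that by (simp add: hv_nonzero[OF _ wle_a] ev_a)
  qed
  have "h (comb x y z) = hv D a x y z" for x y z
  proof -
    have line: "mp_eval G (vector [x, y, t]) = poly (line_poly G (vector [x, y, 0]) (vector [0, 0, 1])) t" for t
    proof -
      have "vector [x, y, t] = vector [x, y, 0] + t *s (vector [0, 0, 1] :: 'k ^ 3)"
        by (simp add: vec_eq_iff forall_3)
      then show ?thesis by (simp add: poly_line_poly)
    qed
    have "mp_eval G (vector [x, y, z]) = hv D a x y z"
      by (rule poly_in_z_eq[of "\<lambda>t. mp_eval G (vector [x, y, t])"]) (rule line, rule hv_poly, rule nz)
    then show ?thesis
      using G(2)[of "vector [x, y, z]"] by (simp add: frame_matrix_mult)
  qed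
  with wle_a show ?thesis by (rule that)
qed

end

section \<open>The ideal of an irreducible plane curve\<close>

text \<open>A polynomial vanishes on the vertical line over x if and only if all its coefficients in
  y have the root x. This links vanishing to divisibility and serves to remove factors from
  k[x].\<close>

lemma poly_slice:
  fixes a :: "'k::alg_closed_field poly poly"
  obtains s where "\<And>y. poly s y = ev2 a x y" "s = 0 \<longleftrightarrow> [:[:-x, 1:]:] dvd a"
proof -
  define s where "s = (\<Sum>j\<le>degree a. monom (poly (coeff a j) x) j)"
  have coeff_s: "coeff s j = poly (coeff a j) x" for j
    by (simp add: s_def coeff_sum coeff_eq_0)
  have "s = 0 \<longleftrightarrow> (\<forall>j. coeff s j = 0)"
    by (simp add: poly_eq_iff)
  also have "\<dots> \<longleftrightarrow> [:[:-x, 1:]:] dvd a"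
    unfolding coeff_s const_poly_dvd_iff poly_eq_0_iff_dvd ..
  finally have zero: "s = 0 \<longleftrightarrow> [:[:-x, 1:]:] dvd a" .
  have eval: "poly s y = ev2 a x y" for y
    using ev2_Y_expansion[of a "degree a" x y] by (simp add: s_def poly_sum poly_monom)
  show ?thesis by (rule that[OF eval zero])
qed

text \<open>Gauss's lemma. At a root x of s the product g q vanishes on the vertical line over x,
  where g does not vanish identically; so X - x divides q and can be cancelled, which lowers the
  degree of s.\<close>

lemma primitive_cancel:
  fixes g a q :: "'k::alg_closed_field poly poly"
  assumes prim: "\<And>x. \<not> [:[:-x, 1:]:] dvd g" and "s \<noteq> 0" "smult s a = g * q"
  shows "g dvd a"
  using assms(2,3)
proof (induction "degree s" arbitrary: s q)
  case 0
  then obtain c where c: "s = [:c:]" "c \<noteq> 0"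
    by (metis degree_eq_zeroE pCons_0_0)
  then have "a = smult [:inverse c:] (smult s a)"
    by (simp flip: one_pCons)
  also have "\<dots> = g * smult [:inverse c:] q"
    unfolding 0(3) by simp
  finally show ?case by (rule dvdI)
next
  case (Suc n)
  then obtain x where "poly s x = 0"
    using alg_closed_imp_poly_has_root[of s] by auto
  then obtain s' where s': "s = [:-x, 1:] * s'"
    unfolding poly_eq_0_iff_dvd by (rule dvdE)
  obtain sg where sg: "\<And>y. poly sg y = ev2 g x y" "sg = 0 \<longleftrightarrow> [:[:-x, 1:]:] dvd g"
    by (rule poly_slice[of g x]) (rule that)
  obtain sq where sq: "\<And>y. poly sq y = ev2 q x y" "sq = 0 \<longleftrightarrow> [:[:-x, 1:]:] dvd q"
    by (rule poly_slice[of q x]) (rule that)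
  have "poly (sg * sq) y = poly 0 y" for y
  proof -
    have "ev2 (smult s a) x y = ev2 (g * q) x y"
      using Suc.prems(2) by (rule arg_cong)
    then show ?thesis
      using \<open>poly s x = 0\<close> by (simp add: sg(1) sq(1))
  qed
  then have "sg * sq = 0"
    by (rule poly_eqI_alg_closed)
  then have "sq = 0"
    using prim sg(2) by simp
  then have "[:[:-x, 1:]:] dvd q"
    using sq(2) by simp
  then obtain q' where q': "q = [:[:-x, 1:]:] * q'"
    by (rule dvdE)
  have q_smult: "q = smult [:-x, 1:] q'"
    unfolding q' by simp
  have "smult [:-x, 1:] (smult s' a) = smult s a"
    unfolding s' by (rule smult_smult)
  also have "\<dots> = smult [:-x, 1:] (g * q')"
    unfolding Suc.prems(2) q_smult by (rule mult_smult_right)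
  finally have "[:[:-x, 1:]:] * (smult s' a - g * q') = 0"
    by (simp add: smult_diff_right)
  then have "smult s' a = g * q'"
    by (simp only: mult_eq_0_iff) simp
  have nz: "s' \<noteq> 0"
    using Suc.prems(1) unfolding s' by (metis mult_zero_right)
  have "degree s = degree [:-x, 1:] + degree s'"
    unfolding s' using nz by (intro degree_mult_eq) simp_all
  then have "n = degree s'"
    using Suc.hyps(2) by simp
  then show ?case
    using nz \<open>smult s' a = g * q'\<close> by (rule Suc.hyps(1))
qed

text \<open>A form of positive degree vanishes at 0, a unit does not.\<close>

lemma unit_form_degree:
  fixes A :: "('k::field, 'n::finite) mpol"
  assumes "homogeneous n A" "A dvd 1"
  shows "n = 0"
proof (rule ccontr)
  assume "n \<noteq> 0"
  obtain B where "1 = A * B" using assms(2) by (rule dvdE)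
  then have "1 = mp_eval A 0 * mp_eval B 0"
    by (metis mp_eval_mult mp_eval_one)
  moreover have "mp_eval A 0 = 0"
    using homogeneous_scale[OF assms(1), of 0 0] \<open>n \<noteq> 0\<close> by (simp add: power_0_left)
  ultimately show False by simp
qed

text \<open>Primality of the ideal comes from irreducibility of the point set \<open>C\<close>, and
  the irreducible form F then identifies its generator; this avoids the Nullstellensatz.
  \<open>infinite_x\<close> ensures that no nonzero polynomial in x alone vanishes on the affine
  part.\<close>

locale irreducible_plane_curve = frame v0 v1 v2 for v0 v1 v2 :: "'k::alg_closed_field ^ 3" +
  fixes F :: "('k, 3) mpol" and d :: nat and f :: "'k poly poly" and C :: "('k, 3) proj set"
  assumes homogeneous_F: "homogeneous d F" and irreducible_F: "Factorial_Ring.irreducible F"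
    and C_zeros: "C = zeros {F}" and C_irreducible: "zariski_irreducible C"
    and weight_f: "wle 1 1 d f" and F_comb: "\<And>x y z. mp_eval F (comb x y z) = hv d f x y z"
    and infinite_x: "infinite {x. \<exists>y. ev2 f x y = 0}"
begin

definition curve_ideal :: "'k poly poly set" where
  "curve_ideal = {a. \<forall>x y. ev2 f x y = 0 \<longrightarrow> ev2 a x y = 0}"

lemma comb_nonzero: "z \<noteq> 0 \<Longrightarrow> comb x y z \<noteq> 0"
  using independent unfolding comb_def by blast

lemma C_iff: "P \<in> C \<longleftrightarrow> mp_eval F (coords P) = 0"
  by (simp add: C_zeros zeros_def)

lemma F_affine: "mp_eval F (comb x y 1) = ev2 f x y"
  by (simp add: F_comb hv_1[OF weight_f])

lemma affine_point_in_C: "ev2 f x y = 0 \<Longrightarrow> point (comb x y 1) \<in> C"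
  using form_zero_point[OF form_funI[OF homogeneous_F] comb_nonzero, of 1 x y]
  by (simp add: C_iff F_affine)

lemma C_affine_point:
  assumes "P \<in> C" "cz (coords P) \<noteq> 0"
  shows "ev2 f (cx (coords P) / cz (coords P)) (cy (coords P) / cz (coords P)) = 0"
proof -
  have "hv d f (cx (coords P)) (cy (coords P)) (cz (coords P)) = 0"
    using assms(1) by (simp add: C_iff flip: F_comb) (simp add: comb_coords)
  then show ?thesis
    using assms(2) by (simp add: hv_nonzero[OF _ weight_f])
qed

lemma exists_weight: "\<exists>N. wle 1 1 N a"
proof (cases "a = 0")
  case False
  then obtain N i j where "wle 1 1 N a" "cf a i j \<noteq> 0" "1 * i + 1 * j = N"
    by (rule exact_weight)
  then show ?thesis by blast
qed simp

definition nonzero_locus :: "nat \<Rightarrow> 'k poly poly \<Rightarrow> ('k, 3) proj set" where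
  "nonzero_locus N a =
    {P \<in> C. cz (coords P) * hv N a (cx (coords P)) (cy (coords P)) (cz (coords P)) \<noteq> 0}"

lemma curve_ideal_open:
  assumes "a \<notin> curve_ideal" "wle 1 1 N a"
  shows "openin (top_of_set C) (nonzero_locus N a)" and "nonzero_locus N a \<noteq> {}"
proof -
  let ?U = "nonzero_locus N a"
  have form: "form_fun (1 + N) (\<lambda>v. cz v * hv N a (cx v) (cy v) (cz v))"
    by (intro form_fun_mult form_fun_matrix form_fun_hv assms(2))
  have "?U = C \<inter> {P. cz (coords P) * hv N a (cx (coords P)) (cy (coords P)) (cz (coords P)) \<noteq> 0}"
    by (auto simp: nonzero_locus_def)
  then show "openin (top_of_set C) ?U"
    using openin_open_Int[OF open_form_nonzero[OF form], of C] by simp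
  obtain x y where xy: "ev2 f x y = 0" "ev2 a x y \<noteq> 0"
    using assms(1) by (auto simp: curve_ideal_def)
  have "cz (comb x y 1) * hv N a (cx (comb x y 1)) (cy (comb x y 1)) (cz (comb x y 1)) \<noteq> 0"
    using xy(2) by (simp add: hv_1[OF assms(2)])
  then have "point (comb x y 1) \<in> ?U"
    using form_zero_point[OF form comb_nonzero, of 1 x y] affine_point_in_C[OF xy(1)] by (simp add: nonzero_locus_def)
  then show "?U \<noteq> {}" by blast
qed

lemma curve_ideal_prime:
  assumes "a * b \<in> curve_ideal"
  shows "a \<in> curve_ideal \<or> b \<in> curve_ideal"
proof (rule ccontr)
  assume "\<not> ?thesis"
  then have ab: "a \<notin> curve_ideal" "b \<notin> curve_ideal" by auto
  obtain N M where NM: "wle 1 1 N a" "wle 1 1 M b"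
    using exists_weight by metis
  obtain P where P: "P \<in> C" "cz (coords P) \<noteq> 0"
      "hv N a (cx (coords P)) (cy (coords P)) (cz (coords P)) \<noteq> 0"
      "hv M b (cx (coords P)) (cy (coords P)) (cz (coords P)) \<noteq> 0"
    using openin_inter_nonempty[OF C_irreducible curve_ideal_open(1)[OF ab(1) NM(1)]
        curve_ideal_open(1)[OF ab(2) NM(2)] curve_ideal_open(2)[OF ab(1) NM(1)] curve_ideal_open(2)[OF ab(2) NM(2)]]
    by (auto simp: nonzero_locus_def)
  then have "ev2 (a * b) (cx (coords P) / cz (coords P)) (cy (coords P) / cz (coords P)) \<noteq> 0"
    by (simp add: hv_nonzero[OF _ NM(1)] hv_nonzero[OF _ NM(2)])
  then show False
    using assms C_affine_point[OF P(1,2)] by (auto simp: curve_ideal_def)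
qed

lemma curve_ideal_const: "[:r:] \<in> curve_ideal \<Longrightarrow> r = 0"
  using infinite_x by (intro poly_eq_0I_infinite[of "{x. \<exists>y. ev2 f x y = 0}"]) (auto simp: curve_ideal_def)

lemma curve_ideal_mult: "a \<in> curve_ideal \<Longrightarrow> b * a \<in> curve_ideal"
  and curve_ideal_diff: "a \<in> curve_ideal \<Longrightarrow> b \<in> curve_ideal \<Longrightarrow> a - b \<in> curve_ideal"
  by (auto simp: curve_ideal_def)

lemma f_in_ideal: "f \<in> curve_ideal"
  by (simp add: curve_ideal_def)

lemma f_nonzero: "f \<noteq> 0"
proof
  assume "f = 0"
  then have "mp_eval F v = mp_eval 0 v" for v
    using F_comb[of "cx v" "cy v" "cz v"] by (simp add: comb_coords hv_def)
  then have "F = 0" by (rule mp_eval_inject)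
  then show False using irreducible_F by simp
qed

text \<open>An element of least degree in \<open>Y\<close>, made primitive, generates the ideal.\<close>

lemma curve_ideal_principal:
  obtains g where "g \<noteq> 0" "g \<in> curve_ideal" "\<And>a. a \<in> curve_ideal \<Longrightarrow> g dvd a"
proof -
  define n where "n = (LEAST n. \<exists>g. g \<in> curve_ideal \<and> g \<noteq> 0 \<and> degree g = n)"
  have n: "\<exists>g. g \<in> curve_ideal \<and> g \<noteq> 0 \<and> degree g = n"
    unfolding n_def by (rule LeastI[of _ "degree f"]) (use f_in_ideal f_nonzero in blast)
  have n_min: "n \<le> degree g" if "g \<in> curve_ideal" "g \<noteq> 0" for g
    unfolding n_def using that by (intro Least_le) blast
  \<comment> \<open>The second minimization, over the degree of the leading coefficient, makes g
    primitive: dividing g by X - x would lower that degree and stay in the prime ideal.\<close>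
  define g where "g = arg_min (\<lambda>g. degree (lead_coeff g)) (\<lambda>g. g \<in> curve_ideal \<and> g \<noteq> 0 \<and> degree g = n)"
  obtain g0 where g0: "g0 \<in> curve_ideal \<and> g0 \<noteq> 0 \<and> degree g0 = n"
    using n by blast
  have g: "g \<in> curve_ideal" "g \<noteq> 0" "degree g = n"
    and g_min: "\<And>g'. g' \<in> curve_ideal \<and> g' \<noteq> 0 \<and> degree g' = n \<Longrightarrow> degree (lead_coeff g) \<le> degree (lead_coeff g')"
    using arg_min_nat_lemma[of "\<lambda>g. g \<in> curve_ideal \<and> g \<noteq> 0 \<and> degree g = n" g0 "\<lambda>g. degree (lead_coeff g)", OF g0]
    unfolding g_def by auto
  have prim: "\<not> [:[:-x, 1:]:] dvd g" for x
  proof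
    assume "[:[:-x, 1:]:] dvd g"
    then obtain g' where g': "g = [:[:-x, 1:]:] * g'" ..
    have "[:[:-x, 1:]:] \<notin> curve_ideal"
      using curve_ideal_const[of "[:-x, 1:]"] by auto
    then have "g' \<in> curve_ideal"
      using curve_ideal_prime[of "[:[:-x, 1:]:]" g'] g(1) g' by simp
    moreover have "g' \<noteq> 0" using g' g(2) by auto
    moreover have "degree g' = n"
      using g(3) \<open>g' \<noteq> 0\<close> unfolding g' by simp
    ultimately have "degree (lead_coeff g) \<le> degree (lead_coeff g')"
      using g_min by blast
    moreover have "lead_coeff g = [:-x, 1:] * lead_coeff g'"
      unfolding g' by (simp add: lead_coeff_mult del: mult_pCons_left)
    moreover have "degree ([:-x, 1:] * lead_coeff g') = Suc (degree (lead_coeff g'))"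
      using \<open>g' \<noteq> 0\<close> by (subst degree_mult_eq) auto
    ultimately show False by simp
  qed
  have "g dvd a" if a: "a \<in> curve_ideal" for a
  proof -
    define rem where "rem = pseudo_mod a g"
    obtain s q where s: "s \<noteq> 0" "smult s a = g * q + rem"
      using pseudo_mod(1)[OF g(2), of a] rem_def by blast
    have "rem = [:s:] * a - q * g"
      using s(2) by (simp add: mult.commute)
    then have "rem \<in> curve_ideal"
      using a g(1) by (simp only: curve_ideal_diff curve_ideal_mult)
    then have "rem = 0"
      using n_min[of rem] pseudo_mod(2)[OF g(2), of a] g(3) rem_def by fastforce
    then show ?thesis
      using primitive_cancel[OF prim s(1)] s(2) by simp
  qed
  with g show ?thesis using that by blast
qed

lemma form_of_hv:
  assumes "wle 1 1 D a"
  obtains G where "homogeneous D G" "\<And>v. mp_eval G v = hv D a (cx v) (cy v) (cz v)"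
  using form_fun_hv[OF assms] by (rule form_funE) (metis that)

text \<open>If f = q g with the generator g, homogenizing both factors splits F. The factor from g
  is no unit, because the curve has affine points; so q is a constant and f generates. As the
  degrees of the factors add up to d, the degree of f is exactly d.\<close>

lemma f_generates:
  shows "\<And>a. a \<in> curve_ideal \<Longrightarrow> f dvd a" and "\<exists>i j. cf f i j \<noteq> 0 \<and> i + j = d"
proof -
  obtain g where g: "g \<noteq> 0" "g \<in> curve_ideal" "\<And>a. a \<in> curve_ideal \<Longrightarrow> g dvd a"
    by (rule curve_ideal_principal) (rule that)
  obtain q where q: "f = q * g"
    using g(3)[OF f_in_ideal] by (metis dvdE mult.commute)
  have "q \<noteq> 0" using q f_nonzero by auto
  obtain N i j where N: "wle 1 1 N g" "cf g i j \<noteq> 0" "1 * i + 1 * j = N"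
    by (rule exact_weight[OF g(1)])
  have Nd: "N \<le> d" and wq: "wle 1 1 (d - N) q"
    using wle_factor[OF _ \<open>q \<noteq> 0\<close> N(2,3,1)] weight_f q by auto
  obtain Q where Q: "homogeneous (d - N) Q" "\<And>v. mp_eval Q v = hv (d - N) q (cx v) (cy v) (cz v)"
    by (rule form_of_hv[OF wq]) (rule that)
  obtain G where G: "homogeneous N G" "\<And>v. mp_eval G v = hv N g (cx v) (cy v) (cz v)"
    by (rule form_of_hv[OF N(1)]) (rule that)
  have "F = Q * G"
  proof (rule mp_eval_inject)
    fix v
    have "mp_eval F v = hv (d - N + N) (q * g) (cx v) (cy v) (cz v)"
      using F_comb[of "cx v" "cy v" "cz v"] Nd q by (simp add: comb_coords)
    then show "mp_eval F v = mp_eval (Q * G) v"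
      by (simp add: hv_mult[OF wq N(1)] mp_eval_mult Q(2) G(2))
  qed
  then have "Q dvd 1 \<or> G dvd 1"
    using irreducible_F by (rule irreducibleD[rotated])
  moreover have "\<not> G dvd 1"
  proof
    assume "G dvd 1"
    then have "N = 0"
      by (rule unit_form_degree[OF G(1)])
    then have "wle 1 1 0 g" using N(1) by simp
    then have "ev2 g x y = cf g 0 0" for x y
      by (subst ev2_bounded) auto
    moreover have "cf g 0 0 \<noteq> 0"
      using N(2,3) \<open>N = 0\<close> by simp
    ultimately have "{x. \<exists>y. ev2 f x y = 0} = {}"
      using g(2) by (auto simp: curve_ideal_def)
    then show False using infinite_x by simp
  qed
  ultimately have "d - N = 0"
    using unit_form_degree[OF Q(1)] by blast
  then have "wle 1 1 0 q" using wq by simp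
  then have "ev2 (q - [:[:cf q 0 0:]:]) x y = 0" for x y
    by (simp add: ev2_bounded[of 0 q])
  then have "q - [:[:cf q 0 0:]:] = 0"
    by (rule ev2_eq_0_imp)
  then obtain r where r: "q = [:[:r:]:]" by (metis eq_iff_diff_eq_0)
  then have "r \<noteq> 0" using \<open>q \<noteq> 0\<close> by auto
  have "g = [:[:inverse r:]:] * f"
    using \<open>r \<noteq> 0\<close> by (simp add: q r flip: one_pCons)
  then have "f dvd g" by (metis dvd_triv_right)
  then show "f dvd a" if "a \<in> curve_ideal" for a
    using g(3)[OF that] dvd_trans by blast
  have "cf f i j \<noteq> 0"
    using N(2) \<open>r \<noteq> 0\<close> by (simp add: q r)
  then show "\<exists>i j. cf f i j \<noteq> 0 \<and> i + j = d"
    using N(3) Nd \<open>d - N = 0\<close> by auto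
qed

text \<open>An affine multiple of f homogenizes to a multiple of F, because f has exact degree d.
  The equation of degrees is conditional, since the zero form has every degree.\<close>

lemma vanishing_form_multiple:
  assumes "form_fun D h" "\<And>P. P \<in> C \<Longrightarrow> h (coords P) = 0"
  obtains e k where "form_fun e k" "\<And>v. h v = k v * mp_eval F v" "(\<exists>v. h v \<noteq> 0) \<Longrightarrow> D = e + d"
proof -
  obtain a where a: "wle 1 1 D a" "\<And>x y z. h (comb x y z) = hv D a x y z"
    by (rule dehomogenize[OF assms(1)]) (rule that)
  have "a \<in> curve_ideal"
    unfolding curve_ideal_def
  proof (clarify)
    fix x y assume "ev2 f x y = 0"
    then have "h (coords (point (comb x y 1))) = 0"
      by (intro assms(2) affine_point_in_C)
    then have "h (comb x y 1) = 0"
      using form_zero_point[OF assms(1) comb_nonzero, of 1] by simp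
    then show "ev2 a x y = 0" by (simp add: a(2) hv_1[OF a(1)])
  qed
  then obtain s where s: "a = s * f"
    using f_generates(1) by (metis dvdE mult.commute)
  have h: "h v = hv D a (cx v) (cy v) (cz v)" for v
    using a(2)[of "cx v" "cy v" "cz v"] by (simp add: comb_coords)
  show ?thesis
  proof (cases "s = 0")
    case True
    then have "h v = 0" for v by (simp add: h s hv_def)
    then show ?thesis
      by (intro that[of 0 "\<lambda>_. 0"]) (auto simp: form_fun_zero)
  next
    case False
    obtain i j where ij: "cf f i j \<noteq> 0" "1 * i + 1 * j = d"
      using f_generates(2) by auto
    have dD: "d \<le> D" and ws: "wle 1 1 (D - d) s"
      using wle_factor[OF _ False ij weight_f] a(1) s by auto
    show ?thesis
    proof (rule that[OF form_fun_hv[OF ws]])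
      show "h v = hv (D - d) s (cx v) (cy v) (cz v) * mp_eval F v" for v
        using hv_mult[OF ws weight_f, of "cx v" "cy v" "cz v"] F_comb[of "cx v" "cy v" "cz v"] dD
        by (simp add: h s comb_coords)
      show "D = D - d + d" using dD by simp
    qed
  qed
qed

text \<open>Each total inflection point brings its own degree and equation; this matches them up to
  a constant.\<close>

lemma defining_form_unique:
  assumes "homogeneous d' F'" "Factorial_Ring.irreducible F'" "C = zeros {F'}"
  obtains c where "c \<noteq> 0" "d' = d" "\<And>v. mp_eval F' v = c * mp_eval F v"
proof -
  have van: "mp_eval F' (coords P) = 0" if "P \<in> C" for P
    using that assms(3) by (simp add: zeros_def)
  obtain e k where k: "form_fun e k" "\<And>v. mp_eval F' v = k v * mp_eval F v"
      "(\<exists>v. mp_eval F' v \<noteq> 0) \<Longrightarrow> d' = e + d"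
    by (rule vanishing_form_multiple[OF form_funI[OF assms(1)]], erule van, rule that)
  obtain K where K: "homogeneous e K" "\<And>v. k v = mp_eval K v"
    by (rule form_funE[OF k(1)]) (rule that)
  have "F' = K * F"
    by (rule mp_eval_inject) (simp add: k(2) K(2) mp_eval_mult)
  then have "K dvd 1 \<or> F dvd 1"
    using assms(2) by (rule irreducibleD[rotated])
  then have "K dvd 1"
    using irreducible_F irreducible_not_unit by blast
  then have e: "e = 0"
    by (rule unit_form_degree[OF K(1)])
  have const: "k v = k 0" for v
    using form_fun_scale[OF k(1)[unfolded e], of 0 v] by simp
  have "F' \<noteq> 0"
    using assms(2) by (metis Factorial_Ring.not_irreducible_zero)
  then obtain v where v: "mp_eval F' v \<noteq> 0"
    by (metis mp_eval_eq_0_imp)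
  have "d' = d"
    using k(3) v e by auto
  moreover have "k 0 \<noteq> 0"
    using v k(2)[of v] const[of v] by auto
  moreover have "mp_eval F' u = k 0 * mp_eval F u" for u
    using k(2)[of u] const[of u] by simp
  ultimately show ?thesis
    by (intro that[of "k 0"])
qed

end

section \<open>Rational functions and local rings\<close>

lemma rat_repsI: "openin (top_of_set V) (dom f) \<Longrightarrow> dom f \<noteq> {} \<Longrightarrow> regular_on (dom f) (the \<circ> f) \<Longrightarrow> f \<in> rat_reps V"
  by (simp add: rat_reps_def)

lemma rat_repsD:
  assumes "f \<in> rat_reps V"
  shows "openin (top_of_set V) (dom f)" "dom f \<noteq> {}" "regular_on (dom f) (\<lambda>P. the (f P))"
  using assms by (simp_all add: rat_reps_def comp_def)

lemma rat_rel_iff: "(f, g) \<in> rat_rel V \<longleftrightarrow> f \<in> rat_reps V \<and> g \<in> rat_reps V \<and> (\<forall>P\<in>dom f \<inter> dom g. f P = g P)"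
  by (simp add: rat_rel_def)

text \<open>Transitivity rests on irreducibility: the domain of the middle function meets the common
  domain of the outer two in a nonempty open set, and agreement there extends by
  \<open>regular_on_eq\<close>.\<close>

lemma equiv_rat_rel:
  assumes V: "zariski_irreducible V"
  shows "equiv (rat_reps V) (rat_rel V)"
proof (rule equivI)
  show "rat_rel V \<subseteq> rat_reps V \<times> rat_reps V"
    by (auto simp: rat_rel_def)
  show "refl_on (rat_reps V) (rat_rel V)"
    by (auto simp: refl_on_def rat_rel_iff)
  show "sym (rat_rel V)"
    by (intro symI) (auto simp: rat_rel_iff)
  show "trans (rat_rel V)"
  proof (rule transI)
    fix f g h assume "(f, g) \<in> rat_rel V" "(g, h) \<in> rat_rel V"
    then have reps: "f \<in> rat_reps V" "g \<in> rat_reps V" "h \<in> rat_reps V"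
      and fg: "\<And>P. P \<in> dom f \<Longrightarrow> P \<in> dom g \<Longrightarrow> f P = g P"
      and gh: "\<And>P. P \<in> dom g \<Longrightarrow> P \<in> dom h \<Longrightarrow> g P = h P"
      by (auto simp: rat_rel_iff)
    note f = rat_repsD[OF reps(1)] and g = rat_repsD[OF reps(2)] and h = rat_repsD[OF reps(3)]
    let ?U = "dom f \<inter> dom h"
    have U: "openin (top_of_set V) ?U" "?U \<noteq> {}"
      using f h openin_inter_nonempty[OF V f(1) h(1)] by auto
    have W: "openin (top_of_set V) (?U \<inter> dom g)" "?U \<inter> dom g \<noteq> {}"
      using U g openin_inter_nonempty[OF V U(1) g(1)] by auto
    have "f P = h P" if P: "P \<in> ?U" for P
    proof -
      have "the (f P) = the (h P)"
      proof (rule regular_on_eq[OF V U(1) _ _ W _ _ P])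
        show "regular_on ?U (\<lambda>P. the (f P))" "regular_on ?U (\<lambda>P. the (h P))"
          using f(3) h(3) by (auto elim: regular_on_subset)
        show "the (f P) = the (h P)" if "P \<in> ?U \<inter> dom g" for P
          using that fg[of P] gh[of P] by simp
      qed auto
      then show ?thesis using P by auto
    qed
    then show "(f, h) \<in> rat_rel V"
      using reps by (auto simp: rat_rel_iff)
  qed
qed

lemma dom_pointwise: "dom (pointwise op f g) = dom f \<inter> dom g"
  by (auto simp: pointwise_def split: if_splits)

lemma pointwise_in_reps:
  fixes V :: "('k::field, 'n::finite) proj set"
  assumes V: "zariski_irreducible V" and "f \<in> rat_reps V" "g \<in> rat_reps V"
    and op: "\<And>(U :: ('k, 'n) proj set) u v. regular_on U u \<Longrightarrow> regular_on U v \<Longrightarrow> regular_on U (\<lambda>P. op (u P) (v P))"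
  shows "pointwise op f g \<in> rat_reps V"
proof (rule rat_repsI)
  note f = rat_repsD[OF assms(2)] and g = rat_repsD[OF assms(3)]
  show "openin (top_of_set V) (dom (pointwise op f g))" "dom (pointwise op f g) \<noteq> {}"
    using f g openin_inter_nonempty[OF V f(1) g(1)] by (auto simp: dom_pointwise)
  have "regular_on (dom f \<inter> dom g) (\<lambda>P. op (the (f P)) (the (g P)))"
    by (rule op) (rule regular_on_subset[OF f(3)], simp, rule regular_on_subset[OF g(3)], simp)
  then show "regular_on (dom (pointwise op f g)) (the \<circ> pointwise op f g)"
    unfolding dom_pointwise by (rule regular_on_cong) (auto simp: pointwise_def)
qed

lemma rat_op_class:
  fixes V :: "('k::field, 'n::finite) proj set"
  assumes V: "zariski_irreducible V" and "f \<in> rat_reps V" "g \<in> rat_reps V"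
    and op: "\<And>(U :: ('k, 'n) proj set) u v. regular_on U u \<Longrightarrow> regular_on U v \<Longrightarrow> regular_on U (\<lambda>P. op (u P) (v P))"
  shows "rat_op op V (rat_rel V `` {f}) (rat_rel V `` {g}) = rat_rel V `` {pointwise op f g}"
  unfolding rat_op_def
proof (rule UN_equiv_class2[OF equiv_rat_rel[OF V] equiv_rat_rel[OF V] _ assms(2,3)], rule congruent2I')
  fix f1 f2 g1 g2 assume "(f1, f2) \<in> rat_rel V" "(g1, g2) \<in> rat_rel V"
  then have "(pointwise op f1 g1, pointwise op f2 g2) \<in> rat_rel V"
    using pointwise_in_reps[OF V _ _ op]
    unfolding rat_rel_iff dom_pointwise by (auto simp: pointwise_def)
  then show "rat_rel V `` {pointwise op f1 g1} = rat_rel V `` {pointwise op f2 g2}"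
    by (rule equiv_class_eq[OF equiv_rat_rel[OF V]])
qed

definition rep :: "('k, 'n) proj set \<Rightarrow> (('k, 'n) proj \<Rightarrow> 'k) \<Rightarrow> ('k::field, 'n::finite) pfun" where
  "rep W h = (\<lambda>P. if P \<in> W then Some (h P) else None)"

lemma dom_rep [simp]: "dom (rep W h) = W"
  by (auto simp: rep_def split: if_splits)

lemma rep_in_reps: "rep W h \<in> rat_reps V \<longleftrightarrow> openin (top_of_set V) W \<and> W \<noteq> {} \<and> regular_on W h"
proof -
  have "regular_on W (the \<circ> rep W h) \<longleftrightarrow> regular_on W h"
    by (auto elim!: regular_on_cong simp: rep_def)
  then show ?thesis unfolding rat_reps_def mem_Collect_eq dom_rep by simp
qed

lemma pointwise_rep: "pointwise op (rep W h) (rep W' h') = rep (W \<inter> W') (\<lambda>P. op (h P) (h' P))"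
  unfolding pointwise_def dom_rep by (auto simp: rep_def fun_eq_iff)

lemma rep_the: "rep (dom f) (\<lambda>P. the (f P)) = f"
  unfolding rep_def
proof
  fix P
  show "(if P \<in> dom f then Some (the (f P)) else None) = f P"
    by (cases "f P") auto
qed

definition germ :: "('k, 'n) proj set \<Rightarrow> (('k, 'n) proj \<Rightarrow> 'k) \<Rightarrow> ('k::field, 'n::finite) pfun set" where
  "germ W h = rat_rel UNIV `` {rep W h}"

definition regular_near :: "('k::field, 'n::finite) proj \<Rightarrow> ('k, 'n) proj set \<Rightarrow> (('k, 'n) proj \<Rightarrow> 'k) \<Rightarrow> bool" where
  "regular_near Q W h \<longleftrightarrow> open W \<and> Q \<in> W \<and> regular_on W h"

lemma regular_near_reps: "regular_near Q W h \<Longrightarrow> rep W h \<in> rat_reps UNIV"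
  by (auto simp: rep_in_reps regular_near_def)

lemma regular_near_UNIV: "regular_near Q UNIV (\<lambda>_. r)"
  by (simp add: regular_near_def regular_on_const)

lemma regular_near_add: "regular_near Q W h \<Longrightarrow> regular_near Q W' h' \<Longrightarrow> regular_near Q (W \<inter> W') (\<lambda>P. h P + h' P)"
  unfolding regular_near_def by (auto intro!: regular_on_add elim: regular_on_subset)

lemma regular_near_mult: "regular_near Q W h \<Longrightarrow> regular_near Q W' h' \<Longrightarrow> regular_near Q (W \<inter> W') (\<lambda>P. h P * h' P)"
  unfolding regular_near_def by (auto intro!: regular_on_mult elim: regular_on_subset)

lemma germ_eq:
  fixes Q :: "('k::alg_closed_field, 'n::finite) proj"
  assumes "regular_near Q W h" "regular_near Q' W' h'" "\<And>P. P \<in> W \<Longrightarrow> P \<in> W' \<Longrightarrow> h P = h' P"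
  shows "germ W h = germ W' h'"
  unfolding germ_def
proof (rule equiv_class_eq[OF equiv_rat_rel[OF irreducible_UNIV]])
  show "(rep W h, rep W' h') \<in> rat_rel UNIV"
    unfolding rat_rel_iff dom_rep
    using assms(3) regular_near_reps[OF assms(1)] regular_near_reps[OF assms(2)]
    by (simp add: rep_def)
qed

lemma carrier_local_ring:
  fixes Q :: "('k::alg_closed_field, 'n::finite) proj"
  shows "a \<in> carrier (local_ring UNIV Q) \<longleftrightarrow> (\<exists>W h. regular_near Q W h \<and> a = germ W h)"
proof
  assume "a \<in> carrier (local_ring UNIV Q)"
  then obtain f where a: "a \<in> rat_reps UNIV // rat_rel UNIV" and f: "f \<in> a" "Q \<in> dom f"
    by (auto simp: local_ring_def function_field_def)
  obtain f0 where f0: "f0 \<in> rat_reps UNIV" "a = rat_rel UNIV `` {f0}"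
    using a by (auto simp: quotient_def)
  then have rel: "(f0, f) \<in> rat_rel UNIV" using f(1) by simp
  then have "a = rat_rel UNIV `` {f}"
    unfolding f0(2) by (rule equiv_class_eq[OF equiv_rat_rel[OF irreducible_UNIV]])
  then have "a = germ (dom f) (\<lambda>P. the (f P))"
    by (simp add: germ_def rep_the)
  moreover have "regular_near Q (dom f) (\<lambda>P. the (f P))"
    using rel f(2) rat_repsD[of f UNIV] by (auto simp: regular_near_def rat_rel_iff)
  ultimately show "\<exists>W h. regular_near Q W h \<and> a = germ W h" by blast
next
  assume "\<exists>W h. regular_near Q W h \<and> a = germ W h"
  then obtain W h where W: "regular_near Q W h" "a = germ W h" by blast
  have "a \<in> rat_reps UNIV // rat_rel UNIV"
    unfolding W(2) germ_def by (rule quotientI) (rule regular_near_reps[OF W(1)])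
  moreover have "rep W h \<in> a"
    unfolding W(2) germ_def using regular_near_reps[OF W(1)] by (simp add: rat_rel_iff)
  moreover have "Q \<in> dom (rep W h)"
    unfolding dom_rep using W(1) by (simp add: regular_near_def)
  ultimately have "a \<in> rat_reps UNIV // rat_rel UNIV \<and> (\<exists>f\<in>a. Q \<in> dom f)"
    by (intro conjI bexI[of _ "rep W h"])
  then show "a \<in> carrier (local_ring UNIV Q)"
    unfolding local_ring_def function_field_def by simp
qed

lemma local_ring_add:
  fixes Q :: "('k::alg_closed_field, 'n::finite) proj"
  assumes "regular_near Q W h" "regular_near Q W' h'"
  shows "germ W h \<oplus>\<^bsub>local_ring UNIV Q\<^esub> germ W' h' = germ (W \<inter> W') (\<lambda>P. h P + h' P)"
  unfolding germ_def
  by (simp add: local_ring_def function_field_def pointwise_rep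
      rat_op_class[OF irreducible_UNIV regular_near_reps[OF assms(1)] regular_near_reps[OF assms(2)] regular_on_add])

lemma local_ring_mult:
  fixes Q :: "('k::alg_closed_field, 'n::finite) proj"
  assumes "regular_near Q W h" "regular_near Q W' h'"
  shows "germ W h \<otimes>\<^bsub>local_ring UNIV Q\<^esub> germ W' h' = germ (W \<inter> W') (\<lambda>P. h P * h' P)"
  unfolding germ_def
  by (simp add: local_ring_def function_field_def pointwise_rep
      rat_op_class[OF irreducible_UNIV regular_near_reps[OF assms(1)] regular_near_reps[OF assms(2)] regular_on_mult])

lemma rat_const_germ: "rat_const UNIV r = germ UNIV (\<lambda>_. r)"
  by (simp add: rat_const_def germ_def rep_def restrict_map_def)

lemma local_ring_consts: "\<zero>\<^bsub>local_ring UNIV Q\<^esub> = germ UNIV (\<lambda>_. 0)" "\<one>\<^bsub>local_ring UNIV Q\<^esub> = germ UNIV (\<lambda>_. 1)"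
  by (simp_all add: local_ring_def function_field_def rat_const_germ)

lemma cring_local_ring:
  fixes Q :: "('k::alg_closed_field, 'n::finite) proj"
  shows "cring (local_ring UNIV Q)" (is "cring ?R")
proof (rule cringI)
  note car = carrier_local_ring
  note simps = local_ring_add local_ring_mult local_ring_consts regular_near_UNIV regular_near_add regular_near_mult
  show "abelian_group ?R"
  proof (rule abelian_groupI)
    fix x assume "x \<in> carrier ?R"
    then obtain W h where W: "regular_near Q W h" "x = germ W h" by (auto simp: car)
    have N: "regular_near Q (UNIV \<inter> W) (\<lambda>P. -1 * h P)"
      by (rule regular_near_mult[OF regular_near_UNIV W(1)])
    show "\<exists>y\<in>carrier ?R. y \<oplus>\<^bsub>?R\<^esub> x = \<zero>\<^bsub>?R\<^esub>"
    proof
      show "germ (UNIV \<inter> W) (\<lambda>P. -1 * h P) \<in> carrier ?R"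
        using N car by blast
      show "germ (UNIV \<inter> W) (\<lambda>P. -1 * h P) \<oplus>\<^bsub>?R\<^esub> x = \<zero>\<^bsub>?R\<^esub>"
        unfolding W(2) local_ring_add[OF N W(1)] local_ring_consts
        by (rule germ_eq[OF regular_near_add[OF N W(1)] regular_near_UNIV[of Q]]) simp
    qed
    show "\<zero>\<^bsub>?R\<^esub> \<oplus>\<^bsub>?R\<^esub> x = x"
      by (simp add: W simps)
  next
    fix x y assume "x \<in> carrier ?R" "y \<in> carrier ?R"
    then obtain W h W' h' where W: "regular_near Q W h" "x = germ W h" "regular_near Q W' h'" "y = germ W' h'"
      by (auto simp: car)
    show "x \<oplus>\<^bsub>?R\<^esub> y \<in> carrier ?R"
      unfolding car W(2,4) local_ring_add[OF W(1,3)] using regular_near_add[OF W(1,3)] by blast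
    show "x \<oplus>\<^bsub>?R\<^esub> y = y \<oplus>\<^bsub>?R\<^esub> x"
      by (simp add: W simps Int_commute add.commute)
  next
    fix x y z assume "x \<in> carrier ?R" "y \<in> carrier ?R" "z \<in> carrier ?R"
    then obtain W h W' h' W'' h'' where W: "regular_near Q W h" "x = germ W h" "regular_near Q W' h'" "y = germ W' h'"
        "regular_near Q W'' h''" "z = germ W'' h''"
      by (auto simp: car)
    show "x \<oplus>\<^bsub>?R\<^esub> y \<oplus>\<^bsub>?R\<^esub> z = x \<oplus>\<^bsub>?R\<^esub> (y \<oplus>\<^bsub>?R\<^esub> z)"
      by (simp add: W simps Int_assoc add.assoc)
  next
    show "\<zero>\<^bsub>?R\<^esub> \<in> carrier ?R"
      using regular_near_UNIV by (auto simp: car local_ring_consts)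
  qed
  show "comm_monoid ?R"
  proof (rule comm_monoidI)
    fix x assume "x \<in> carrier ?R"
    then obtain W h where W: "regular_near Q W h" "x = germ W h" by (auto simp: car)
    show "\<one>\<^bsub>?R\<^esub> \<otimes>\<^bsub>?R\<^esub> x = x"
      by (simp add: W simps)
  next
    fix x y assume "x \<in> carrier ?R" "y \<in> carrier ?R"
    then obtain W h W' h' where W: "regular_near Q W h" "x = germ W h" "regular_near Q W' h'" "y = germ W' h'"
      by (auto simp: car)
    show "x \<otimes>\<^bsub>?R\<^esub> y \<in> carrier ?R"
      unfolding car W(2,4) local_ring_mult[OF W(1,3)] using regular_near_mult[OF W(1,3)] by blast
    show "x \<otimes>\<^bsub>?R\<^esub> y = y \<otimes>\<^bsub>?R\<^esub> x"
      by (simp add: W simps Int_commute mult.commute)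
  next
    fix x y z assume "x \<in> carrier ?R" "y \<in> carrier ?R" "z \<in> carrier ?R"
    then obtain W h W' h' W'' h'' where W: "regular_near Q W h" "x = germ W h" "regular_near Q W' h'" "y = germ W' h'"
        "regular_near Q W'' h''" "z = germ W'' h''"
      by (auto simp: car)
    show "x \<otimes>\<^bsub>?R\<^esub> y \<otimes>\<^bsub>?R\<^esub> z = x \<otimes>\<^bsub>?R\<^esub> (y \<otimes>\<^bsub>?R\<^esub> z)"
      by (simp add: W simps Int_assoc mult.assoc)
  next
    show "\<one>\<^bsub>?R\<^esub> \<in> carrier ?R"
      using regular_near_UNIV by (auto simp: car local_ring_consts)
  qed
  fix x y z assume "x \<in> carrier ?R" "y \<in> carrier ?R" "z \<in> carrier ?R"
  then obtain W h W' h' W'' h'' where W: "regular_near Q W h" "x = germ W h" "regular_near Q W' h'" "y = germ W' h'"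
      "regular_near Q W'' h''" "z = germ W'' h''"
    by (auto simp: car)
  have "W \<inter> W' \<inter> W'' = W \<inter> W'' \<inter> (W' \<inter> W'')" by auto
  then show "(x \<oplus>\<^bsub>?R\<^esub> y) \<otimes>\<^bsub>?R\<^esub> z = x \<otimes>\<^bsub>?R\<^esub> z \<oplus>\<^bsub>?R\<^esub> y \<otimes>\<^bsub>?R\<^esub> z"
    by (simp add: W simps distrib_right)
qed

section \<open>Bounding the dimension of a quotient ring\<close>

text \<open>The base field as a ring record, so that the constants in the quotient ring are the
  image of a field under a ring homomorphism and form a subfield.\<close>

definition scalar_ring :: "'k::field ring" where
  "scalar_ring = \<lparr>carrier = UNIV, mult = (*), one = 1, zero = 0, add = (+)\<rparr>"

lemma field_scalar_ring: "field (scalar_ring :: 'k::field ring)"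
proof (rule cring.cring_fieldI2)
  show "cring (scalar_ring :: 'k ring)"
    by (intro cringI abelian_groupI comm_monoidI)
      (auto simp: scalar_ring_def algebra_simps intro: exI[of _ "- _"] left_minus)
  show "\<exists>b\<in>carrier scalar_ring. a \<otimes>\<^bsub>scalar_ring\<^esub> b = \<one>\<^bsub>scalar_ring\<^esub>"
    if "a \<in> carrier scalar_ring" "a \<noteq> \<zero>\<^bsub>scalar_ring\<^esub>" for a :: 'k
    using that by (intro bexI[of _ "inverse a"]) (auto simp: scalar_ring_def)
qed (simp add: scalar_ring_def)

lemma (in ring) dimension_trivial_ring:
  assumes "dimension n K E" "carrier R = {\<zero>}"
  shows "n = 0 \<and> E = {\<zero>}"
  using assms(1)
proof (induction rule: dimension.induct)
  case (Suc_dim v E n)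
  then show ?case using assms(2) by auto
qed simp

text \<open>The i-th set consists of the sums of h(c_j) s_j over j < i plus an element of
  \<open>I\<close>. The recursion mirrors \<open>line_extension\<close>, so that each step raises
  the dimension of the image in the quotient by at most one.\<close>

primrec truncations :: "('a, 'b) ring_scheme \<Rightarrow> 'a set \<Rightarrow> ('k \<Rightarrow> 'a) \<Rightarrow> (nat \<Rightarrow> 'a) \<Rightarrow> nat \<Rightarrow> 'a set" where
  "truncations R I h s 0 = I"
| "truncations R I h s (Suc i) = {h c \<otimes>\<^bsub>R\<^esub> s i \<oplus>\<^bsub>R\<^esub> t | c t. t \<in> truncations R I h s i}"

text \<open>\<open>ring.dimension\<close> is a relation, so the images of the truncations are shown
  to have some dimension j \<le> i each; uniqueness of dimension identifies the last one with
  m.\<close>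

lemma quotient_dimension_le:
  fixes R (structure) and h :: "'k::field \<Rightarrow> 'a"
  assumes "cring R" "ideal I R" "h \<in> ring_hom scalar_ring R" "\<And>i. s i \<in> carrier R"
    and full: "carrier R \<subseteq> truncations R I h s n"
    and dim: "ring.dimension (R Quot I) m (range (\<lambda>c. I +> h c)) (carrier (R Quot I))"
  shows "m \<le> n"
proof -
  interpret cring R by fact
  interpret I: ideal I R by fact
  let ?A = "R Quot I" and ?\<pi> = "(+>) I"
  interpret A: cring ?A by (rule I.quotient_is_cring) fact
  have h_closed: "h c \<in> carrier R" for c
    using assms(3) by (auto simp: ring_hom_def scalar_ring_def)
  have \<pi>: "?\<pi> \<in> ring_hom R ?A" by (rule I.rcos_ring_hom)
  have h\<pi>: "ring_hom_ring scalar_ring ?A (\<lambda>c. ?\<pi> (h c))"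
    using ring_hom_trans[OF assms(3) \<pi>] field.is_ring[OF field_scalar_ring] A.ring_axioms
    by (intro ring_hom_ringI2) (auto simp: comp_def)
  show ?thesis
  proof (cases "\<one>\<^bsub>?A\<^esub> = \<zero>\<^bsub>?A\<^esub>")
    \<comment> \<open>In the zero ring the image of the constants is not a subfield, so the theory
      of dimension over a subfield does not apply.\<close>
    case True
    then have "carrier ?A = {\<zero>\<^bsub>?A\<^esub>}" by (rule A.one_zeroD)
    then show ?thesis using A.dimension_trivial_ring[OF dim] by simp
  next
    case False
    let ?K = "range (\<lambda>c. ?\<pi> (h c))"
    have K: "subfield ?K ?A"
      using ring_hom_ring.img_is_subfield(2)[OF h\<pi> field.carrier_is_subfield[OF field_scalar_ring] False]
      by (simp add: scalar_ring_def)
    have trunc_closed: "truncations R I h s i \<subseteq> carrier R" for i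
      by (induction i) (use I.a_subset h_closed assms(4) in auto)
    have "\<exists>j\<le>i. A.dimension j ?K (?\<pi> ` truncations R I h s i)" for i
    proof (induction i)
      case 0
      have "?\<pi> ` I = {\<zero>\<^bsub>?A\<^esub>}"
      proof -
        have "I \<noteq> {}" using subgroup.one_closed[OF additive_subgroup.a_subgroup[OF I.is_additive_subgroup]] by (metis empty_iff)
        then show ?thesis by (auto simp: FactRing_def I.a_rcos_const)
      qed
      then show ?case using A.zero_dim by auto
    next
      case (Suc i)
      then obtain j where j: "j \<le> i" "A.dimension j ?K (?\<pi> ` truncations R I h s i)" by blast
      let ?E = "?\<pi> ` truncations R I h s i" and ?v = "?\<pi> (s i)"
      have v: "?v \<in> carrier ?A"
        using \<pi> assms(4) by (auto simp: ring_hom_def)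
      have eq: "?\<pi> ` truncations R I h s (Suc i) = A.line_extension ?K ?v ?E"
      proof -
        have "?\<pi> (h c \<otimes> s i \<oplus> t) = ?\<pi> (h c) \<otimes>\<^bsub>?A\<^esub> ?v \<oplus>\<^bsub>?A\<^esub> ?\<pi> t"
          if "t \<in> truncations R I h s i" for c t
          using that trunc_closed[of i] h_closed assms(4) ring_hom_add[OF \<pi>] ring_hom_mult[OF \<pi>] by auto
        then show ?thesis
          by (auto simp: A.line_extension_mem_iff set_eq_iff) blast+
      qed
      show ?case
      proof (cases "?v \<in> ?E")
        case True
        have "A.line_extension ?K ?v ?E = ?E"
        proof
          show "A.line_extension ?K ?v ?E \<subseteq> ?E"
            using A.space_subgroup_props[OF K j(2)] True by (auto simp: A.line_extension_mem_iff)
          have zero: "\<zero>\<^bsub>?A\<^esub> \<in> ?K"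
            using subringE(2)[OF subfieldE(1)[OF K]] .
          show "?E \<subseteq> A.line_extension ?K ?v ?E"
          proof
            fix u assume u: "u \<in> ?E"
            then have "u \<in> carrier ?A"
              using A.space_subgroup_props(1)[OF K j(2)] by blast
            then have "u = \<zero>\<^bsub>?A\<^esub> \<otimes>\<^bsub>?A\<^esub> ?v \<oplus>\<^bsub>?A\<^esub> u"
              using v by simp
            then show "u \<in> A.line_extension ?K ?v ?E"
              unfolding A.line_extension_mem_iff using zero u by blast
          qed
        qed
        then show ?thesis using j unfolding eq by (intro exI[of _ j]) simp
      next
        case False
        then show ?thesis
          using A.Suc_dim[OF v False j(2)] j(1) eq by (intro exI[of _ "Suc j"]) auto
      qed
    qed
    then obtain j where j: "j \<le> n" "A.dimension j ?K (?\<pi> ` truncations R I h s n)" by blast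
    have "?\<pi> ` truncations R I h s n = carrier ?A"
      using full trunc_closed[of n] by (auto simp: FactRing_def A_RCOSETS_def')
    then have "m = j"
      using A.dimension_is_inj[OF K dim] j(2) by simp
    then show ?thesis using j(1) by simp
  qed
qed

section \<open>Contact with the tangent line\<close>

lemma regular_on_inverse:
  assumes "regular_on U f" "\<And>P. P \<in> U \<Longrightarrow> f P \<noteq> 0"
  shows "regular_on U (\<lambda>P. 1 / f P)"
proof (rule regular_onI)
  fix P assume P: "P \<in> U"
  obtain W d h h' where W: "openin (top_of_set U) W" "P \<in> W" "form_fun d h" "form_fun d h'"
    "\<And>Q. Q \<in> W \<Longrightarrow> h' (coords Q) \<noteq> 0" "\<And>Q. Q \<in> W \<Longrightarrow> f Q = h (coords Q) / h' (coords Q)"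
    by (rule regular_onE[OF assms(1) P]) (rule that)
  have "h (coords Q) \<noteq> 0 \<and> 1 / f Q = h' (coords Q) / h (coords Q)" if "Q \<in> W" for Q
    using assms(2)[of Q] W(6)[OF that] subsetD[OF openin_imp_subset[OF W(1)] that] by auto
  with W(1-4) show "\<exists>W d h h'. openin (top_of_set U) W \<and> P \<in> W \<and> form_fun d h \<and> form_fun d h' \<and>
     (\<forall>Q\<in>W. h' (coords Q) \<noteq> 0 \<and> 1 / f Q = h (coords Q) / h' (coords Q))"
    by (intro exI[of _ W] exI[of _ d] exI[of _ h'] exI[of _ h]) simp
qed

lemma regular_on_power: "regular_on U f \<Longrightarrow> regular_on U (\<lambda>P. f P ^ n)"
  by (induction n) (simp_all add: regular_on_const regular_on_mult)

lemma regular_on_sum: "(\<And>i. i \<in> A \<Longrightarrow> regular_on U (f i)) \<Longrightarrow> regular_on U (\<lambda>P. \<Sum>i\<in>A. f i P)"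
  by (induction A rule: infinite_finite_induct) (simp_all add: regular_on_const regular_on_add)

lemma regular_on_poly: "regular_on U f \<Longrightarrow> regular_on U (\<lambda>P. poly p (f P))"
  unfolding poly_altdef by (intro regular_on_sum regular_on_mult regular_on_const regular_on_power)

lemma regular_on_ev2: "regular_on U f \<Longrightarrow> regular_on U g \<Longrightarrow> regular_on U (\<lambda>P. ev2 a (f P) (g P))"
  unfolding ev2_altdef by (intro regular_on_sum regular_on_mult regular_on_const regular_on_power)

lemma regular_near_inverse:
  fixes Q :: "('k::field, 'n::finite) proj"
  assumes "regular_near Q W h" "h Q \<noteq> 0"
  shows "regular_near Q {P \<in> W. h P \<noteq> 0} (\<lambda>P. 1 / h P)"
  unfolding regular_near_def
proof (intro conjI)
  have "openin (top_of_set W) {P \<in> W. h P \<noteq> 0}" "open W"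
    using assms(1) openin_regular_nonzero by (auto simp: regular_near_def)
  then show "open {P \<in> W. h P \<noteq> 0}"
    using openin_open_trans by blast
  show "regular_on {P \<in> W. h P \<noteq> 0} (\<lambda>P. 1 / h P)"
    using assms(1) by (intro regular_on_inverse) (auto simp: regular_near_def elim: regular_on_subset)
qed (use assms in \<open>auto simp: regular_near_def\<close>)

lemma local_equation_germ:
  fixes Q :: "('k::alg_closed_field, 'n::finite) proj"
  assumes "homogeneous d F" "homogeneous d H" "mp_eval H (coords Q) \<noteq> 0"
  shows "regular_near Q {P. mp_eval H (coords P) \<noteq> 0} (\<lambda>P. mp_eval F (coords P) / mp_eval H (coords P))"
    and "germ {P. mp_eval H (coords P) \<noteq> 0} (\<lambda>P. mp_eval F (coords P) / mp_eval H (coords P))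
      = rat_rel UNIV `` {\<lambda>P. if mp_eval H (coords P) \<noteq> 0
          then Some (mp_eval F (coords P) / mp_eval H (coords P)) else None}"
proof -
  show "regular_near Q {P. mp_eval H (coords P) \<noteq> 0} (\<lambda>P. mp_eval F (coords P) / mp_eval H (coords P))"
    unfolding regular_near_def using assms(3)
    by (auto intro!: open_form_nonzero form_funI[OF assms(2)] regular_on_quotient[OF form_funI[OF assms(1)]])
qed (simp add: germ_def rep_def)

lemma local_equations_carrier:
  fixes Q :: "('k::alg_closed_field, 'n::finite) proj"
  shows "local_equations Q F \<subseteq> carrier (local_ring UNIV Q)"
proof
  fix a assume "a \<in> local_equations Q F"
  then obtain H d where H: "homogeneous d F" "homogeneous d H" "mp_eval H (coords Q) \<noteq> 0"
    and a: "a = rat_rel UNIV `` {\<lambda>P. if mp_eval H (coords P) \<noteq> 0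
          then Some (mp_eval F (coords P) / mp_eval H (coords P)) else None}"
    unfolding local_equations_def by auto
  show "a \<in> carrier (local_ring UNIV Q)"
    unfolding carrier_local_ring a local_equation_germ(2)[OF H, symmetric]
    using local_equation_germ(1)[OF H] by blast
qed

section \<open>The local ring of the plane in an affine chart\<close>

context frame
begin

definition chart :: "('k, 3) proj set" where "chart = {P. cz (coords P) \<noteq> 0}"
definition ax :: "('k, 3) proj \<Rightarrow> 'k" where "ax P = cx (coords P) / cz (coords P)"
definition ay :: "('k, 3) proj \<Rightarrow> 'k" where "ay P = cy (coords P) / cz (coords P)"
definition aff :: "'k poly poly \<Rightarrow> ('k, 3) proj \<Rightarrow> 'k" where "aff a P = ev2 a (ax P) (ay P)"

lemma v2_comb: "v2 = comb 0 0 1" "v2 \<noteq> 0"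
  using independent[of 0 0 1] by (auto simp: comb_def)

lemma origin: "point v2 \<in> chart" "ax (point v2) = 0" "ay (point v2) = 0"
proof -
  have v2: "cx v2 = 0" "cy v2 = 0" "cz v2 = 1"
    using coords_comb[of 0 0 1] by (simp_all flip: v2_comb(1))
  show "point v2 \<in> chart"
    unfolding chart_def using form_zero_point[OF form_fun_matrix v2_comb(2), of coord_matrix 3] v2(3) by simp
  show "ax (point v2) = 0" "ay (point v2) = 0"
    unfolding ax_def ay_def
    using form_quotient_point[OF form_fun_matrix form_fun_matrix v2_comb(2), of coord_matrix 1 coord_matrix 3]
      form_quotient_point[OF form_fun_matrix form_fun_matrix v2_comb(2), of coord_matrix 2 coord_matrix 3] v2
    by simp_all
qed

lemma regular_chart: "regular_on chart ax" "regular_on chart ay" "regular_on chart (aff a)"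
proof -
  show x: "regular_on chart ax" and y: "regular_on chart ay"
    unfolding ax_def[abs_def] ay_def[abs_def]
    by (rule regular_on_quotient[OF form_fun_matrix form_fun_matrix], simp add: chart_def)+
  show "regular_on chart (aff a)"
    unfolding aff_def[abs_def] by (rule regular_on_ev2[OF x y])
qed

lemma open_chart: "open chart"
  unfolding chart_def by (rule open_form_nonzero[OF form_fun_matrix])

lemma regular_near_chart: "regular_on chart h \<Longrightarrow> regular_near (point v2) chart h"
  using open_chart origin(1) by (simp add: regular_near_def)

lemma form_on_chart:
  assumes "P \<in> chart" "wle 1 1 D a" "\<And>x y z. h (comb x y z) = hv D a x y z"
  shows "h (coords P) = cz (coords P) ^ D * aff a P"
proof -
  have "h (coords P) = hv D a (cx (coords P)) (cy (coords P)) (cz (coords P))"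
    unfolding assms(3)[symmetric] comb_coords ..
  then show ?thesis
    using assms(1) by (simp add: hv_nonzero[OF _ assms(2)] aff_def ax_def ay_def chart_def)
qed

text \<open>The i-th truncation for the generators 1, x, ..., x^(i-1) contains the polynomials in x
  of degree below i, shifted by elements of \<open>I\<close>; each step splits off the top
  coefficient.\<close>

lemma germ_poly_truncation:
  defines "R \<equiv> local_ring UNIV (point v2)"
  assumes I: "ideal I R" "\<iota> \<in> I" and c: "\<And>j. i \<le> j \<Longrightarrow> coeff c j = 0"
  shows "germ chart (\<lambda>P. poly c (ax P)) \<oplus>\<^bsub>R\<^esub> \<iota> \<in>
    truncations R I (rat_const UNIV) (\<lambda>i. germ chart (\<lambda>P. ax P ^ i)) i"
  using c
proof (induction i arbitrary: c)
  case 0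
  interpret cring R unfolding R_def by (rule cring_local_ring)
  interpret I: ideal I R by fact
  have "c = 0" using 0 by (auto simp: poly_eq_iff)
  then have "germ chart (\<lambda>P. poly c (ax P)) = \<zero>\<^bsub>R\<^esub>"
    unfolding R_def local_ring_consts
    by (intro germ_eq[OF regular_near_chart[OF regular_on_poly[OF regular_chart(1)]] regular_near_UNIV]) simp
  then show ?case
    using I(2) I.Icarr by simp
next
  case (Suc i)
  interpret cring R unfolding R_def by (rule cring_local_ring)
  interpret I: ideal I R by fact
  define c' where "c' = c - monom (coeff c i) i"
  have "coeff c' j = 0" if "i \<le> j" for j
    using Suc.prems[of j] that by (cases "j = i") (auto simp: c'_def)
  then have IH: "germ chart (\<lambda>P. poly c' (ax P)) \<oplus>\<^bsub>R\<^esub> \<iota> \<in>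
      truncations R I (rat_const UNIV) (\<lambda>i. germ chart (\<lambda>P. ax P ^ i)) i"
    by (rule Suc.IH)
  note near = regular_near_chart[OF regular_on_poly[OF regular_chart(1)]]
    regular_near_chart[OF regular_on_power[OF regular_chart(1)]] regular_near_UNIV[of "point v2"]
  have prod: "rat_const UNIV (coeff c i) \<otimes>\<^bsub>R\<^esub> germ chart (\<lambda>P. ax P ^ i) = germ chart (\<lambda>P. coeff c i * ax P ^ i)"
    unfolding R_def rat_const_germ local_ring_mult[OF near(3,2)] by simp
  have nearm: "regular_near (point v2) chart (\<lambda>P. coeff c i * ax P ^ i)"
    by (rule regular_near_chart[OF regular_on_mult[OF regular_on_const regular_on_power[OF regular_chart(1)]]])
  have sum: "germ chart (\<lambda>P. coeff c i * ax P ^ i) \<oplus>\<^bsub>R\<^esub> germ chart (\<lambda>P. poly c' (ax P)) = germ chart (\<lambda>P. poly c (ax P))"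
    unfolding R_def local_ring_add[OF nearm near(1)] by (simp add: c'_def poly_monom)
  have carr: "germ chart (\<lambda>P. coeff c i * ax P ^ i) \<in> carrier R" "germ chart (\<lambda>P. poly c' (ax P)) \<in> carrier R"
    unfolding R_def carrier_local_ring using nearm near(1) by blast+
  have "germ chart (\<lambda>P. poly c (ax P)) \<oplus>\<^bsub>R\<^esub> \<iota> = rat_const UNIV (coeff c i) \<otimes>\<^bsub>R\<^esub> germ chart (\<lambda>P. ax P ^ i) \<oplus>\<^bsub>R\<^esub>
      (germ chart (\<lambda>P. poly c' (ax P)) \<oplus>\<^bsub>R\<^esub> \<iota>)"
    unfolding prod using carr I.Icarr[OF I(2)] by (simp add: a_assoc flip: sum)
  then show ?case using IH by auto
qed

text \<open>On y = 0 the equation f becomes x^n e0 with e0 a unit at the origin, so modulo f and y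
  every germ is a polynomial in x of degree below n.\<close>

lemma intersection_mult_le:
  assumes F: "homogeneous d F" "wle 1 1 d f" "\<And>x y z. mp_eval F (comb x y z) = hv d f x y z"
    and L: "homogeneous 1 L" "\<And>x y z. mp_eval L (comb x y z) = l * y" "l \<noteq> 0"
    and f: "f = pCons ([:0, 1:] ^ n * e0) f1" "poly e0 0 \<noteq> 0"
    and mult: "intersection_mult F L (point v2) m"
  shows "m \<le> n"
proof -
  define R where "R = local_ring UNIV (point v2)"
  define I where "I = Idl\<^bsub>R\<^esub> (local_equations (point v2) F \<union> local_equations (point v2) L)"
  have dim: "ring.dimension (R Quot I) m (range (\<lambda>c. I +>\<^bsub>R\<^esub> rat_const UNIV c)) (carrier (R Quot I))"
    using mult unfolding intersection_mult_def R_def I_def Let_def .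
  interpret R: cring R unfolding R_def by (rule cring_local_ring)
  have sub: "local_equations (point v2) F \<union> local_equations (point v2) L \<subseteq> carrier R"
    unfolding R_def using local_equations_carrier by blast
  have I: "ideal I R" unfolding I_def by (rule R.genideal_ideal[OF sub])
  interpret I: ideal I R by (rule I)
  have gens: "local_equations (point v2) F \<union> local_equations (point v2) L \<subseteq> I"
    unfolding I_def by (rule R.genideal_self[OF sub])
  define \<phi> \<psi> where "\<phi> = germ chart (aff f)" and "\<psi> = germ chart ay"
  note near_f = regular_near_chart[OF regular_chart(3)[of f]] and near_y = regular_near_chart[OF regular_chart(2)]
  have "form_fun (d * 1) (\<lambda>v. cz v ^ d)"
    by (intro form_fun_power form_fun_matrix)
  then obtain H where H: "homogeneous d H" "\<And>v. mp_eval H v = cz v ^ d"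
    by (rule form_funE) simp
  have HQ: "mp_eval H (coords (point v2)) \<noteq> 0"
    using origin(1) by (simp add: H(2) chart_def)
  have "\<phi> = germ {P. mp_eval H (coords P) \<noteq> 0} (\<lambda>P. mp_eval F (coords P) / mp_eval H (coords P))"
    unfolding \<phi>_def
  proof (rule germ_eq[OF near_f local_equation_germ(1)[OF F(1) H(1) HQ]])
    fix P assume "P \<in> chart"
    then show "aff f P = mp_eval F (coords P) / mp_eval H (coords P)"
      using form_on_chart[OF _ F(2,3), of P] by (simp add: H(2) chart_def)
  qed
  then have "\<phi> \<in> local_equations (point v2) F"
    unfolding local_equation_germ(2)[OF F(1) H(1) HQ] local_equations_def using F(1) H(1) HQ by blast
  then have \<phi>: "\<phi> \<in> I" using gens by blast
  have "\<psi> \<in> I"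
  proof -
    obtain H' where H': "homogeneous 1 H'" "\<And>v. mp_eval H' v = cz v"
      using form_fun_matrix[of coord_matrix 3] by (rule form_funE) simp
    have H'Q: "mp_eval H' (coords (point v2)) \<noteq> 0"
      using origin(1) by (simp add: H'(2) chart_def)
    define lam where "lam = germ {P. mp_eval H' (coords P) \<noteq> 0} (\<lambda>P. mp_eval L (coords P) / mp_eval H' (coords P))"
    have "lam \<in> local_equations (point v2) L"
      unfolding lam_def local_equation_germ(2)[OF L(1) H'(1) H'Q] local_equations_def
      using L(1) H'(1) H'Q by blast
    then have lam: "lam \<in> I" using gens by blast
    have near': "regular_near (point v2) {P. mp_eval H' (coords P) \<noteq> 0} (\<lambda>P. mp_eval L (coords P) / mp_eval H' (coords P))"
      by (rule local_equation_germ(1)[OF L(1) H'(1) H'Q])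
    have "germ UNIV (\<lambda>_. 1 / l) \<otimes>\<^bsub>R\<^esub> lam = \<psi>"
      unfolding R_def lam_def \<psi>_def local_ring_mult[OF regular_near_UNIV near']
    proof (rule germ_eq[OF regular_near_mult[OF regular_near_UNIV near'] near_y])
      fix P assume "P \<in> chart"
      have "mp_eval L (coords P) = l * cy (coords P)"
        using L(2)[of "cx (coords P)" "cy (coords P)" "cz (coords P)"] by (simp add: comb_coords)
      then show "1 / l * (mp_eval L (coords P) / mp_eval H' (coords P)) = ay P"
        using L(3) by (simp add: H'(2) ay_def)
    qed
    moreover have "germ UNIV (\<lambda>_. 1 / l) \<in> carrier R"
      unfolding R_def carrier_local_ring using regular_near_UNIV by blast
    ultimately show ?thesis
      using I.I_l_closed[OF lam] by metis
  qed
  have full: "carrier R \<subseteq> truncations R I (rat_const UNIV) (\<lambda>i. germ chart (\<lambda>P. ax P ^ i)) n"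
  proof
    fix r assume "r \<in> carrier R"
    then obtain W h where W: "regular_near (point v2) W h" "r = germ W h"
      unfolding R_def carrier_local_ring by blast
    then have "regular_on W h" "point v2 \<in> W" "open W" by (auto simp: regular_near_def)
    obtain W' D k k' where W': "openin (top_of_set W) W'" "point v2 \<in> W'" "form_fun D k" "form_fun D k'"
      "\<And>P. P \<in> W' \<Longrightarrow> k' (coords P) \<noteq> 0" "\<And>P. P \<in> W' \<Longrightarrow> h P = k (coords P) / k' (coords P)"
      by (rule regular_onE[OF \<open>regular_on W h\<close> \<open>point v2 \<in> W\<close>]) (rule that)
    obtain a where a: "wle 1 1 D a" "\<And>x y z. k (comb x y z) = hv D a x y z"
      by (rule dehomogenize[OF W'(3)]) (rule that)
    obtain b where b: "wle 1 1 D b" "\<And>x y z. k' (comb x y z) = hv D b x y z"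
      by (rule dehomogenize[OF W'(4)]) (rule that)
    have hab: "aff b P \<noteq> 0" "h P = aff a P / aff b P" if "P \<in> W'" "P \<in> chart" for P
      using W'(5,6)[OF that(1)] form_on_chart[OF that(2) a] form_on_chart[OF that(2) b] that(2)
      by (auto simp: chart_def)
    obtain a0 a' where a0: "a = pCons a0 a'" by (cases a)
    obtain b0 b' where b0: "b = pCons b0 b'" by (cases b)
    have bQ: "aff b (point v2) \<noteq> 0"
      using hab(1)[OF W'(2) origin(1)] .
    then have "poly b0 0 \<noteq> 0"
      by (simp add: aff_def origin b0)
    then obtain \<iota> where \<iota>: "[:0, 1:] ^ n dvd 1 - \<iota> * b0"
      by (rule inverse_mod_power)
    \<comment> \<open>c is a0 / b0 modulo x^n, that is, the germ restricted to y = 0 and truncated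
      at degree n.\<close>
    define c where "c = (\<iota> * a0) mod [:0, 1:] ^ n"
    have c_deg: "coeff c j = 0" if "n \<le> j" for j
    proof (cases "c = 0")
      case False
      have "([:0, 1:] :: 'k poly) ^ n \<noteq> 0" "degree (([:0, 1:] :: 'k poly) ^ n) = n"
        by (simp_all add: degree_power_eq)
      then have "degree c < n"
        using degree_mod_less[of "[:0, 1:] ^ n" "\<iota> * a0"] False by (simp add: c_def)
      then show ?thesis using that by (intro coeff_eq_0) simp
    qed simp
    have "[:0, 1:] ^ n dvd \<iota> * a0 - c"
      unfolding c_def by (rule dvd_minus_mod)
    then have "[:0, 1:] ^ n dvd (1 - \<iota> * b0) * a0 + (\<iota> * a0 - c) * b0"
      using \<iota> by (intro dvd_add dvd_mult2)
    moreover have "(1 - \<iota> * b0) * a0 + (\<iota> * a0 - c) * b0 = a0 - c * b0"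
      by (simp add: algebra_simps)
    ultimately have "[:0, 1:] ^ n dvd a0 - c * b0"
      by simp
    then obtain q where q: "a0 - c * b0 = [:0, 1:] ^ n * q" ..
    have near_b: "regular_near (point v2) {P \<in> chart. aff b P \<noteq> 0} (\<lambda>P. 1 / aff b P)"
      by (rule regular_near_inverse[OF regular_near_chart[OF regular_chart(3)] bQ])
    have near_e: "regular_near (point v2) {P \<in> chart. poly e0 (ax P) \<noteq> 0} (\<lambda>P. 1 / poly e0 (ax P))"
      by (rule regular_near_inverse[OF regular_near_chart[OF regular_on_poly[OF regular_chart(1)]]])
        (simp add: origin f(2))
    \<comment> \<open>The coefficients of f and y: a - c b = x^n q + y (a' - c b'), where x^n = (f -
      y f1) / e0 is substituted and everything is divided by b.\<close>
    define g1 where "g1 P = poly q (ax P) * (1 / poly e0 (ax P)) * (1 / aff b P)" for P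
    define g2 where "g2 P = (aff (a' - smult c b') P + (-1) * (poly q (ax P) * aff f1 P) * (1 / poly e0 (ax P))) * (1 / aff b P)" for P
    define N where "N = {P \<in> chart. poly e0 (ax P) \<noteq> 0} \<inter> {P \<in> chart. aff b P \<noteq> 0}"
    have g: "regular_near (point v2) N g1" "regular_near (point v2) N g2"
    proof -
      have "chart \<inter> N = N" by (auto simp: N_def)
      have "regular_near (point v2) (chart \<inter> {P \<in> chart. poly e0 (ax P) \<noteq> 0} \<inter> {P \<in> chart. aff b P \<noteq> 0}) g1"
        unfolding g1_def[abs_def]
        by (intro regular_near_mult near_b near_e regular_near_chart regular_on_poly regular_chart)
      moreover have "regular_near (point v2) ((chart \<inter> (chart \<inter> {P \<in> chart. poly e0 (ax P) \<noteq> 0})) \<inter> {P \<in> chart. aff b P \<noteq> 0}) g2"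
        unfolding g2_def[abs_def]
        by (intro regular_near_mult regular_near_add near_b near_e regular_near_chart regular_on_mult regular_on_const
            regular_on_poly regular_chart)
      ultimately show "regular_near (point v2) N g1" "regular_near (point v2) N g2"
        using \<open>chart \<inter> N = N\<close> by (simp_all add: N_def Int_assoc)
    qed
    have decomp: "h P = poly c (ax P) + (g1 P * aff f P + g2 P * ay P)" if "P \<in> W'" "P \<in> N" for P
    proof -
      define A B E0 Q0 where "A = aff (a' - smult c b') P" and "B = aff b P" and "E0 = poly e0 (ax P)" and "Q0 = poly q (ax P)"
      have "P \<in> chart" and nz: "B \<noteq> 0" "E0 \<noteq> 0"
        using that(2) by (auto simp: N_def B_def E0_def)
      have "a - smult c b = pCons ([:0, 1:] ^ n * q) (a' - smult c b')"
        by (simp add: a0 b0 flip: q)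
      then have "aff (a - smult c b) P = aff (pCons ([:0, 1:] ^ n * q) (a' - smult c b')) P"
        by (rule arg_cong)
      then have ab: "aff a P = poly c (ax P) * B + (ax P ^ n * Q0 + ay P * A)"
        by (simp add: aff_def A_def B_def Q0_def algebra_simps)
      have ff: "aff f P = ax P ^ n * E0 + ay P * aff f1 P"
        by (simp add: aff_def f(1) E0_def)
      have "g1 P * aff f P + g2 P * ay P = (ax P ^ n * Q0 + ay P * A) / B"
        unfolding g1_def g2_def ff A_def[symmetric] B_def[symmetric] E0_def[symmetric] Q0_def[symmetric]
        using nz by (simp add: field_simps)
      then show ?thesis
        using hab(2)[OF that(1) \<open>P \<in> chart\<close>] nz unfolding ab by (simp add: B_def add_divide_distrib)
    qed
    define \<rho> where "\<rho> = germ N g1 \<otimes>\<^bsub>R\<^esub> \<phi> \<oplus>\<^bsub>R\<^esub> germ N g2 \<otimes>\<^bsub>R\<^esub> \<psi>"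
    have carr: "germ N g1 \<in> carrier R" "germ N g2 \<in> carrier R"
      unfolding R_def carrier_local_ring using g by blast+
    have "\<rho> \<in> I"
      unfolding \<rho>_def using I.I_l_closed[OF \<phi> carr(1)] I.I_l_closed[OF \<open>\<psi> \<in> I\<close> carr(2)]
      by (rule additive_subgroup.a_closed[OF I.is_additive_subgroup])
    note near_c = regular_near_chart[OF regular_on_poly[OF regular_chart(1)], of c]
    have \<rho>: "\<rho> = germ ((N \<inter> chart) \<inter> (N \<inter> chart)) (\<lambda>P. g1 P * aff f P + g2 P * ay P)"
      unfolding \<rho>_def R_def \<phi>_def \<psi>_def local_ring_mult[OF g(1) near_f] local_ring_mult[OF g(2) near_y]
        local_ring_add[OF regular_near_mult[OF g(1) near_f] regular_near_mult[OF g(2) near_y]] ..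
    note near_\<rho> = regular_near_add[OF regular_near_mult[OF g(1) near_f] regular_near_mult[OF g(2) near_y]]
    have nearW': "regular_near (point v2) W' h"
      using W'(1,2) \<open>open W\<close> \<open>regular_on W h\<close> openin_imp_subset[OF W'(1)] openin_open_trans
      by (auto simp: regular_near_def elim: regular_on_subset)
    have "r = germ W' h"
      unfolding W(2) by (rule germ_eq[OF W(1) nearW']) simp
    also have "\<dots> = germ chart (\<lambda>P. poly c (ax P)) \<oplus>\<^bsub>R\<^esub> \<rho>"
      unfolding \<rho> unfolding R_def local_ring_add[OF near_c near_\<rho>]
      by (rule germ_eq[OF nearW' regular_near_add[OF near_c near_\<rho>]]) (simp add: decomp)
    finally show "r \<in> truncations R I (rat_const UNIV) (\<lambda>i. germ chart (\<lambda>P. ax P ^ i)) n"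
      using germ_poly_truncation[OF I[unfolded R_def] \<open>\<rho> \<in> I\<close> c_deg] by (simp add: R_def)
  qed
  have hom: "rat_const UNIV \<in> ring_hom scalar_ring R"
  proof (rule ring_hom_memI)
    show "rat_const UNIV x \<in> carrier R" for x :: 'k
      unfolding R_def rat_const_germ carrier_local_ring using regular_near_UNIV by blast
  qed (simp_all add: scalar_ring_def R_def rat_const_germ local_ring_consts
      local_ring_add[OF regular_near_UNIV[of "point v2"] regular_near_UNIV[of "point v2"]]
      local_ring_mult[OF regular_near_UNIV[of "point v2"] regular_near_UNIV[of "point v2"]])
  have carr: "germ chart (\<lambda>P. ax P ^ i) \<in> carrier R" for i
    unfolding R_def carrier_local_ring
    using regular_near_chart[OF regular_on_power[OF regular_chart(1)]] by blast
  show ?thesis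
    by (rule quotient_dimension_le[OF R.is_cring I hom carr full dim])
qed

end

section \<open>Linear projections and function fields\<close>

lemma form_fun_matrix_mult: "form_fun 1 (\<lambda>v :: 'k ^ 'm. (M *v v) $ i)" for M :: "'k::field ^ 'm::finite ^ 'n::finite"
  unfolding matrix_vector_mult_def using form_fun_linear[of "\<lambda>j. M $ i $ j"] by simp

lemma form_fun_proj_map:
  assumes "form_fun d h"
  shows "form_fun d (\<lambda>v. h (A *v v))"
  using form_fun_compose[OF assms form_fun_matrix_mult, of A] by simp

lemma proj_map_coords: "A *v coords P \<noteq> 0 \<Longrightarrow> proj_map A P = point (A *v coords P)"
  using proj_map_point[of A "coords P"] by simp

lemma morphism_proj_map:
  fixes A :: "'k::field ^ 'n::finite ^ 'm::finite"
  assumes "\<And>P. P \<in> W \<Longrightarrow> A *v coords P \<noteq> 0"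
  shows "morphism W UNIV (proj_map A)"
  unfolding morphism_def
proof (intro conjI allI impI)
  have zero_iff: "h (coords (proj_map A P)) = 0 \<longleftrightarrow> h (A *v coords P) = 0"
    if "P \<in> W" "form_fun d h" for P d and h :: "'k ^ 'm \<Rightarrow> 'k"
    using form_zero_point[OF that(2) assms[OF that(1)]] proj_map_coords[OF assms[OF that(1)]] by simp
  show cont: "continuous_on W (proj_map A)"
    unfolding continuous_openin_preimage_eq
  proof (intro allI impI)
    fix T :: "('k, 'm) proj set" assume "open T"
    then obtain S where S: "S \<subseteq> forms" "- T = zeros S"
      unfolding open_proj_def by blast
    show "openin (top_of_set W) (W \<inter> proj_map A -` T)"
    proof (subst openin_subopen, rule ballI)
      fix P assume P: "P \<in> W \<inter> proj_map A -` T"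
      then have "proj_map A P \<notin> zeros S" using S(2) by blast
      then obtain F where F: "F \<in> S" "mp_eval F (coords (proj_map A P)) \<noteq> 0"
        unfolding zeros_def by blast
      then obtain d where d: "homogeneous d F"
        using S(1) by (auto simp: forms_def)
      let ?O = "{P. mp_eval F (A *v coords P) \<noteq> 0}"
      have "open ?O"
        by (rule open_form_nonzero[OF form_fun_proj_map[OF form_funI[OF d]]])
      then have "openin (top_of_set W) (W \<inter> ?O)" by (rule openin_open_Int)
      moreover have "P \<in> W \<inter> ?O"
        using P F(2) zero_iff[OF _ form_funI[OF d]] by auto
      moreover have "W \<inter> ?O \<subseteq> W \<inter> proj_map A -` T"
      proof
        fix R assume R: "R \<in> W \<inter> ?O"
        then have "mp_eval F (coords (proj_map A R)) \<noteq> 0"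
          using zero_iff[OF _ form_funI[OF d], of R] by simp
        then have "proj_map A R \<notin> zeros S"
          using F(1) unfolding zeros_def by blast
        then show "R \<in> W \<inter> proj_map A -` T"
          using R S(2) by blast
      qed
      ultimately show "\<exists>U. openin (top_of_set W) U \<and> P \<in> U \<and> U \<subseteq> W \<inter> proj_map A -` T" by blast
    qed
  qed
  fix U :: "('k, 'm) proj set" and f assume U: "openin (top_of_set UNIV) U \<and> regular_on U f"
  show "regular_on (W \<inter> proj_map A -` U) (f \<circ> proj_map A)"
  proof (rule regular_on_local)
    fix P assume P: "P \<in> W \<inter> proj_map A -` U"
    then have "proj_map A P \<in> U" by simp
    obtain N d h h' where N: "openin (top_of_set U) N" "proj_map A P \<in> N" "form_fun d h" "form_fun d h'"
      "\<And>Q. Q \<in> N \<Longrightarrow> h' (coords Q) \<noteq> 0" "\<And>Q. Q \<in> N \<Longrightarrow> f Q = h (coords Q) / h' (coords Q)"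
      by (rule regular_onE[OF conjunct2[OF U] \<open>proj_map A P \<in> U\<close>]) (rule that)
    obtain T where T: "open T" "N = U \<inter> T"
      using N(1) by (auto simp: openin_open)
    let ?N = "(W \<inter> proj_map A -` U) \<inter> (W \<inter> proj_map A -` T)"
    have "openin (top_of_set W) (W \<inter> proj_map A -` T)"
      using cont T(1) by (simp add: continuous_openin_preimage_eq)
    then have "openin (top_of_set (W \<inter> proj_map A -` U)) ?N"
      by (auto simp: openin_open)
    moreover have "P \<in> ?N" using P N(2) T(2) by auto
    moreover have "regular_on ?N (f \<circ> proj_map A)"
    proof (rule regular_on_cong[OF regular_on_quotient[OF form_fun_proj_map[OF N(3), of A] form_fun_proj_map[OF N(4), of A]]])
      fix R assume R: "R \<in> ?N"
      then have "R \<in> W" and RN: "proj_map A R \<in> N" using T(2) by auto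
      then show "h' (A *v coords R) \<noteq> 0"
        using zero_iff[OF _ N(4)] N(5) by blast
      show "h (A *v coords R) / h' (A *v coords R) = (f \<circ> proj_map A) R"
        using N(6)[OF RN] form_quotient_point[OF N(3,4) assms[OF \<open>R \<in> W\<close>]] proj_map_coords[OF assms[OF \<open>R \<in> W\<close>]]
        by simp
    qed
    ultimately show "\<exists>N. openin (top_of_set (W \<inter> proj_map A -` U)) N \<and> P \<in> N \<and> regular_on N (f \<circ> proj_map A)"
      by blast
  qed
qed simp

text \<open>A regular function on a subset is locally a quotient of forms of the ambient space; so
  regularity pulls back although the image is merely a subset of it.\<close>

lemma morphism_image:
  fixes \<phi> :: "('k::field, 'n::finite) proj \<Rightarrow> ('k, 'm::finite) proj"
  assumes \<phi>: "morphism X UNIV \<phi>"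
  shows "morphism X (\<phi> ` X) \<phi>"
  unfolding morphism_def
proof (intro conjI allI impI)
  show "continuous_on X \<phi>" using \<phi> by (simp add: morphism_def)
  fix U f assume "openin (top_of_set (\<phi> ` X)) U \<and> regular_on U f"
  then have f: "regular_on U f" by simp
  show "regular_on (X \<inter> \<phi> -` U) (f \<circ> \<phi>)"
  proof (rule regular_on_local)
    fix P assume P: "P \<in> X \<inter> \<phi> -` U"
    then have "\<phi> P \<in> U" by simp
    obtain N d h h' where N: "openin (top_of_set U) N" "\<phi> P \<in> N" "form_fun d h" "form_fun d h'"
      "\<And>Q. Q \<in> N \<Longrightarrow> h' (coords Q) \<noteq> 0" "\<And>Q. Q \<in> N \<Longrightarrow> f Q = h (coords Q) / h' (coords Q)"
      by (rule regular_onE[OF f \<open>\<phi> P \<in> U\<close>]) (rule that)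
    obtain T where T: "open T" "N = U \<inter> T"
      using N(1) by (auto simp: openin_open)
    let ?N = "(X \<inter> \<phi> -` U) \<inter> {P \<in> X. \<phi> P \<in> T}"
    have "openin (top_of_set (X \<inter> \<phi> -` U)) ?N"
      using morphism_openin_preimage[OF \<phi> T(1)] by (auto simp: openin_open)
    moreover have "P \<in> ?N" using P N(2) T(2) by auto
    moreover have "regular_on ?N (f \<circ> \<phi>)"
    proof (rule regular_on_cong)
      show "regular_on ?N (\<lambda>P. h (coords (\<phi> P)) / h' (coords (\<phi> P)))"
        by (rule regular_on_subset[OF morphism_quotient[OF \<phi> N(3,4)]]) (use N(5) T(2) in auto)
      show "h (coords (\<phi> R)) / h' (coords (\<phi> R)) = (f \<circ> \<phi>) R" if "R \<in> ?N" for R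
        using that N(6)[of "\<phi> R"] T(2) by auto
    qed
    ultimately show "\<exists>N. openin (top_of_set (X \<inter> \<phi> -` U)) N \<and> P \<in> N \<and> regular_on N (f \<circ> \<phi>)"
      by blast
  qed
qed simp

lemma irreducible_image:
  assumes \<phi>: "morphism X UNIV \<phi>" and X: "zariski_irreducible X"
  shows "zariski_irreducible (\<phi> ` X)"
  unfolding zariski_irreducible_def
proof (intro conjI allI impI)
  show "\<phi> ` X \<noteq> {}" using X by (simp add: zariski_irreducible_def)
  fix A B assume AB: "closed A \<and> closed B \<and> \<phi> ` X \<subseteq> A \<union> B"
  show "\<phi> ` X \<subseteq> A \<or> \<phi> ` X \<subseteq> B"
  proof (rule ccontr)
    assume "\<not> ?thesis"
    then have "{P \<in> X. \<phi> P \<in> - A} \<noteq> {}" "{P \<in> X. \<phi> P \<in> - B} \<noteq> {}" by auto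
    moreover have "openin (top_of_set X) {P \<in> X. \<phi> P \<in> - A}" "openin (top_of_set X) {P \<in> X. \<phi> P \<in> - B}"
      using AB morphism_openin_preimage[OF \<phi>, of "- A"] morphism_openin_preimage[OF \<phi>, of "- B"]
      by (simp_all add: closed_def)
    ultimately have "{P \<in> X. \<phi> P \<in> - A} \<inter> {P \<in> X. \<phi> P \<in> - B} \<noteq> {}"
      using openin_inter_nonempty[OF X] by blast
    then show False using AB by auto
  qed
qed

lemma dom_pullback: "dom ((f \<circ> \<psi>) |` W) = {P \<in> W. \<psi> P \<in> dom f}"
  by (auto simp: restrict_map_def split: if_splits)

lemma pullback_rep:
  assumes "morphism W Y \<psi>" "openin (top_of_set V) W" "f \<in> rat_reps Y" "\<exists>P\<in>W. \<psi> P \<in> dom f"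
  shows "(f \<circ> \<psi>) |` W \<in> rat_reps V"
proof (rule rat_repsI)
  note f = rat_repsD[OF assms(3)]
  show "openin (top_of_set V) (dom ((f \<circ> \<psi>) |` W))"
    unfolding dom_pullback using morphism_openin_preimage'[OF assms(1) f(1)] assms(2) by (rule openin_trans)
  show "dom ((f \<circ> \<psi>) |` W) \<noteq> {}"
    unfolding dom_pullback using assms(4) by blast
  have "regular_on {P \<in> W. \<psi> P \<in> dom f} (\<lambda>P. the (f (\<psi> P)))"
    by (rule morphism_regular[OF assms(1) f(1,3)])
  then show "regular_on (dom ((f \<circ> \<psi>) |` W)) (the \<circ> (f \<circ> \<psi>) |` W)"
    unfolding dom_pullback by (rule regular_on_cong) simp
qed

lemma pullback_class:
  assumes V: "zariski_irreducible V" and Y: "zariski_irreducible Y" and "f \<in> rat_reps Y"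
    and reps: "\<And>g. g \<in> rat_reps Y \<Longrightarrow> (g \<circ> \<psi>) |` W \<in> rat_reps V"
  shows "pullback V W \<psi> (rat_rel Y `` {f}) = rat_rel V `` {(f \<circ> \<psi>) |` W}"
  unfolding pullback_def
proof (rule UN_equiv_class[OF equiv_rat_rel[OF Y] _ assms(3)], rule congruentI)
  fix g h assume gh: "(g, h) \<in> rat_rel Y"
  then have "((g \<circ> \<psi>) |` W, (h \<circ> \<psi>) |` W) \<in> rat_rel V"
    unfolding rat_rel_iff dom_pullback using reps by auto
  then show "rat_rel V `` {(g \<circ> \<psi>) |` W} = rat_rel V `` {(h \<circ> \<psi>) |` W}"
    by (rule equiv_class_eq[OF equiv_rat_rel[OF V]])
qed

lemma rat_class_in_carrier: "f \<in> rat_reps V \<Longrightarrow> rat_rel V `` {f} \<in> carrier (function_field V)"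
  by (simp add: function_field_def quotientI)

lemma pullback_class_onto:
  assumes "zariski_irreducible X" "zariski_irreducible Y" "morphism X Y \<psi>" "\<psi> ` X = Y" "f \<in> rat_reps Y"
  shows "pullback X X \<psi> (rat_rel Y `` {f}) = rat_rel X `` {(f \<circ> \<psi>) |` X}" "(f \<circ> \<psi>) |` X \<in> rat_reps X"
proof -
  have reps: "(g \<circ> \<psi>) |` X \<in> rat_reps X" if g: "g \<in> rat_reps Y" for g
  proof (rule pullback_rep[OF assms(3) openin_subtopology_self g])
    obtain Q where "Q \<in> dom g" "Q \<in> Y"
      using rat_repsD(1,2)[OF g] openin_imp_subset by blast
    then show "\<exists>P\<in>X. \<psi> P \<in> dom g" using assms(4) by blast
  qed
  then show "(f \<circ> \<psi>) |` X \<in> rat_reps X" using assms(5) by blast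
  show "pullback X X \<psi> (rat_rel Y `` {f}) = rat_rel X `` {(f \<circ> \<psi>) |` X}"
    by (rule pullback_class[OF assms(1,2,5) reps])
qed

text \<open>Equality of classes becomes equality of values, because two representatives of a class
  agree wherever both are defined. The last conclusion covers every representative g' of the image
  class, so that for a class fixed by \<tau> the function f itself can be taken.\<close>

lemma point_group_action:
  assumes X: "zariski_irreducible X" and \<phi>: "morphism X UNIV \<phi>"
    and \<sigma>: "morphism X X \<sigma>" "\<sigma> ` X = X"
    and \<tau>: "\<tau> \<in> galois_group (function_field (\<phi> ` X)) K"
    and comm: "\<forall>a\<in>carrier (function_field (\<phi> ` X)). pullback X X \<sigma> (pullback X X \<phi> a) = pullback X X \<phi> (\<tau> a)"
    and f: "f \<in> rat_reps (\<phi> ` X)"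
  obtains g where "g \<in> rat_reps (\<phi> ` X)" "\<tau> (rat_rel (\<phi> ` X) `` {f}) = rat_rel (\<phi> ` X) `` {g}"
    "\<And>g' P. g' \<in> \<tau> (rat_rel (\<phi> ` X) `` {f}) \<Longrightarrow> P \<in> X \<Longrightarrow> \<phi> (\<sigma> P) \<in> dom f \<Longrightarrow> \<phi> P \<in> dom g' \<Longrightarrow>
      f (\<phi> (\<sigma> P)) = g' (\<phi> P)"
proof -
  let ?C = "\<phi> ` X"
  note C = irreducible_image[OF \<phi> X] and \<phi>C = morphism_image[OF \<phi>]
  let ?a = "rat_rel ?C `` {f}"
  have a: "?a \<in> carrier (function_field ?C)"
    by (rule rat_class_in_carrier[OF f])
  have "\<tau> ?a \<in> carrier (function_field ?C)"
    using \<tau> a unfolding galois_group_def ring_iso_def ring_hom_def by auto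
  then obtain g where g: "g \<in> rat_reps ?C" "\<tau> ?a = rat_rel ?C `` {g}"
    unfolding function_field_def by (auto elim!: quotientE)
  have agree: "f (\<phi> (\<sigma> P)) = g' (\<phi> P)"
    if g': "g' \<in> \<tau> ?a" and P: "P \<in> X" "\<phi> (\<sigma> P) \<in> dom f" "\<phi> P \<in> dom g'" for g' P
  proof -
    have rel: "(g, g') \<in> rat_rel ?C" using g' g(2) by simp
    then have g'_rep: "g' \<in> rat_reps ?C" by (simp add: rat_rel_iff)
    have \<tau>a: "\<tau> ?a = rat_rel ?C `` {g'}"
      unfolding g(2) using rel by (rule equiv_class_eq[OF equiv_rat_rel[OF C]])
    note pf = pullback_class_onto[OF X C \<phi>C refl f] and pg = pullback_class_onto[OF X C \<phi>C refl g'_rep]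
    note ps = pullback_class_onto[OF X X \<sigma> pf(2)]
    have "rat_rel X `` {((f \<circ> \<phi>) |` X \<circ> \<sigma>) |` X} = rat_rel X `` {(g' \<circ> \<phi>) |` X}"
      using bspec[OF comm a] unfolding pf(1) ps(1) \<tau>a pg(1) .
    then have "(((f \<circ> \<phi>) |` X \<circ> \<sigma>) |` X, (g' \<circ> \<phi>) |` X) \<in> rat_rel X"
      using eq_equiv_class[OF _ equiv_rat_rel[OF X] pg(2)] by blast
    moreover have "\<sigma> P \<in> X" using \<sigma>(2) P(1) by blast
    then have "P \<in> dom (((f \<circ> \<phi>) |` X \<circ> \<sigma>) |` X)" "P \<in> dom ((g' \<circ> \<phi>) |` X)"
      unfolding dom_pullback using P by auto
    ultimately have "(((f \<circ> \<phi>) |` X \<circ> \<sigma>) |` X) P = ((g' \<circ> \<phi>) |` X) P"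
      unfolding rat_rel_iff by blast
    then show ?thesis using P \<open>\<sigma> P \<in> X\<close> by simp
  qed
  show ?thesis by (rule that[of g]) (rule g(1), rule g(2), rule agree)
qed

text \<open>Coordinates on the projective line in which the projection from v1 reads (x : z). As the
  kernel of A is spanned by v1, the images p0 and p2 of v0 and v2 form a basis, and g0, g2 are dual
  to it.\<close>

lemma (in frame) projection_coordinates:
  assumes "projection_from (point v1) A"
  obtains g0 g2 :: "'k ^ 2 \<Rightarrow> 'k" and p0 p2 :: "'k ^ 2" where "form_fun 1 g0" "form_fun 1 g2"
    "\<And>v. g0 (A *v v) = cx v" "\<And>v. g2 (A *v v) = cz v" "\<And>v. A *v v = cx v *s p0 + cz v *s p2"
    "\<And>u. u = g0 u *s p0 + g2 u *s p2"
proof -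
  define p0 p2 where "p0 = A *v v0" and "p2 = A *v v2"
  have v1: "v1 \<noteq> 0"
    using independent[of 0 1 0] by auto
  have ker: "A *v v = 0 \<longleftrightarrow> v \<in> vec.span {v1}" for v
    using assms unfolding projection_from_def Rep_point[OF v1] by blast
  have Av: "A *v comb x y z = x *s p0 + z *s p2" for x y z
  proof -
    have "A *v v1 = 0" using ker vec.span_base by blast
    then show ?thesis
      by (simp add: comb_def p0_def p2_def matrix_vector_right_distrib vec.scale)
  qed
  have indep: "x = 0 \<and> z = 0" if "x *s p0 + z *s p2 = 0" for x z
  proof -
    have "comb x 0 z \<in> vec.span {v1}"
      using ker[of "comb x 0 z"] Av that by simp
    then obtain c where "comb x 0 z = c *s v1"
      by (auto simp: vec.span_singleton)
    then have "comb x (- c) z = 0"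
      by (simp add: comb_def algebra_simps)
    then show ?thesis using independent[of x "- c" z] unfolding comb_def by blast
  qed
  define \<delta> where "\<delta> = p0 $ 1 * p2 $ 2 - p0 $ 2 * p2 $ 1"
  have "\<delta> \<noteq> 0"
  proof
    assume "\<delta> = 0"
    have "p2 $ 1 *s p0 + (- p0 $ 1) *s p2 = 0" "p2 $ 2 *s p0 + (- p0 $ 2) *s p2 = 0"
      using \<open>\<delta> = 0\<close> by (simp_all add: \<delta>_def vec_eq_iff forall_2 algebra_simps)
    then have "p2 $ 1 = 0" "p0 $ 1 = 0" "p2 $ 2 = 0" "p0 $ 2 = 0"
      using indep[of "p2 $ 1" "- p0 $ 1"] indep[of "p2 $ 2" "- p0 $ 2"] by simp_all
    then have "1 *s p0 + 1 *s p2 = 0" by (simp add: vec_eq_iff forall_2)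
    then show False using indep[of 1 1] by simp
  qed
  \<comment> \<open>Cramer's rule for expressing u by p0 and p2, with determinant \<delta>.\<close>
  define g0 g2 where "g0 u = (p2 $ 2 / \<delta>) * u $ 1 + (- p2 $ 1 / \<delta>) * u $ 2"
    and "g2 u = (- p0 $ 2 / \<delta>) * u $ 1 + (p0 $ 1 / \<delta>) * u $ 2" for u :: "'k ^ 2"
  show ?thesis
  proof (rule that)
    show "form_fun 1 g0" "form_fun 1 g2"
      unfolding g0_def[abs_def] g2_def[abs_def] by (intro form_fun_add form_fun_cmult form_fun_coord)+
    show Av': "A *v v = cx v *s p0 + cz v *s p2" for v
      using Av[of "cx v" "cy v" "cz v"] by (simp add: comb_coords)
    show "g0 (A *v v) = cx v" "g2 (A *v v) = cz v" for v
      unfolding Av' using \<open>\<delta> \<noteq> 0\<close>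
      by (simp_all add: g0_def g2_def field_simps) (simp_all add: \<delta>_def algebra_simps)
    show "u = g0 u *s p0 + g2 u *s p2" for u
      using \<open>\<delta> \<noteq> 0\<close>
      by (simp add: g0_def g2_def vec_eq_iff forall_2 field_simps) (simp add: \<delta>_def algebra_simps)
  qed
qed

lemma frame_extension:
  fixes v :: "'k::alg_closed_field ^ 3"
  assumes "v \<noteq> 0"
  obtains v0 v2 where "frame v0 v v2"
proof -
  have "\<exists>v0 v2. \<forall>x y z. x *s v0 + y *s v + z *s v2 = 0 \<longrightarrow> x = 0 \<and> y = 0 \<and> z = 0"
  proof (cases "v $ 1 = 0")
    case False
    then show ?thesis
      by (intro exI[of _ "vector [0, 1, 0]"] exI[of _ "vector [0, 0, 1]"]) (auto simp: vec_eq_iff forall_3)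
  next
    case v1: True
    show ?thesis
    proof (cases "v $ 2 = 0")
      case False
      then show ?thesis
        using v1 by (intro exI[of _ "vector [1, 0, 0]"] exI[of _ "vector [0, 0, 1]"]) (auto simp: vec_eq_iff forall_3)
    next
      case True
      then have "v $ 3 \<noteq> 0" using v1 assms by (auto simp: vec_eq_iff forall_3)
      then show ?thesis
        using v1 True by (intro exI[of _ "vector [1, 0, 0]"] exI[of _ "vector [0, 1, 0]"]) (auto simp: vec_eq_iff forall_3)
    qed
  qed
  then obtain v0 v2 where "\<forall>x y z. x *s v0 + y *s v + z *s v2 = 0 \<longrightarrow> x = 0 \<and> y = 0 \<and> z = 0" by blast
  then have "frame v0 v v2" by (intro frame.intro) blast
  then show ?thesis by (rule that)
qed

text \<open>Projected from one of its points, a line is a single point.\<close>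

lemma projection_kernel:
  fixes P Q :: "('k::alg_closed_field, 3) proj"
  assumes "projection_from Q A" "A *v coords P = 0"
  shows "P = Q"
proof -
  have "coords P \<in> Rep_proj Q"
    using assms by (auto simp: projection_from_def)
  then have "vec.span {coords P} = Rep_proj Q"
    unfolding Rep_coords[of Q] by (intro span_singleton_eq) simp_all
  then have "Rep_proj P = Rep_proj Q" by (simp add: Rep_coords)
  then show ?thesis by (simp add: Rep_proj_inject)
qed

text \<open>A linear form h vanishing on \<open>C\<close> vanishes at the centre Q, so it factors
  through the projection as a linear form k on the projective line. The image would lie in the
  closed set k = 0, against dominance.\<close>

lemma dominant_projection_not_line:
  fixes C :: "('k::alg_closed_field, 3) proj set"
  assumes "Q \<in> C" "projection_from Q A" "closure (proj_map A ` (C - {Q})) = UNIV"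
    and h: "form_fun 1 h" "\<exists>v. h v \<noteq> 0"
  shows "\<exists>P\<in>C. h (coords P) \<noteq> 0"
proof (rule ccontr)
  assume "\<not> ?thesis"
  then have van: "h (coords P) = 0" if "P \<in> C" for P using that by blast
  obtain v0 v2 where "frame v0 (coords Q) v2"
    by (rule frame_extension[OF coords_nonzero])
  then interpret frame v0 "coords Q" v2 .
  obtain g0 g2 :: "'k ^ 2 \<Rightarrow> 'k" and p0 p2 where g: "form_fun 1 g0" "form_fun 1 g2"
    "\<And>v. g0 (A *v v) = cx v" "\<And>v. g2 (A *v v) = cz v" "\<And>v. A *v v = cx v *s p0 + cz v *s p2"
    by (rule projection_coordinates[of A]) (use assms(2) in simp, rule that)
  obtain F where F: "homogeneous 1 F" "\<And>v. h v = mp_eval F v"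
    by (rule form_funE[OF h(1)]) (rule that)
  obtain a where a: "\<And>v. mp_eval F v = (\<Sum>i\<in>UNIV. a i * v $ i)"
    by (rule homogeneous_1_linear[OF F(1)]) (rule that)
  have lin: "h (comb x y z) = x * h v0 + y * h (coords Q) + z * h v2" for x y z
    unfolding F(2) a comb_def by (simp add: sum.distrib sum_distrib_left algebra_simps)
  have hv: "h v = cx v * h v0 + cz v * h v2" for v
    using lin[of "cx v" "cy v" "cz v"] van[OF assms(1)] by (simp add: comb_coords)
  define k where "k u = h v0 * g0 u + h v2 * g2 u" for u
  have k_form: "form_fun 1 k"
    unfolding k_def[abs_def] by (intro form_fun_add form_fun_cmult g(1,2))
  have kA: "k (A *v v) = h v" for v
    using hv[of v] by (simp add: k_def g(3,4) mult.commute)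
  have "proj_map A ` (C - {Q}) \<subseteq> - {R. k (coords R) \<noteq> 0}"
  proof (clarify)
    fix P assume P: "P \<in> C" "P \<noteq> Q" "k (coords (proj_map A P)) \<noteq> 0"
    have "A *v coords P \<noteq> 0"
      using projection_kernel[OF assms(2)] P(2) by blast
    then have "k (coords (proj_map A P)) = 0"
      using form_zero_point[OF k_form] kA van[OF P(1)] by (simp add: proj_map_coords)
    then show False using P(3) by simp
  qed
  moreover have "closed (- {R. k (coords R) \<noteq> 0})"
    using open_form_nonzero[OF k_form] by (simp add: closed_def)
  ultimately have "closure (proj_map A ` (C - {Q})) \<subseteq> - {R. k (coords R) \<noteq> 0}"
    by (rule closure_minimal)
  then have k0: "k (coords R) = 0" for R
    using assms(3) by auto
  have "k u = 0" for u
  proof (cases "u = 0")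
    case True
    then show ?thesis using form_fun_scale[OF k_form, of 0 0] by simp
  next
    case False
    then show ?thesis using k0[of "point u"] form_zero_point[OF k_form False] by simp
  qed
  then have "h v = 0" for v using kA[of v] by simp
  then show False using h(2) by blast
qed

section \<open>Total inflection points\<close>

lemma linear_form_combination:
  assumes "homogeneous 1 L"
  shows "mp_eval L (x *s u + y *s v) = x * mp_eval L u + y * mp_eval L v"
proof -
  obtain a where a: "\<And>v. mp_eval L v = (\<Sum>i\<in>UNIV. a i * v $ i)"
    by (rule homogeneous_1_linear[OF assms]) (rule that)
  show ?thesis
    unfolding a by (simp add: sum.distrib sum_distrib_left algebra_simps)
qed

lemma distinct_points_independent:
  assumes "P \<noteq> R" "x *s coords P + z *s coords R = 0"
  shows "x = 0 \<and> z = 0"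
proof -
  have "x = 0"
  proof (rule ccontr)
    assume x: "x \<noteq> 0"
    have "x *s coords P = (- z) *s coords R"
      using assms(2) by (simp add: eq_neg_iff_add_eq_0)
    then have "(1 / x) *s (x *s coords P) = (1 / x) *s ((- z) *s coords R)"
      by (rule arg_cong)
    then have "coords P = (- z / x) *s coords R"
      using x by (simp add: vector_smult_assoc)
    then have P: "coords P = (- z / x) *s coords R" .
    have "- z / x \<noteq> 0"
    proof
      assume "- z / x = 0"
      with P have "coords P = 0 *s coords R" by simp
      then show False by simp
    qed
    then have "point (coords P) = point (coords R)"
      using point_scale[OF _ coords_nonzero, of "- z / x" R] P by simp
    then show False using assms(1) by simp
  qed
  moreover from this have "z *s coords R = 0" using assms(2) by simp
  then have "z = 0" by simp
  ultimately show ?thesis by simp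
qed

text \<open>\<open>tangent_line\<close> is a set of points; the vectors of the tangent space,
  including 0, are recovered because it is closed under scaling.\<close>

lemma tangent_space_kernel:
  fixes C :: "('k::field, 3) proj set"
  assumes "homogeneous 1 L" "tangent_line C Q = zeros {L}"
  shows "w \<in> tangent_space C Q \<longleftrightarrow> mp_eval L w = 0"
proof (cases "w = 0")
  case True
  have "mp_eval L (0 *s w) = 0 ^ 1 * mp_eval L w"
    by (rule homogeneous_scale[OF assms(1)])
  then show ?thesis using True by (simp add: tangent_space_def)
next
  case False
  have scale: "c *s w \<in> tangent_space C Q" if "w \<in> tangent_space C Q" for c
    unfolding tangent_space_def mem_Collect_eq
  proof (intro ballI impI)
    fix F assume "F \<in> forms" "C \<subseteq> zeros {F}"
    then have "(\<Sum>i\<in>UNIV. mp_eval (mp_deriv i F) (coords Q) * w $ i) = 0"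
      using that unfolding tangent_space_def by blast
    then have "c * (\<Sum>i\<in>UNIV. mp_eval (mp_deriv i F) (coords Q) * w $ i) = 0" by simp
    then show "(\<Sum>i\<in>UNIV. mp_eval (mp_deriv i F) (coords Q) * (c *s w) $ i) = 0"
      by (simp add: sum_distrib_left mult.left_commute)
  qed
  have "w \<in> tangent_space C Q \<longleftrightarrow> point w \<in> tangent_line C Q"
    unfolding tangent_line_def mem_Collect_eq Rep_point[OF False]
    using scale vec.span_base[of w "{w}"] by (auto simp: vec.span_singleton)
  also have "\<dots> \<longleftrightarrow> mp_eval L w = 0"
    unfolding assms(2) zeros_def using form_zero_point[OF form_funI[OF assms(1)] False] by simp
  finally show ?thesis .
qed

lemma line_poly_mult: "line_poly (K * F) v w = line_poly K v w * line_poly F v w"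
  for v :: "'k::alg_closed_field ^ 'n::finite"
  by (rule poly_eqI_alg_closed) (simp add: poly_line_poly mp_eval_mult)

lemma homogeneous_vanish:
  assumes "homogeneous d F" "Factorial_Ring.irreducible F" "C = zeros {F}" "Q \<in> C"
  shows "d > 0"
proof -
  show ?thesis
  proof (rule ccontr)
    assume "\<not> d > 0"
    then have d: "d = 0" by simp
    have "Poly_Mapping.keys F \<subseteq> {0}"
    proof
      fix m assume "m \<in> Poly_Mapping.keys F"
      then have "(\<Sum>i\<in>UNIV. Poly_Mapping.lookup m i) = 0"
        using assms(1) d by (simp add: homogeneous_def)
      then have "m = 0" by (intro poly_mapping_eqI) simp
      then show "m \<in> {0}" by simp
    qed
    then have "mp_eval F (coords Q) = Poly_Mapping.lookup F 0 * mono_eval 0 (coords Q)"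
      using mp_eval_superset[of "{0}" F] by simp
    moreover have "mp_eval F (coords Q) = 0"
      using assms(3,4) by (simp add: zeros_def)
    ultimately have "Poly_Mapping.lookup F 0 = 0"
      by (simp add: mono_eval_def)
    then have "Poly_Mapping.lookup F m = 0" for m
      using \<open>Poly_Mapping.keys F \<subseteq> {0}\<close> in_keys_iff[of m F] by (cases "m = 0") auto
    then have "F = 0" by (intro poly_mapping_eqI) simp
    then show False using assms(2) by simp
  qed
qed

text \<open>\<open>not_line\<close> will come from the dominance of the projection from a Galois
  point. It excludes that \<open>C\<close> coincides with its tangent line.\<close>

locale inflection_point =
  fixes C :: "('k::alg_closed_field, 3) proj set" and Q :: "('k, 3) proj" and d :: nat and F L :: "('k, 3) mpol"
  assumes F: "homogeneous d F" "Factorial_Ring.irreducible F" "C = zeros {F}"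
    and L: "homogeneous 1 L" "Factorial_Ring.irreducible L" "tangent_line C Q = zeros {L}"
    and mult: "intersection_mult F L Q d" and Q_in_C: "Q \<in> C"
    and not_line: "\<And>h. form_fun 1 h \<Longrightarrow> \<exists>v. h v \<noteq> 0 \<Longrightarrow> \<exists>P\<in>C. h (coords P) \<noteq> 0"
begin

abbreviation q where "q \<equiv> coords Q"

lemma L_nonzero: "\<exists>v. mp_eval L v \<noteq> 0"
  using mp_eval_eq_0_imp[of L] L(2) by (metis Factorial_Ring.not_irreducible_zero)

lemma F_q: "mp_eval F q = 0"
  using Q_in_C F(3) by (simp add: zeros_def)

text \<open>Euler's relation without division by the degree, hence in every characteristic: a form
  vanishing at q vanishes at all multiples (1 + t) q.\<close>

lemma L_q: "mp_eval L q = 0"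
proof -
  have "q \<in> tangent_space C Q"
    unfolding tangent_space_def mem_Collect_eq directional_derivative
  proof (intro ballI impI)
    fix G :: "('k, 3) mpol" assume G: "G \<in> forms" "C \<subseteq> zeros {G}"
    then obtain e where e: "homogeneous e G" by (auto simp: forms_def)
    have "mp_eval G q = 0" using G(2) Q_in_C by (auto simp: zeros_def)
    have "line_poly G q q = 0"
    proof (rule poly_eqI_alg_closed)
      fix t
      have "q + t *s q = (1 + t) *s q" by (simp add: vec.scale_left_distrib)
      then show "poly (line_poly G q q) t = poly 0 t"
        using homogeneous_scale[OF e, of "1 + t" q] \<open>mp_eval G q = 0\<close> by (simp add: poly_line_poly)
    qed
    then show "poly (pderiv (line_poly G q q)) 0 = 0" by simp
  qed
  then show ?thesis using tangent_space_kernel[OF L(1,3)] by simp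
qed

lemma derivative_zero:
  assumes "mp_eval L w = 0"
  shows "poly (pderiv (line_poly F q w)) 0 = 0"
proof -
  have "w \<in> tangent_space C Q"
    using assms tangent_space_kernel[OF L(1,3)] by simp
  moreover have "F \<in> forms" "C \<subseteq> zeros {F}"
    using F homogeneous_forms by auto
  ultimately show ?thesis
    unfolding tangent_space_def directional_derivative mem_Collect_eq by blast
qed

text \<open>If the differential of F vanished in a direction off the tangent line, it would vanish
  in all directions. By \<open>multiple\<close> every form vanishing on \<open>C\<close> is a
  multiple of F, so the tangent space would be everything, whereas it is the kernel of a nonzero
  linear form.\<close>

lemma derivative_nonzero:
  assumes multiple: "\<And>D h. form_fun D h \<Longrightarrow> \<forall>P\<in>C. h (coords P) = 0 \<Longrightarrow>
      \<exists>e k. form_fun e k \<and> (\<forall>v. h v = k v * mp_eval F v)"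
    and w: "mp_eval L w \<noteq> 0"
  shows "poly (pderiv (line_poly F q w)) 0 \<noteq> 0"
proof
  assume zero: "poly (pderiv (line_poly F q w)) 0 = 0"
  have all_zero: "poly (pderiv (line_poly F q u)) 0 = 0" for u
  proof -
    define s where "s = mp_eval L u / mp_eval L w"
    have "mp_eval L (1 *s u + (- s) *s w) = 0"
      unfolding linear_form_combination[OF L(1)] using w by (simp add: s_def)
    then have "poly (pderiv (line_poly F q (1 *s u + (- s) *s w))) 0 = 0"
      by (rule derivative_zero)
    then have "(\<Sum>i\<in>UNIV. mp_eval (mp_deriv i F) q * u $ i) - s * (\<Sum>i\<in>UNIV. mp_eval (mp_deriv i F) q * w $ i) = 0"
      unfolding directional_derivative[symmetric]
      by (simp add: sum_distrib_left sum_subtractf[symmetric] algebra_simps)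
    then show ?thesis
      unfolding directional_derivative zero by simp
  qed
  have "u \<in> tangent_space C Q" for u
    unfolding tangent_space_def mem_Collect_eq directional_derivative
  proof (intro ballI impI)
    fix G :: "('k, 3) mpol" assume G: "G \<in> forms" "C \<subseteq> zeros {G}"
    then obtain D where D: "homogeneous D G" by (auto simp: forms_def)
    have "\<forall>P\<in>C. mp_eval G (coords P) = 0" using G(2) by (auto simp: zeros_def)
    then obtain e k where k: "form_fun e k" "\<forall>v. mp_eval G v = k v * mp_eval F v"
      using multiple[OF form_funI[OF D]] by blast
    obtain K where K: "\<And>v. k v = mp_eval K v"
      by (rule form_funE[OF k(1)]) (rule that)
    have "G = K * F"
      by (rule mp_eval_inject) (simp add: k(2) K mp_eval_mult)
    moreover have "poly (line_poly F q u) 0 = 0"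
      using F_q by (simp add: poly_line_poly)
    ultimately show "poly (pderiv (line_poly G q u)) 0 = 0"
      using all_zero[of u] by (simp add: line_poly_mult pderiv_mult)
  qed
  then have "mp_eval L u = 0" for u
    using tangent_space_kernel[OF L(1,3)] by simp
  then show False using w by simp
qed

text \<open>On the tangent line F is a polynomial u0 of degree at most d, and by
  \<open>intersection_mult_le\<close> its order at Q is at least the intersection multiplicity d; so
  it is c t^d.\<close>

lemma contact:
  assumes Lw: "mp_eval L w = 0" and ind: "\<And>x z. x *s w + z *s q = 0 \<Longrightarrow> x = 0 \<and> z = 0"
  shows "\<exists>c. c \<noteq> 0 \<and> (\<forall>t. mp_eval F (q + t *s w) = c * t ^ d)"
proof -
  obtain u where u: "mp_eval L u \<noteq> 0" using L_nonzero by blast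
  interpret frame w u q
  proof
    fix x y z assume xyz: "x *s w + y *s u + z *s q = 0"
    have "mp_eval L (1 *s (x *s w + y *s u) + z *s q) = 0"
      using xyz homogeneous_scale[OF L(1), of 0 q] by simp
    then have "y * mp_eval L u = 0"
      unfolding linear_form_combination[OF L(1)] using Lw L_q by simp
    then have "y = 0" using u by simp
    then show "x = 0 \<and> y = 0 \<and> z = 0" using xyz ind[of x z] by simp
  qed
  have L_comb: "mp_eval L (comb x y z) = mp_eval L u * y" for x y z
  proof -
    have "comb x y z = 1 *s (x *s w + y *s u) + z *s q" by (simp add: comb_def)
    then show ?thesis
      using Lw L_q by (simp only: linear_form_combination[OF L(1)]) simp
  qed
  obtain f where f: "wle 1 1 d f" "\<And>x y z. mp_eval F (comb x y z) = hv d f x y z"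
    by (rule dehomogenize[OF form_funI[OF F(1)]]) (rule that)
  have F_eq: "mp_eval F v = hv d f (cx v) (cy v) (cz v)" for v
    using f(2)[of "cx v" "cy v" "cz v"] by (simp add: comb_coords)
  have L_eq: "mp_eval L v = mp_eval L u * cy v" for v
    using L_comb[of "cx v" "cy v" "cz v"] by (simp add: comb_coords)
  obtain u0 f1 where f1: "f = pCons u0 f1" by (cases f)
  \<comment> \<open>Otherwise L divides F, so by irreducibility F has degree 1 and \<open>C\<close>
    is a line, against \<open>not_line\<close>.\<close>
  have "u0 \<noteq> 0"
  proof
    assume "u0 = 0"
    then have fY: "f = f1 * [:0, 1:]" by (simp add: f1)
    have "f1 \<noteq> 0"
    proof
      assume "f1 = 0"
      then have "mp_eval F v = 0" for v unfolding F_eq fY by (simp add: hv_def)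
      then have "F = 0" by (rule mp_eval_eq_0_imp)
      then show False using F(2) by simp
    qed
    have Y: "cf ([:0, 1:] :: 'k poly poly) 0 1 \<noteq> 0" "1 * 0 + 1 * 1 = (1::nat)" by simp_all
    have wY: "wle 1 1 1 ([:0, 1:] :: 'k poly poly)"
      by (rule wle_pCons) (auto simp: wle_one simp flip: one_pCons)
    have d1: "1 \<le> d" "wle 1 1 (d - 1) f1"
    proof -
      have wf: "wle 1 1 d (f1 * [:0, 1:])" using f(1) unfolding fY .
      show "1 \<le> d" "wle 1 1 (d - 1) f1"
        by (rule wle_factor[OF zero_less_one \<open>f1 \<noteq> 0\<close> Y wY wf])+
    qed
    obtain K where K: "homogeneous (d - 1) K" "\<And>v. (1 / mp_eval L u) * hv (d - 1) f1 (cx v) (cy v) (cz v) = mp_eval K v"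
      by (rule form_funE[OF form_fun_cmult[OF form_fun_hv[OF d1(2)], of "1 / mp_eval L u"]]) (rule that)
    have "F = K * L"
    proof (rule mp_eval_inject)
      fix v
      have "mp_eval F v = hv (d - 1) f1 (cx v) (cy v) (cz v) * hv 1 [:0, 1:] (cx v) (cy v) (cz v)"
        unfolding F_eq fY using hv_mult[OF d1(2) wY] d1(1) by (simp only: le_add_diff_inverse2)
      also have "hv 1 [:0, 1:] (cx v) (cy v) (cz v) = cy v"
        by (simp add: hv_def)
      finally show "mp_eval F v = mp_eval (K * L) v"
        unfolding mp_eval_mult K(2)[symmetric] L_eq[of v] using u by simp
    qed
    then have "K dvd 1 \<or> L dvd 1"
      using F(2) by (rule irreducibleD[rotated])
    then have "K dvd 1" using L(2) irreducible_not_unit by blast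
    then have "d - 1 = 0" by (rule unit_form_degree[OF K(1)])
    then have "d = 1" using d1(1) by simp
    have "F \<noteq> 0"
      using F(2) by (metis Factorial_Ring.not_irreducible_zero)
    then have "\<exists>v. mp_eval F v \<noteq> 0"
      by (metis mp_eval_eq_0_imp)
    then have "\<exists>P\<in>C. mp_eval F (coords P) \<noteq> 0"
      by (rule not_line[OF form_funI[OF F(1)[unfolded \<open>d = 1\<close>]]])
    then show False using F(3) by (auto simp: zeros_def)
  qed
  define n where "n = Polynomial.order 0 u0"
  obtain e0 where e0: "u0 = [:0, 1:] ^ n * e0" "\<not> [:0, 1:] dvd e0"
    using order_decomp[OF \<open>u0 \<noteq> 0\<close>, of 0] by (auto simp: n_def)
  have e00: "poly e0 0 \<noteq> 0"
    using e0(2) poly_eq_0_iff_dvd[of e0 0] by simp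
  have "d \<le> n"
  proof (rule intersection_mult_le[OF F(1) f L(1) L_comb u])
    show "f = pCons ([:0, 1:] ^ n * e0) f1" using f1 e0(1) by simp
    show "intersection_mult F L (point q) d" using mult by simp
  qed (rule e00)
  have "degree u0 \<le> d"
  proof (rule degree_le, intro allI impI)
    fix i assume "d < i"
    show "coeff u0 i = 0"
    proof (rule ccontr)
      assume "coeff u0 i \<noteq> 0"
      then have "cf f i 0 \<noteq> 0" by (simp add: f1)
      then have "1 * i + 1 * 0 \<le> d" using f(1) unfolding wle_def by blast
      then show False using \<open>d < i\<close> by simp
    qed
  qed
  moreover have "degree u0 = n + degree e0"
    using e00 unfolding e0(1) by (subst degree_mult_eq) (auto simp: degree_power_eq)
  ultimately have "degree e0 = 0" "n = d" using \<open>d \<le> n\<close> by simp_all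
  then obtain c where c: "e0 = [:c:]" by (metis degree_eq_zeroE)
  have "mp_eval F (q + t *s w) = c * t ^ d" for t
  proof -
    have "q + t *s w = comb t 0 1" by (simp add: comb_def)
    then have "mp_eval F (q + t *s w) = ev2 f t 0"
      by (simp add: f(2) hv_1[OF f(1)])
    then show ?thesis by (simp add: f1 e0(1) c \<open>n = d\<close>)
  qed
  moreover have "c \<noteq> 0" using e00 c by simp
  ultimately show ?thesis by blast
qed

text \<open>A second point R would be the point t = \<infinity> of the line q + t R, on which F is c
  t^d. In the coordinate s = 1 / t this is the constant c, also at s = 0, so F does not vanish at
  R.\<close>

lemma tangent_line_meets_once:
  assumes "R \<in> C" "mp_eval L (coords R) = 0"
  shows "R = Q"
proof (rule ccontr)
  assume "R \<noteq> Q"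
  then obtain c where c: "c \<noteq> 0" "\<forall>t. mp_eval F (q + t *s coords R) = c * t ^ d"
    using contact[OF assms(2) distinct_points_independent[of R Q]] by blast
  have "poly (line_poly F (coords R) q - [:c:]) s = 0" if "s \<in> {s. s \<noteq> 0}" for s
  proof -
    have s: "s \<noteq> 0" using that by simp
    then have "coords R + s *s q = s *s (q + (1 / s) *s coords R)"
      by (simp add: vector_add_ldistrib vector_smult_assoc add.commute)
    then have "mp_eval F (coords R + s *s q) = s ^ d * (c * (1 / s) ^ d)"
      using c(2) by (simp only: homogeneous_scale[OF F(1)])
    then show ?thesis using s by (simp add: poly_line_poly power_divide)
  qed
  then have "line_poly F (coords R) q - [:c:] = 0"
    by (rule poly_eq_0I_infinite[OF infinite_nonzero])
  then have "poly (line_poly F (coords R) q) 0 = c" by simp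
  then have "mp_eval F (coords R) = c" by (simp add: poly_line_poly)
  then show False using assms(1) F(3) c(1) by (simp add: zeros_def)
qed

end

lemma irreducible_avoid_lines:
  assumes "zariski_irreducible C" "finite H" "\<And>h. h \<in> H \<Longrightarrow> form_fun 1 h \<and> (\<exists>P\<in>C. h (coords P) \<noteq> 0)"
  shows "\<exists>P\<in>C. \<forall>h\<in>H. h (coords P) \<noteq> 0"
proof -
  have "\<exists>W. openin (top_of_set C) W \<and> W \<noteq> {} \<and> (\<forall>P\<in>W. \<forall>h\<in>H. h (coords P) \<noteq> 0)"
    using assms(2,3)
  proof (induction H rule: finite_induct)
    case empty
    then show ?case
      using assms(1) by (intro exI[of _ C]) (auto simp: zariski_irreducible_def)
  next
    case (insert h H)
    then obtain W where W: "openin (top_of_set C) W" "W \<noteq> {}" "\<forall>P\<in>W. \<forall>h\<in>H. h (coords P) \<noteq> 0"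
      by blast
    have h: "form_fun 1 h" "\<exists>P\<in>C. h (coords P) \<noteq> 0" using insert.prems by auto
    let ?V = "C \<inter> {P. h (coords P) \<noteq> 0}"
    have V: "openin (top_of_set C) ?V" "?V \<noteq> {}"
      using openin_open_Int[OF open_form_nonzero[OF h(1)]] h(2) by auto
    have "W \<inter> ?V \<noteq> {}" by (rule openin_inter_nonempty[OF assms(1) W(1) V(1) W(2) V(2)])
    moreover have "openin (top_of_set C) (W \<inter> ?V)" using W(1) V(1) by (rule openin_Int)
    ultimately show ?case
      using W(3) by (intro exI[of _ "W \<inter> ?V"]) auto
  qed
  then obtain W where W: "openin (top_of_set C) W" "W \<noteq> {}" "\<forall>P\<in>W. \<forall>h\<in>H. h (coords P) \<noteq> 0" by blast
  then show ?thesis using openin_imp_subset[OF W(1)] by blast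
qed

text \<open>\<open>w\<close> is the cross product of the coefficient vectors. If it vanished, L and
  L' would be proportional, and the values at u would force L = 0.\<close>

lemma linear_kernel_intersection:
  fixes L L' :: "('k::field, 3) mpol"
  assumes "homogeneous 1 L" "homogeneous 1 L'" "mp_eval L u = 0" "mp_eval L' u \<noteq> 0" "\<exists>v. mp_eval L v \<noteq> 0"
  obtains w where "w \<noteq> 0" "mp_eval L w = 0" "mp_eval L' w = 0"
proof -
  obtain a where a: "\<And>v. mp_eval L v = (\<Sum>i\<in>UNIV. a i * v $ i)"
    by (rule homogeneous_1_linear[OF assms(1)]) (rule that)
  obtain b where b: "\<And>v. mp_eval L' v = (\<Sum>i\<in>UNIV. b i * v $ i)"
    by (rule homogeneous_1_linear[OF assms(2)]) (rule that)
  define w :: "'k ^ 3" where "w = vector [a 2 * b 3 - a 3 * b 2, a 3 * b 1 - a 1 * b 3, a 1 * b 2 - a 2 * b 1]"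
  show ?thesis
  proof (rule that)
    show "mp_eval L w = 0" "mp_eval L' w = 0"
      unfolding a b sum_3 w_def vector_3 by (simp_all add: algebra_simps)
    show "w \<noteq> 0"
    proof
      assume "w = 0"
      then have ab: "a 2 * b 3 = a 3 * b 2" "a 3 * b 1 = a 1 * b 3" "a 1 * b 2 = a 2 * b 1"
        unfolding w_def by (simp_all add: vec_eq_iff forall_3)
      have "a i * b j = a j * b i" for i j :: 3
        using ab exhaust_3[of i] exhaust_3[of j] by (elim disjE) (simp_all add: mult.commute)
      then have "a i * (\<Sum>j\<in>UNIV. b j * u $ j) = b i * (\<Sum>j\<in>UNIV. a j * u $ j)" for i
        by (simp add: sum_distrib_left mult.assoc[symmetric]) (simp add: mult.commute)
      then have "a i * mp_eval L' u = 0" for i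
        using assms(3) by (simp add: a b)
      then have "a i = 0" for i using assms(4) by simp
      then have "mp_eval L v = 0" for v by (simp add: a)
      then show False using assms(5) by blast
    qed
  qed
qed

section \<open>The linear transformation\<close>

lemma line_poly_cmult:
  fixes v :: "'k::alg_closed_field ^ 'n::finite"
  assumes "\<And>v. mp_eval G v = a * mp_eval F v"
  shows "line_poly G v w = smult a (line_poly F v w)"
  by (rule poly_eqI_alg_closed) (simp add: poly_line_poly assms)

text \<open>
  The first vector of the frame spans the intersection of the tangent lines at the first two
  points, and \<open>a2\<close>, \<open>a3\<close> compare the three equations of the curve.
\<close>

locale inflection_configuration =
  I1: inflection_point C Q1 d F L1 + I2: inflection_point C Q2 d F2 L2 + I3: inflection_point C Q3 d F3 L3 +
  irreducible_plane_curve v0 "coords Q1" "coords Q2" F d f C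
  for C :: "('k::alg_closed_field, 3) proj set" and Q1 Q2 Q3 d F L1 F2 L2 F3 L3 v0 f +
  fixes a2 a3 :: 'k
  assumes distinct: "Q1 \<noteq> Q2" "Q1 \<noteq> Q3" "Q2 \<noteq> Q3"
    and v0: "mp_eval L1 v0 = 0" "mp_eval L2 v0 = 0"
    and F2: "a2 \<noteq> 0" "\<And>v. mp_eval F2 v = a2 * mp_eval F v"
    and F3: "a3 \<noteq> 0" "\<And>v. mp_eval F3 v = a3 * mp_eval F v"
begin

lemma comb_q: "comb 0 1 0 = coords Q1" "comb 0 0 1 = coords Q2" "comb 1 0 0 = v0"
  by (simp_all add: comb_def)

lemma coords_q: "cz (coords Q1) = 0" "cz (coords Q2) = 1" "cx (coords Q2) = 0" "cy (coords Q2) = 0"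
  using coords_comb[of 0 1 0] coords_comb[of 0 0 1] by (simp_all add: comb_q)

lemma L_nonzero:
  "mp_eval L1 (coords Q2) \<noteq> 0" "mp_eval L1 (coords Q3) \<noteq> 0"
  "mp_eval L2 (coords Q1) \<noteq> 0" "mp_eval L3 (coords Q1) \<noteq> 0"
  using I1.tangent_line_meets_once[OF I2.Q_in_C] I1.tangent_line_meets_once[OF I3.Q_in_C]
    I2.tangent_line_meets_once[OF I1.Q_in_C] I3.tangent_line_meets_once[OF I1.Q_in_C] distinct by auto

lemma linear_comb:
  assumes "homogeneous 1 L"
  shows "mp_eval L (comb x y z) = x * mp_eval L v0 + y * mp_eval L (coords Q1) + z * mp_eval L (coords Q2)"
proof -
  have "comb x y z = 1 *s (x *s v0 + y *s coords Q1) + z *s coords Q2"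
    by (simp add: comb_def)
  then show ?thesis by (simp only: linear_form_combination[OF assms] mult_1)
qed

lemma cz_L1: "mp_eval L1 v = cz v * mp_eval L1 (coords Q2)"
  using linear_comb[OF I1.L(1), of "cx v" "cy v" "cz v"] v0 I1.L_q by (simp add: comb_coords)

lemma multiple:
  assumes "form_fun D h" "\<forall>P\<in>C. h (coords P) = 0"
  shows "\<exists>e k. form_fun e k \<and> (\<forall>v. h v = k v * mp_eval F v)"
proof -
  obtain e k where "form_fun e k" "\<And>v. h v = k v * mp_eval F v"
    by (rule vanishing_form_multiple[OF assms(1)]) (use assms(2) in simp, rule that)
  then show ?thesis by (intro exI conjI allI)
qed

lemma multiple':
  assumes "a \<noteq> 0" "\<And>v. mp_eval G v = a * mp_eval F v" "form_fun D h" "\<forall>P\<in>C. h (coords P) = 0"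
  shows "\<exists>e k. form_fun e k \<and> (\<forall>v. h v = k v * mp_eval G v)"
proof -
  obtain e k where k: "form_fun e k" "\<forall>v. h v = k v * mp_eval F v"
    using multiple[OF assms(3,4)] by (elim exE conjE)
  show ?thesis
    using form_fun_cmult[OF k(1), of "1 / a"] k(2) assms(1,2)
    by (intro exI[of _ e] exI[of _ "\<lambda>v. 1 / a * k v"]) simp
qed

lemma derivative_nonzero:
  "mp_eval L1 w \<noteq> 0 \<Longrightarrow> poly (pderiv (line_poly F (coords Q1) w)) 0 \<noteq> 0"
  "mp_eval L2 w \<noteq> 0 \<Longrightarrow> poly (pderiv (line_poly F (coords Q2) w)) 0 \<noteq> 0"
  "mp_eval L3 w \<noteq> 0 \<Longrightarrow> poly (pderiv (line_poly F (coords Q3) w)) 0 \<noteq> 0"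
proof -
  show "mp_eval L1 w \<noteq> 0 \<Longrightarrow> poly (pderiv (line_poly F (coords Q1) w)) 0 \<noteq> 0"
    by (rule I1.derivative_nonzero[OF multiple])
  show "poly (pderiv (line_poly F (coords Q2) w)) 0 \<noteq> 0" if "mp_eval L2 w \<noteq> 0"
    using I2.derivative_nonzero[OF multiple'[OF F2] that] F2(1)
    by (simp add: line_poly_cmult[of F2 a2 F, OF F2(2)] pderiv_smult)
  show "poly (pderiv (line_poly F (coords Q3) w)) 0 \<noteq> 0" if "mp_eval L3 w \<noteq> 0"
    using I3.derivative_nonzero[OF multiple'[OF F3] that] F3(1)
    by (simp add: line_poly_cmult[of F3 a3 F, OF F3(2)] pderiv_smult)
qed

lemma d_ge_2: "d \<ge> 2"
proof -
  have "d > 0" by (rule homogeneous_vanish[OF I1.F I1.Q_in_C])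
  moreover have "d \<noteq> 1"
  proof
    assume "d = 1"
    have "F \<noteq> 0" using I1.F(2) by (metis Factorial_Ring.not_irreducible_zero)
    then have "\<exists>v. mp_eval F v \<noteq> 0" by (metis mp_eval_eq_0_imp)
    then have "\<exists>P\<in>C. mp_eval F (coords P) \<noteq> 0"
      by (rule I1.not_line[OF form_funI[OF I1.F(1)[unfolded \<open>d = 1\<close>]]])
    then show False by (auto simp: C_iff)
  qed
  ultimately show ?thesis by simp
qed

text \<open>Along Q_1 + t Q_2 the coefficient of t in F is that of y^(d-1) z. It is nonzero because
  Q_1 is a smooth point and Q_2 lies off its tangent line.\<close>

lemma f_y_coeff: "cf f 0 (d - 1) \<noteq> 0"
proof -
  define p where "p = (\<Sum>j\<le>d. monom (cf f 0 j) (d - j))"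
  have "line_poly F (coords Q1) (coords Q2) = p"
  proof (rule poly_eqI_alg_closed)
    fix t
    have "coords Q1 + t *s coords Q2 = comb 0 1 t" by (simp add: comb_def)
    then have "poly (line_poly F (coords Q1) (coords Q2)) t = hv d f 0 1 t"
      by (simp add: poly_line_poly F_comb)
    also have "\<dots> = (\<Sum>j\<le>d. \<Sum>i\<le>d - j. if i = 0 then cf f 0 j * t ^ (d - j) else 0)"
      unfolding hv_def by (intro sum.cong) (auto simp: power_0_left)
    also have "\<dots> = poly p t"
      by (simp add: p_def poly_sum poly_monom)
    finally show "poly (line_poly F (coords Q1) (coords Q2)) t = poly p t" .
  qed
  then have "poly (pderiv p) 0 \<noteq> 0"
    using derivative_nonzero(1)[OF L_nonzero(1)] by simp
  moreover have "poly (pderiv p) 0 = coeff p 1"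
    by (simp add: poly_0_coeff_0 coeff_pderiv)
  moreover have "coeff p 1 = (\<Sum>j\<le>d. if j = d - 1 then cf f 0 j else 0)"
    unfolding p_def coeff_sum using d_ge_2 by (intro sum.cong) auto
  ultimately show ?thesis by simp
qed

text \<open>On the tangent line z = 0 at Q_1 total inflection gives F(x, 1, 0) = c x^d, which leaves
  c x^d as the only term of degree d in f.\<close>

lemma f_top_coeffs:
  obtains c where "c \<noteq> 0" "cf f d 0 = c" "\<And>j. 0 < j \<Longrightarrow> j \<le> d \<Longrightarrow> cf f (d - j) j = 0"
proof -
  have ind: "x = 0 \<and> z = 0" if "x *s v0 + z *s coords Q1 = 0" for x z
    using independent[of x z 0] that by simp
  obtain c where c: "c \<noteq> 0" "\<forall>t. mp_eval F (coords Q1 + t *s v0) = c * t ^ d"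
    using I1.contact[OF v0(1) ind] by blast
  have polyeq: "(\<Sum>j\<le>d. monom (cf f (d - j) j) (d - j)) = monom c d"
  proof (rule poly_eqI_alg_closed)
    fix x
    have "coords Q1 + x *s v0 = comb x 1 0" by (simp add: comb_def add.commute)
    then have "hv d f x 1 0 = c * x ^ d"
      using c(2) F_comb[of x 1 0] by metis
    then show "poly (\<Sum>j\<le>d. monom (cf f (d - j) j) (d - j)) x = poly (monom c d) x"
      by (simp add: hv_0 poly_sum poly_monom)
  qed
  have eq: "(\<Sum>j\<le>d. coeff (monom (cf f (d - j) j) (d - j)) i) = coeff (monom c d) i" for i
    by (simp only: coeff_sum[symmetric] polyeq)
  have cf: "cf f (d - j) j = coeff (monom c d) (d - j)" if "j \<le> d" for j
  proof -
    have "(\<Sum>k\<le>d. coeff (monom (cf f (d - k) k) (d - k)) (d - j)) = (\<Sum>k\<le>d. if k = j then cf f (d - k) k else 0)"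
      using that by (intro sum.cong) auto
    then show ?thesis using eq[of "d - j"] that by simp
  qed
  show ?thesis
  proof (rule that[OF c(1)])
    show "cf f d 0 = c" using cf[of 0] by simp
    show "cf f (d - j) j = 0" if "0 < j" "j \<le> d" for j
      using cf[OF that(2)] that by simp
  qed
qed

lemma f_rest: "cf f i j \<noteq> 0 \<Longrightarrow> i + j \<le> d - 1 \<or> i = d \<and> j = 0"
proof -
  assume nz: "cf f i j \<noteq> 0"
  then have "1 * i + 1 * j \<le> d" using weight_f unfolding wle_def by blast
  then have ij: "i + j \<le> d" by simp
  show ?thesis
  proof (cases "i + j = d")
    case True
    then have "cf f (d - j) j \<noteq> 0" using nz by (metis add_diff_cancel_right')
    then have "j = 0"
      using f_top_coeffs True by (metis le_add2 gr0I)
    then show ?thesis using True by simp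
  qed (use ij in simp)
qed

text \<open>Contact along y = 0 gives the pure power of x, up to the factor \<open>a2\<close>
  between the two equations. The value of h at the origin is the derivative of f there in the
  direction of Q_1, which is nonzero by smoothness since Q_1 lies off the tangent line at
  Q_2.\<close>

lemma f_at_Q2:
  obtains c h where "c \<noteq> 0" "ev2 h 0 0 \<noteq> 0" "\<And>x y. ev2 f x y = c * x ^ d + y * ev2 h x y"
proof -
  have ind: "x = 0 \<and> z = 0" if "x *s v0 + z *s coords Q2 = 0" for x z
    using independent[of x 0 z] that by simp
  obtain c where c: "c \<noteq> 0" "\<forall>t. mp_eval F2 (coords Q2 + t *s v0) = c * t ^ d"
    using I2.contact[OF v0(2) ind] by blast
  obtain u0 h where f: "f = pCons u0 h" by (cases f)
  have u0: "poly u0 x = c / a2 * x ^ d" for x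
  proof -
    have "coords Q2 + x *s v0 = comb x 0 1" by (simp add: comb_def add.commute)
    then have "mp_eval F2 (comb x 0 1) = c * x ^ d"
      using c(2)[rule_format, of x] by (simp only:)
    then have "a2 * ev2 f x 0 = c * x ^ d"
      using F2(2)[of "comb x 0 1"] by (simp only: F_affine)
    then show ?thesis using F2(1) by (simp add: f field_simps)
  qed
  have ev: "ev2 f x y = c / a2 * x ^ d + y * ev2 h x y" for x y
    by (simp add: f u0)
  obtain s where s: "\<And>y. poly s y = ev2 h 0 y"
    by (rule poly_slice[of h 0]) (rule that)
  have "line_poly F (coords Q2) (coords Q1) = [:0, 1:] * s"
  proof (rule poly_eqI_alg_closed)
    fix t
    have "coords Q2 + t *s coords Q1 = comb 0 t 1" by (simp add: comb_def add.commute)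
    then show "poly (line_poly F (coords Q2) (coords Q1)) t = poly ([:0, 1:] * s) t"
      using d_ge_2 by (simp add: poly_line_poly F_affine ev s power_0_left)
  qed
  then have "poly (pderiv ([:0, 1:] * s)) 0 \<noteq> 0"
    using derivative_nonzero(2)[OF L_nonzero(3)] by simp
  then have "ev2 h 0 0 \<noteq> 0"
    unfolding pderiv_mult by (simp add: pderiv_pCons s)
  moreover have "c / a2 \<noteq> 0" using c(1) F2(1) by simp
  ultimately show ?thesis using that ev by blast
qed

text \<open>The tangent line at Q_3 is y + \<alpha> x + \<beta> z = 0. Normalizing by the
  coefficient of y is possible because Q_1 does not lie on that line.\<close>

definition \<alpha> :: 'k where "\<alpha> = mp_eval L3 v0 / mp_eval L3 (coords Q1)"
definition \<beta> :: 'k where "\<beta> = mp_eval L3 (coords Q2) / mp_eval L3 (coords Q1)"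

lemma L3_comb: "mp_eval L3 (comb x y z) = mp_eval L3 (coords Q1) * (y + \<alpha> * x + \<beta> * z)"
  using L_nonzero(4) by (simp add: linear_comb[OF I3.L(1)] \<alpha>_def \<beta>_def field_simps)

lemma Q3_affine:
  assumes "cx (coords Q3) = 0"
  shows "cz (coords Q3) \<noteq> 0" "cy (coords Q3) = - \<beta> * cz (coords Q3)"
proof -
  show "cz (coords Q3) \<noteq> 0"
    using L_nonzero(2) cz_L1[of "coords Q3"] by auto
  have "mp_eval L3 (coords Q1) * (cy (coords Q3) + \<alpha> * cx (coords Q3) + \<beta> * cz (coords Q3)) = 0"
    using I3.L_q L3_comb[of "cx (coords Q3)" "cy (coords Q3)" "cz (coords Q3)"] by (simp add: comb_coords)
  then have "cy (coords Q3) + \<beta> * cz (coords Q3) = 0"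
    using L_nonzero(4) assms by simp
  then show "cy (coords Q3) = - \<beta> * cz (coords Q3)"
    by (simp add: eq_neg_iff_add_eq_0)
qed

text \<open>As at Q_2, but along y = - \<alpha> x - \<beta>: there f equals c x^d, so the linear
  factor divides f - c x^d. It matters that Q_3 lies on x = 0, since this makes the same power x^d
  appear as at Q_2 instead of a power of a shifted x.\<close>

lemma f_at_Q3:
  assumes Q3: "cx (coords Q3) = 0"
  obtains c h where "c \<noteq> 0" "ev2 h 0 (- \<beta>) \<noteq> 0"
    "\<And>x y. ev2 f x y = c * x ^ d + (y + \<alpha> * x + \<beta>) * ev2 h x y"
proof -
  define z where "z = cz (coords Q3)"
  have z: "z \<noteq> 0" using Q3_affine[OF Q3] by (simp add: z_def)
  have q3: "coords Q3 = comb 0 (- \<beta> * z) z"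
    using comb_coords[of "coords Q3"] Q3_affine(2)[OF Q3] Q3 by (simp add: z_def)
  define w where "w = comb 1 (- \<alpha>) 0"
  have "mp_eval L3 w = 0"
    unfolding w_def L3_comb by simp
  moreover have ind: "x = 0 \<and> y = 0" if "x *s w + y *s coords Q3 = 0" for x y
  proof -
    have "comb x (- \<alpha> * x - \<beta> * z * y) (y * z) = x *s w + y *s coords Q3"
      by (simp add: q3 w_def comb_def algebra_simps)
    then have "x = 0 \<and> y * z = 0"
      using independent that unfolding comb_def by metis
    then show ?thesis using z by simp
  qed
  ultimately obtain c where c: "c \<noteq> 0" "\<forall>t. mp_eval F3 (coords Q3 + t *s w) = c * t ^ d"
    using I3.contact[of w] by blast
  have line: "ev2 f x (- \<alpha> * x - \<beta>) = c / a3 * x ^ d" for x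
  proof -
    have "comb x (- \<alpha> * x - \<beta>) 1 = (1 / z) *s (coords Q3 + (x * z) *s w)"
      using z by (simp add: q3 w_def comb_def algebra_simps)
    then have "mp_eval F3 (comb x (- \<alpha> * x - \<beta>) 1) = (1 / z) ^ d * (c * (x * z) ^ d)"
      using c(2) by (simp only: homogeneous_scale[OF I3.F(1)])
    then have "a3 * ev2 f x (- \<alpha> * x - \<beta>) = c * x ^ d"
      using z by (simp add: F3(2) F_affine power_mult_distrib power_divide)
    then show ?thesis using F3(1) by (simp add: field_simps)
  qed
  define r where "r = [:- \<beta>, - \<alpha>:]"
  define k where "k = f - [:monom (c / a3) d:]"
  have "poly k r = 0"
  proof (rule poly_eqI_alg_closed)
    fix x
    have lin: "poly (poly g r) x = ev2 g x (poly r x)" for g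
      by (induction g) (simp_all add: ev2_def)
    have rx: "poly r x = - \<alpha> * x - \<beta>" by (simp add: r_def algebra_simps)
    have "ev2 k x y = ev2 f x y - c / a3 * x ^ d" for y by (simp add: k_def poly_monom)
    then show "poly (poly k r) x = poly 0 x"
      unfolding lin rx using line[of x] by simp
  qed
  then obtain h where h: "k = [:- r, 1:] * h"
    unfolding poly_eq_0_iff_dvd by (rule dvdE)
  have ev: "ev2 f x y = c / a3 * x ^ d + (y + \<alpha> * x + \<beta>) * ev2 h x y" for x y
  proof -
    have "ev2 k x y = ev2 ([:- r, 1:] * h) x y" by (simp only: h)
    then show ?thesis by (simp add: k_def r_def poly_monom algebra_simps)
  qed
  obtain s where s: "\<And>y. poly s y = ev2 h 0 y"
    by (rule poly_slice[of h 0]) (rule that)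
  have "line_poly F (coords Q3) (coords Q1) = smult (z ^ d) ([:0, 1 / z:] * pcompose s [:- \<beta>, 1 / z:])"
  proof (rule poly_eqI_alg_closed)
    fix t
    have "coords Q3 + t *s coords Q1 = z *s comb 0 (- \<beta> + t / z) 1"
      using z by (simp add: q3 comb_def algebra_simps)
    then have "mp_eval F (coords Q3 + t *s coords Q1) = z ^ d * ev2 f 0 (- \<beta> + t / z)"
      by (simp only: homogeneous_scale[OF I1.F(1)] F_affine)
    then show "poly (line_poly F (coords Q3) (coords Q1)) t =
        poly (smult (z ^ d) ([:0, 1 / z:] * pcompose s [:- \<beta>, 1 / z:])) t"
      using d_ge_2 by (simp add: poly_line_poly ev s poly_pcompose power_0_left)
  qed
  then have "poly (pderiv (smult (z ^ d) ([:0, 1 / z:] * pcompose s [:- \<beta>, 1 / z:]))) 0 \<noteq> 0"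
    using derivative_nonzero(3)[OF L_nonzero(4)] by simp
  then have "ev2 h 0 (- \<beta>) \<noteq> 0"
    unfolding pderiv_smult pderiv_mult by (simp add: pderiv_pCons poly_pcompose s)
  moreover have "c / a3 \<noteq> 0" using c(1) F3(1) by simp
  ultimately show ?thesis using that ev by blast
qed

end

lemma configuration_exists:
  fixes C :: "('k::alg_closed_field, 3) proj set"
  assumes C: "zariski_irreducible C"
    and I: "inflection_point C Q1 d1 F1 L1" "inflection_point C Q2 d2 F2 L2" "inflection_point C Q3 d3 F3 L3"
    and distinct: "Q1 \<noteq> Q2" "Q1 \<noteq> Q3" "Q2 \<noteq> Q3"
  obtains v0 f a2 a3 where "inflection_configuration C Q1 Q2 Q3 d1 F1 L1 F2 L2 F3 L3 v0 f a2 a3"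
proof -
  interpret I1: inflection_point C Q1 d1 F1 L1 by fact
  interpret I2: inflection_point C Q2 d2 F2 L2 by fact
  interpret I3: inflection_point C Q3 d3 F3 L3 by fact
  have L1Q2: "mp_eval L1 (coords Q2) \<noteq> 0" and L2Q1: "mp_eval L2 (coords Q1) \<noteq> 0"
    using I1.tangent_line_meets_once[OF I2.Q_in_C] I2.tangent_line_meets_once[OF I1.Q_in_C] distinct by auto
  obtain v0 where v0: "v0 \<noteq> 0" "mp_eval L1 v0 = 0" "mp_eval L2 v0 = 0"
    by (rule linear_kernel_intersection[OF I1.L(1) I2.L(1) I1.L_q L2Q1 I1.L_nonzero])
  \<comment> \<open>L1 kills v0 and Q_1 but not Q_2, so applied to a linear relation it isolates the
    coefficient of Q_2; in the same way L2 isolates that of Q_1.\<close>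
  interpret frame v0 "coords Q1" "coords Q2"
  proof
    fix x y z assume xyz: "x *s v0 + y *s coords Q1 + z *s coords Q2 = 0"
    have lin: "mp_eval L (x *s v0 + y *s coords Q1 + z *s coords Q2) =
        x * mp_eval L v0 + y * mp_eval L (coords Q1) + z * mp_eval L (coords Q2)" if "homogeneous 1 L" for L
      using linear_form_combination[OF that, of 1 "x *s v0 + y *s coords Q1" z]
        linear_form_combination[OF that, of x v0 y] by simp
    have zero: "mp_eval L 0 = 0" if "homogeneous 1 L" for L :: "('k, 3) mpol"
      using homogeneous_scale[OF that, of 0 0] by simp
    have "z = 0" using lin[OF I1.L(1)] zero[OF I1.L(1)] v0 I1.L_q L1Q2 unfolding xyz by simp
    moreover have "y = 0" using lin[OF I2.L(1)] zero[OF I2.L(1)] v0 I2.L_q L2Q1 unfolding xyz by simp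
    ultimately show "x = 0 \<and> y = 0 \<and> z = 0" using xyz v0(1) by simp
  qed
  obtain f where f: "wle 1 1 d1 f" "\<And>x y z. mp_eval F1 (comb x y z) = hv d1 f x y z"
    by (rule dehomogenize[OF form_funI[OF I1.F(1)]]) (rule that)
  \<comment> \<open>Otherwise \<open>C\<close> would be covered by the line z = 0 and finitely many
    vertical lines, and being irreducible it would lie in one of them.\<close>
  have "infinite {x. \<exists>y. ev2 f x y = 0}"
  proof
    assume fin: "finite {x. \<exists>y. ev2 f x y = 0}" (is "finite ?X")
    define K where "K c v = cx v + (- c) * cz v" for c v
    define H where "H = insert (\<lambda>v. cz v) (K ` ?X)"
    have ne: "form_fun 1 h \<and> (\<exists>v. h v \<noteq> 0)" if "h \<in> H" for h
    proof (cases "h = (\<lambda>v. cz v)")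
      case True
      then show ?thesis using coords_comb(3)[of 0 0 1] form_fun_matrix[of coord_matrix 3] by (metis zero_neq_one)
    next
      case False
      then have "h \<in> K ` ?X" using that unfolding H_def by simp
      then obtain c where h: "h = K c" by (rule imageE)
      have "h (comb 1 0 0) = 1" unfolding h K_def by simp
      moreover have "form_fun 1 h"
        unfolding h K_def[abs_def] by (intro form_fun_add form_fun_cmult form_fun_matrix)
      ultimately show ?thesis by (metis zero_neq_one)
    qed
    have "\<exists>P\<in>C. \<forall>h\<in>H. h (coords P) \<noteq> 0"
    proof (rule irreducible_avoid_lines[OF C])
      show "finite H" using fin by (simp add: H_def)
      show "form_fun 1 h \<and> (\<exists>P\<in>C. h (coords P) \<noteq> 0)" if "h \<in> H" for h
        using I1.not_line ne[OF that] by simp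
    qed
    then obtain P where P: "P \<in> C" "\<And>h. h \<in> H \<Longrightarrow> h (coords P) \<noteq> 0" by blast
    have z: "cz (coords P) \<noteq> 0"
      using P(2)[of "\<lambda>v. cz v"] by (simp add: H_def)
    have "hv d1 f (cx (coords P)) (cy (coords P)) (cz (coords P)) = mp_eval F1 (coords P)"
      by (simp add: comb_coords flip: f(2))
    also have "\<dots> = 0" using P(1) I1.F(3) by (simp add: zeros_def)
    finally have "ev2 f (cx (coords P) / cz (coords P)) (cy (coords P) / cz (coords P)) = 0"
      using z by (simp add: hv_nonzero[OF z f(1)])
    then have "K (cx (coords P) / cz (coords P)) \<in> H"
      unfolding H_def by (intro insertI2 imageI CollectI exI)
    from P(2)[OF this] show False using z by (simp add: K_def)
  qed
  then interpret irreducible_plane_curve v0 "coords Q1" "coords Q2" F1 d1 f C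
    using I1.F C f by unfold_locales auto
  obtain a2 where a2: "a2 \<noteq> 0" "d2 = d1" "\<And>v. mp_eval F2 v = a2 * mp_eval F1 v"
    by (rule defining_form_unique[OF I2.F]) (rule that)
  obtain a3 where a3: "a3 \<noteq> 0" "d3 = d1" "\<And>v. mp_eval F3 v = a3 * mp_eval F1 v"
    by (rule defining_form_unique[OF I3.F]) (rule that)
  have "inflection_configuration C Q1 Q2 Q3 d1 F1 L1 F2 L2 F3 L3 v0 f a2 a3"
    by (intro inflection_configuration.intro inflection_configuration_axioms.intro
        I(1) I(2)[unfolded a2(2)] I(3)[unfolded a3(2)] irreducible_plane_curve_axioms distinct v0 a2 a3)
  then show ?thesis by (rule that)
qed

section \<open>The action of the automorphism on the coordinates\<close>

locale galois_configuration =
  inflection_configuration "\<phi> ` X" "\<phi> P1" "\<phi> P2" "\<phi> P3" d F L1 F2 L2 F3 L3 v0 f a2 a3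
  for X :: "('k::alg_closed_field, 'n::finite) proj set" and \<phi> :: "('k, 'n) proj \<Rightarrow> ('k, 3) proj"
    and P1 P2 P3 d F L1 F2 L2 F3 L3 v0 f a2 a3 +
  fixes \<sigma> :: "('k, 'n) proj \<Rightarrow> ('k, 'n) proj" and A :: "'k ^ 3 ^ 2" and \<tau>
  assumes X: "zariski_irreducible X" and \<phi>: "morphism X UNIV \<phi>"
    and \<sigma>: "morphism X X \<sigma>" "\<sigma> ` X = X"
    and P2: "P2 \<in> X" "\<sigma> P2 = P3"
    and A: "projection_from (\<phi> P1) A"
    and \<tau>: "\<tau> \<in> galois_group (function_field (\<phi> ` X)) (projection_subfield (\<phi> ` X) A (\<phi> P1))"
    and comm: "\<forall>a\<in>carrier (function_field (\<phi> ` X)).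
      pullback X X \<sigma> (pullback X X \<phi> a) = pullback X X \<phi> (\<tau> a)"
begin

abbreviation C where "C \<equiv> \<phi> ` X"

lemma ne_Q1_iff: "P \<noteq> \<phi> P1 \<longleftrightarrow> cx (coords P) \<noteq> 0 \<or> cz (coords P) \<noteq> 0"
proof -
  obtain p0 p2 :: "'k ^ 2" where Av: "\<And>v. A *v v = cx v *s p0 + cz v *s p2"
    by (rule projection_coordinates[of A]) (use A in simp, rule that)
  have "P = \<phi> P1" if "cx (coords P) = 0" "cz (coords P) = 0"
    by (rule projection_kernel[OF A]) (simp add: Av that)
  moreover have "cx (coords (\<phi> P1)) = 0"
    using coords_comb(1)[of 0 1 0] by (simp add: comb_q)
  ultimately show ?thesis using coords_q(1) by blast
qed

lemma projection_nonzero: "P \<noteq> \<phi> P1 \<Longrightarrow> A *v coords P \<noteq> 0"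
  using projection_kernel[OF A] by blast

lemma openin_projection_domain: "openin (top_of_set C) (C - {\<phi> P1})"
proof -
  have "C - {\<phi> P1} = C \<inter> ({P. cx (coords P) \<noteq> 0} \<union> {P. cz (coords P) \<noteq> 0})"
    using ne_Q1_iff by blast
  moreover have "open ({P. cx (coords P) \<noteq> 0} \<union> {P. cz (coords P) \<noteq> 0})"
    by (rule open_Un open_form_nonzero[OF form_fun_matrix])+
  ultimately show ?thesis unfolding openin_open by (intro exI conjI)
qed

text \<open>Off \<open>dom g\<close> some form H vanishes that is nonzero at a point p2 + x0 p0.
  Along p2 + x p0 it is a nonzero polynomial in x with finitely many roots, while the curve has
  affine points over infinitely many x. So every rational function on the projective line can be
  pulled back.\<close>

lemma projection_dominant:
  fixes g :: "('k, 2) pfun"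
  assumes "g \<in> rat_reps UNIV"
  shows "\<exists>P\<in>C - {\<phi> P1}. proj_map A P \<in> dom g"
proof -
  obtain g0 g2 :: "'k ^ 2 \<Rightarrow> 'k" and p0 p2 :: "'k ^ 2" where g: "form_fun 1 g2"
    "\<And>v. g2 (A *v v) = cz v" "\<And>v. A *v v = cx v *s p0 + cz v *s p2"
    "\<And>u. u = g0 u *s p0 + g2 u *s p2"
    by (rule projection_coordinates[of A]) (use A in simp, rule that)
  let ?V = "{R. g2 (coords R) \<noteq> 0}"
  have "A *v coords (\<phi> P2) \<noteq> 0"
    using projection_nonzero distinct(1) by simp
  then have "point (A *v coords (\<phi> P2)) \<in> ?V"
    using form_zero_point[OF g(1)] by (simp add: g(2) coords_q)
  then have V: "openin (top_of_set UNIV) ?V" "?V \<noteq> {}"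
    using open_form_nonzero[OF g(1)] by auto
  obtain R where R: "R \<in> dom g" "g2 (coords R) \<noteq> 0"
    using openin_inter_nonempty[OF irreducible_UNIV rat_repsD(1)[OF assms] V(1) rat_repsD(2)[OF assms] V(2)]
    by blast
  have "open (dom g)" using rat_repsD(1)[OF assms] by simp
  then obtain T where T: "T \<subseteq> forms" "- dom g = zeros T"
    unfolding open_proj_def by blast
  have "R \<notin> zeros T" using R(1) T(2) by blast
  then obtain H where H: "H \<in> T" "mp_eval H (coords R) \<noteq> 0"
    unfolding zeros_def by blast
  then obtain D where D: "homogeneous D H" using T(1) unfolding forms_def by blast
  define x0 where "x0 = g0 (coords R) / g2 (coords R)"
  have eq: "coords R = g2 (coords R) *s (p2 + x0 *s p0)"
    by (subst g(4)[of "coords R"]) (use R(2) in \<open>simp add: x0_def vec.scale_right_distrib add.commute\<close>)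
  have "mp_eval H (coords R) = mp_eval H (g2 (coords R) *s (p2 + x0 *s p0))"
    by (rule arg_cong[OF eq])
  also have "\<dots> = g2 (coords R) ^ D * mp_eval H (p2 + x0 *s p0)"
    by (rule homogeneous_scale[OF D])
  finally have "poly (line_poly H p2 p0) x0 \<noteq> 0"
    using H(2) by (auto simp: poly_line_poly)
  then have "line_poly H p2 p0 \<noteq> 0" by auto
  then have "finite {x. poly (line_poly H p2 p0) x = 0}" by (rule poly_roots_finite)
  then have "\<not> {x. \<exists>y. ev2 f x y = 0} \<subseteq> {x. poly (line_poly H p2 p0) x = 0}"
    using infinite_x finite_subset by blast
  then obtain x y where xy: "ev2 f x y = 0" "poly (line_poly H p2 p0) x \<noteq> 0" by blast
  define P where "P = point (comb x y 1)"
  have nz: "comb x y 1 \<noteq> 0" by (rule comb_nonzero) simp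
  have P: "P \<in> C" unfolding P_def by (rule affine_point_in_C[OF xy(1)])
  have "cz (coords P) \<noteq> 0"
    unfolding P_def using form_zero_point[OF form_fun_matrix nz, of coord_matrix 3] by simp
  then have PQ: "P \<noteq> \<phi> P1" using ne_Q1_iff by blast
  have "mp_eval H (A *v comb x y 1) \<noteq> 0"
    using xy(2) by (simp add: g(3) poly_line_poly add.commute)
  then have "mp_eval H (A *v coords P) \<noteq> 0"
    unfolding P_def using form_zero_point[OF form_fun_proj_map[OF form_funI[OF D], of A] nz] by simp
  then have "mp_eval H (coords (proj_map A P)) \<noteq> 0"
    using form_zero_point[OF form_funI[OF D] projection_nonzero[OF PQ]]
    by (simp add: proj_map_coords[OF projection_nonzero[OF PQ]])
  then have "proj_map A P \<notin> zeros T" using H(1) unfolding zeros_def by blast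
  then show ?thesis using P PQ T(2) by blast
qed

text \<open>x is the pullback of g0 / g2 from the projective line, so its class is fixed by \<tau>.
  Taking \<open>f0\<close> itself as representative of the image class turns this into equality of
  the values at P and \<sigma>(P).\<close>

lemma x_invariant:
  assumes P: "P \<in> X" "cz (coords (\<phi> P)) \<noteq> 0" "cz (coords (\<phi> (\<sigma> P))) \<noteq> 0"
  shows "cx (coords (\<phi> (\<sigma> P))) / cz (coords (\<phi> (\<sigma> P))) = cx (coords (\<phi> P)) / cz (coords (\<phi> P))"
proof -
  obtain g0 g2 :: "'k ^ 2 \<Rightarrow> 'k" where g: "form_fun 1 g0" "form_fun 1 g2"
    "\<And>v. g0 (A *v v) = cx v" "\<And>v. g2 (A *v v) = cz v"
    by (rule projection_coordinates[of A]) (use A in simp, rule that)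
  define g where "g = rep {R. g2 (coords R) \<noteq> 0} (\<lambda>R. g0 (coords R) / g2 (coords R))"
  define f0 where "f0 = (g \<circ> proj_map A) |` (C - {\<phi> P1})"
  have nz: "A *v coords R \<noteq> 0" if "cz (coords R) \<noteq> 0" for R
    using projection_nonzero[of R] ne_Q1_iff[of R] that by blast
  have g_zero: "g2 (coords (proj_map A R)) \<noteq> 0" if "cz (coords R) \<noteq> 0" for R
    using form_zero_point[OF g(2) nz[OF that]] that by (simp add: proj_map_coords[OF nz[OF that]] g)
  have f0: "f0 R = Some (cx (coords R) / cz (coords R))" if "R \<in> C" "cz (coords R) \<noteq> 0" for R
  proof -
    have "R \<in> C - {\<phi> P1}" using that ne_Q1_iff by blast
    moreover have "g (proj_map A R) = Some (cx (coords R) / cz (coords R))"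
      using g_zero[OF that(2)] form_quotient_point[OF g(1,2) nz[OF that(2)]]
      by (simp add: g_def rep_def proj_map_coords[OF nz[OF that(2)]] g)
    ultimately show ?thesis by (simp add: f0_def)
  qed
  have "{R. g2 (coords R) \<noteq> 0} \<noteq> {}"
    using g_zero[of "\<phi> P2"] coords_q by auto
  then have g_reps: "g \<in> rat_reps UNIV"
    unfolding g_def rep_in_reps using open_form_nonzero[OF g(2)]
    by (intro conjI regular_on_quotient[OF g(1,2)]) auto
  have mor: "morphism (C - {\<phi> P1}) UNIV (proj_map A)"
    by (rule morphism_proj_map) (use projection_nonzero in blast)
  have reps: "(u \<circ> proj_map A) |` (C - {\<phi> P1}) \<in> rat_reps C" if "u \<in> rat_reps UNIV" for u
    by (rule pullback_rep[OF mor openin_projection_domain that projection_dominant[OF that]])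
  have f0_reps: "f0 \<in> rat_reps C" unfolding f0_def by (rule reps[OF g_reps])
  have "rat_rel C `` {f0} = pullback C (C - {\<phi> P1}) (proj_map A) (rat_rel UNIV `` {g})"
    unfolding f0_def by (rule pullback_class[symmetric, OF C_irreducible irreducible_UNIV g_reps reps])
  then have "rat_rel C `` {f0} \<in> projection_subfield C A (\<phi> P1)"
    unfolding projection_subfield_def using rat_class_in_carrier[OF g_reps] by (rule image_eqI)
  then have fixed: "\<tau> (rat_rel C `` {f0}) = rat_rel C `` {f0}"
    using \<tau> unfolding galois_group_def by blast
  have mem: "f0 \<in> \<tau> (rat_rel C `` {f0})"
    unfolding fixed using f0_reps by (simp add: rat_rel_iff)
  have act: "f0 (\<phi> (\<sigma> P)) = g' (\<phi> P)"
    if "g' \<in> \<tau> (rat_rel C `` {f0})" "P \<in> X" "\<phi> (\<sigma> P) \<in> dom f0" "\<phi> P \<in> dom g'" for g' P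
    by (rule point_group_action[OF X \<phi> \<sigma> \<tau> comm f0_reps]) (use that in blast)
  have \<sigma>P: "\<phi> (\<sigma> P) \<in> C" using P(1) \<sigma>(2) by blast
  have "f0 (\<phi> (\<sigma> P)) = f0 (\<phi> P)"
    by (rule act[OF mem P(1)]) (use f0[OF \<sigma>P P(3)] f0[OF imageI[OF P(1)] P(2)] in blast)+
  then show ?thesis using f0[OF \<sigma>P P(3)] f0[OF imageI[OF P(1)] P(2)] by simp
qed

text \<open>Here x, y and y' are all regular. P_2 belongs to this set because Q_2 and Q_3 lie off
  the tangent line z = 0 at Q_1.\<close>

definition S where "S = {P \<in> X. cz (coords (\<phi> P)) \<noteq> 0 \<and> cz (coords (\<phi> (\<sigma> P))) \<noteq> 0}"
definition xx where "xx P = cx (coords (\<phi> P)) / cz (coords (\<phi> P))"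
definition yy where "yy P = cy (coords (\<phi> P)) / cz (coords (\<phi> P))"
definition yt where "yt P = cy (coords (\<phi> (\<sigma> P))) / cz (coords (\<phi> (\<sigma> P)))"

lemma \<phi>\<sigma>: "morphism X UNIV (\<lambda>P. \<phi> (\<sigma> P))"
  by (rule morphism_compose[OF \<sigma>(1) \<phi>])

lemma \<sigma>_in: "P \<in> X \<Longrightarrow> \<sigma> P \<in> X"
  using \<sigma>(2) by blast

lemma openin_S: "openin (top_of_set X) S"
proof -
  have "S = {P \<in> X. \<phi> P \<in> {R. cz (coords R) \<noteq> 0}} \<inter> {P \<in> X. \<phi> (\<sigma> P) \<in> {R. cz (coords R) \<noteq> 0}}"
    by (auto simp: S_def)
  then show ?thesis
    using morphism_openin_preimage[OF \<phi>, of "{R. cz (coords R) \<noteq> 0}"]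
      morphism_openin_preimage[OF \<phi>\<sigma>, of "{R. cz (coords R) \<noteq> 0}"]
      open_form_nonzero[OF form_fun_matrix, of coord_matrix 3] by (simp add: openin_Int)
qed

lemma P2_in_S: "P2 \<in> S"
  using P2 coords_q L_nonzero(2) cz_L1[of "coords (\<phi> P3)"] by (simp add: S_def)

lemma regular_coordinates: "regular_on S xx" "regular_on S yy" "regular_on S yt"
proof -
  show "regular_on S xx" unfolding xx_def[abs_def]
    by (rule regular_on_subset[OF morphism_quotient[OF \<phi> form_fun_matrix form_fun_matrix]]) (auto simp: S_def)
  show "regular_on S yy" unfolding yy_def[abs_def]
    by (rule regular_on_subset[OF morphism_quotient[OF \<phi> form_fun_matrix form_fun_matrix]]) (auto simp: S_def)
  show "regular_on S yt" unfolding yt_def[abs_def]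
    by (rule regular_on_subset[OF morphism_quotient[OF \<phi>\<sigma> form_fun_matrix form_fun_matrix]]) (auto simp: S_def)
qed

lemma meets_S:
  assumes "openin (top_of_set C) W" "W \<noteq> {}"
  shows "openin (top_of_set X) {P \<in> S. \<phi> P \<in> W}" "{P \<in> S. \<phi> P \<in> W} \<noteq> {}"
proof -
  have SW: "{P \<in> S. \<phi> P \<in> W} = S \<inter> {P \<in> X. \<phi> P \<in> W}"
    by (auto simp: S_def)
  have W: "openin (top_of_set X) {P \<in> X. \<phi> P \<in> W}"
    by (rule morphism_openin_preimage'[OF morphism_image[OF \<phi>] assms(1)])
  have "W \<subseteq> C" using openin_imp_subset[OF assms(1)] .
  then have "{P \<in> X. \<phi> P \<in> W} \<noteq> {}" using assms(2) by blast
  then show "{P \<in> S. \<phi> P \<in> W} \<noteq> {}"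
    unfolding SW using openin_inter_nonempty[OF X openin_S W] P2_in_S by blast
  show "openin (top_of_set X) {P \<in> S. \<phi> P \<in> W}"
    unfolding SW by (rule openin_Int[OF openin_S W])
qed

lemma xx_\<sigma>: "P \<in> S \<Longrightarrow> cx (coords (\<phi> (\<sigma> P))) / cz (coords (\<phi> (\<sigma> P))) = xx P"
  using x_invariant by (simp add: S_def xx_def)

lemma f_on_S:
  assumes "P \<in> S"
  shows "ev2 f (xx P) (yy P) = 0" "ev2 f (xx P) (yt P) = 0"
  using C_affine_point[of "\<phi> P"] C_affine_point[of "\<phi> (\<sigma> P)"] xx_\<sigma>[OF assms] assms \<sigma>_in[of P]
  by (simp_all add: S_def yy_def yt_def) (simp_all add: xx_def)

lemma f_dvd:
  assumes "\<And>P. P \<in> S \<Longrightarrow> ev2 a (xx P) (yy P) = 0"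
  shows "f dvd a"
proof (rule f_generates(1), rule ccontr)
  assume a: "a \<notin> curve_ideal"
  obtain N where N: "wle 1 1 N a" using exists_weight by blast
  obtain P where P: "P \<in> S" "\<phi> P \<in> nonzero_locus N a"
    using meets_S(2)[OF curve_ideal_open[OF a N]] by blast
  then have "hv N a (cx (coords (\<phi> P))) (cy (coords (\<phi> P))) (cz (coords (\<phi> P))) \<noteq> 0"
    by (simp add: nonzero_locus_def)
  then show False
    using assms[OF P(1)] P(1) by (simp add: hv_nonzero[OF _ N] S_def xx_def yy_def)
qed

text \<open>The image of the class of y under \<tau> is represented by a function g on the image
  curve, locally a quotient of forms; dehomogenizing denominator and numerator gives G and U. The
  identity G y' = U holds on a nonempty open set and hence on all of \<open>S\<close>.\<close>

lemma yt_rational: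
  "\<exists>G U. \<not> f dvd G \<and> (\<forall>P\<in>S. ev2 G (xx P) (yy P) * yt P = ev2 U (xx P) (yy P))"
proof -
  define f0 where "f0 = rep {R \<in> C. cz (coords R) \<noteq> 0} (\<lambda>R. cy (coords R) / cz (coords R))"
  have "\<phi> P2 \<in> {R \<in> C. cz (coords R) \<noteq> 0}" using P2(1) coords_q by simp
  moreover have "openin (top_of_set C) {R \<in> C. cz (coords R) \<noteq> 0}"
    unfolding openin_open using open_form_nonzero[OF form_fun_matrix, of coord_matrix 3] by blast
  ultimately have f0: "f0 \<in> rat_reps C"
    unfolding f0_def rep_in_reps
    by (intro conjI regular_on_quotient[OF form_fun_matrix form_fun_matrix]) auto
  obtain g where g: "g \<in> rat_reps C"
    and act: "\<And>P. P \<in> X \<Longrightarrow> \<phi> (\<sigma> P) \<in> dom f0 \<Longrightarrow> \<phi> P \<in> dom g \<Longrightarrow> f0 (\<phi> (\<sigma> P)) = g (\<phi> P)"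
  proof (rule point_group_action[OF X \<phi> \<sigma> \<tau> comm f0])
    fix g assume g: "g \<in> rat_reps C" "\<tau> (rat_rel C `` {f0}) = rat_rel C `` {g}"
      and act: "\<And>g' P. g' \<in> \<tau> (rat_rel C `` {f0}) \<Longrightarrow> P \<in> X \<Longrightarrow> \<phi> (\<sigma> P) \<in> dom f0 \<Longrightarrow> \<phi> P \<in> dom g' \<Longrightarrow>
        f0 (\<phi> (\<sigma> P)) = g' (\<phi> P)"
    have mem: "g \<in> \<tau> (rat_rel C `` {f0})"
      unfolding g(2) using g(1) by (simp add: rat_rel_iff)
    show thesis by (rule that[OF g(1) act[OF mem]])
  qed
  have yt_g: "yt P = the (g (\<phi> P))" if "P \<in> S" "\<phi> P \<in> dom g" for P
  proof -
    have "f0 (\<phi> (\<sigma> P)) = Some (yt P)"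
      using that(1) \<sigma>_in[of P] by (simp add: f0_def rep_def S_def yt_def)
    moreover have "f0 (\<phi> (\<sigma> P)) = g (\<phi> P)"
      by (rule act) (use that calculation in \<open>auto simp: S_def\<close>)
    ultimately show ?thesis by simp
  qed
  obtain P0 where P0: "P0 \<in> S" "\<phi> P0 \<in> dom g"
    using meets_S(2)[OF rat_repsD(1,2)[OF g]] by blast
  obtain W D h h' where W: "openin (top_of_set (dom g)) W" "\<phi> P0 \<in> W" "form_fun D h" "form_fun D h'"
    "\<And>Q. Q \<in> W \<Longrightarrow> h' (coords Q) \<noteq> 0" "\<And>Q. Q \<in> W \<Longrightarrow> the (g Q) = h (coords Q) / h' (coords Q)"
    by (rule regular_onE[OF rat_repsD(3)[OF g] P0(2)]) (rule that)
  obtain G where G: "wle 1 1 D G" "\<And>x y z. h' (comb x y z) = hv D G x y z"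
    by (rule dehomogenize[OF W(4)]) (rule that)
  obtain U where U: "wle 1 1 D U" "\<And>x y z. h (comb x y z) = hv D U x y z"
    by (rule dehomogenize[OF W(3)]) (rule that)
  have ev: "h' (coords (\<phi> P)) = cz (coords (\<phi> P)) ^ D * ev2 G (xx P) (yy P)"
    "h (coords (\<phi> P)) = cz (coords (\<phi> P)) ^ D * ev2 U (xx P) (yy P)" if "P \<in> S" for P
    using that G(2)[of "cx (coords (\<phi> P))" "cy (coords (\<phi> P))" "cz (coords (\<phi> P))"]
      U(2)[of "cx (coords (\<phi> P))" "cy (coords (\<phi> P))" "cz (coords (\<phi> P))"]
    by (simp_all only: comb_coords xx_def yy_def) (simp_all add: S_def hv_nonzero[OF _ G(1)] hv_nonzero[OF _ U(1)])
  have W_dom: "W \<subseteq> dom g" using openin_imp_subset[OF W(1)] .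
  have WC: "openin (top_of_set C) W" by (rule openin_trans[OF W(1) rat_repsD(1)[OF g]])
  have local: "ev2 G (xx P) (yy P) * yt P = ev2 U (xx P) (yy P)" if "P \<in> {P \<in> S. \<phi> P \<in> W}" for P
  proof -
    have P: "P \<in> S" "\<phi> P \<in> W" using that by auto
    have z: "cz (coords (\<phi> P)) ^ D \<noteq> 0" using P(1) by (simp add: S_def)
    have "yt P = h (coords (\<phi> P)) / h' (coords (\<phi> P))"
      using yt_g[OF P(1)] W(6)[OF P(2)] W_dom P(2) by auto
    then have "h' (coords (\<phi> P)) * yt P = h (coords (\<phi> P))" using W(5)[OF P(2)] by simp
    then have "cz (coords (\<phi> P)) ^ D * (ev2 G (xx P) (yy P) * yt P) = cz (coords (\<phi> P)) ^ D * ev2 U (xx P) (yy P)"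
      unfolding ev[OF P(1)] by (simp only: mult.assoc)
    then show ?thesis by (rule iffD1[OF mult_left_cancel[OF z]])
  qed
  have nW: "{P \<in> S. \<phi> P \<in> W} \<noteq> {}" using P0(1) W(2) by blast
  have all: "ev2 G (xx P) (yy P) * yt P = ev2 U (xx P) (yy P)" if "P \<in> S" for P
    by (rule regular_on_eq[OF X openin_S _ _ meets_S(1)[OF WC] nW _ local that])
      (use W(2) in \<open>auto intro!: regular_on_mult regular_on_ev2 regular_coordinates\<close>)
  have "\<not> f dvd G"
  proof
    assume "f dvd G"
    then obtain q where "G = f * q" by (rule dvdE)
    then have "ev2 G (xx P0) (yy P0) = 0" using f_on_S(1)[OF P0(1)] by simp
    then show False using W(5)[OF W(2)] ev(1)[OF P0(1)] by simp
  qed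
  then show ?thesis by (intro exI[of _ G] exI[of _ U] conjI ballI all)
qed

lemma cx_Q3: "cx (coords (\<phi> P3)) = 0"
  using xx_\<sigma>[OF P2_in_S] P2_in_S P2 coords_q by (simp add: xx_def S_def)

lemma y_affine: "\<exists>r. \<forall>P\<in>S. yt P + \<alpha> * xx P + \<beta> = r * yy P"
proof -
  obtain c where c: "c \<noteq> 0" "cf f d 0 = c"
    by (rule f_top_coeffs) (rule that)
  obtain c2 h2 where h2: "c2 \<noteq> 0" "ev2 h2 0 0 \<noteq> 0" "\<And>x y. ev2 f x y = c2 * x ^ d + y * ev2 h2 x y"
    by (rule f_at_Q2) (rule that)
  obtain c3 h3 where h3: "c3 \<noteq> 0" "ev2 h3 0 (- \<beta>) \<noteq> 0"
    "\<And>x y. ev2 f x y = c3 * x ^ d + (y + \<alpha> * x + \<beta>) * ev2 h3 x y"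
    by (rule f_at_Q3[OF cx_Q3]) (rule that)
  \<comment> \<open>The algebraic core counts with e = d - 1, and d \<ge> 2 makes e
    positive.\<close>
  have d: "Suc (d - 1) = d" "d - 1 > 0" using d_ge_2 by simp_all
  have p2: "xx P2 = 0" "yy P2 = 0" "yt P2 = - \<beta>"
    using P2 coords_q Q3_affine[OF cx_Q3] by (simp_all add: xx_def yy_def yt_def)
  have "plane_model f h2 h3 (d - 1) (cf f 0 (d - 1)) c c2 c3 \<alpha> \<beta> S {u. regular_on S u} xx yy yt P2"
  proof (rule plane_model.intro)
    show "ev2 f x y = c2 * x ^ Suc (d - 1) + y * ev2 h2 x y" for x y
      unfolding d(1) by (rule h2(3))
    show "ev2 f x y = c3 * x ^ Suc (d - 1) + (y + \<alpha> * x + \<beta>) * ev2 h3 x y" for x y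
      unfolding d(1) by (rule h3(3))
    show "cf f (Suc (d - 1)) 0 = c" unfolding d(1) by (rule c(2))
    show "i + j \<le> d - 1 \<or> i = Suc (d - 1) \<and> j = 0" if "cf f i j \<noteq> 0" for i j
      unfolding d(1) by (rule f_rest[OF that])
    show "(\<lambda>P. u P + v P) \<in> {u. regular_on S u}" "(\<lambda>P. u P * v P) \<in> {u. regular_on S u}"
      if "u \<in> {u. regular_on S u}" "v \<in> {u. regular_on S u}" for u v
      using that by (simp_all add: regular_on_add regular_on_mult)
    show "(\<forall>P\<in>S. u P = 0) \<or> (\<forall>P\<in>S. v P = 0)"
      if "u \<in> {u. regular_on S u}" "v \<in> {u. regular_on S u}" "\<forall>P\<in>S. u P * v P = 0" for u v
      by (rule regular_on_domain[OF X openin_S]) (use that in auto)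
    show "ev2 f (xx P) (yy P) = 0" "ev2 f (xx P) (yt P) = 0" if "P \<in> S" for P
      by (rule f_on_S[OF that])+
    show "\<exists>G U. \<not> f dvd G \<and> (\<forall>P\<in>S. ev2 G (xx P) (yy P) * yt P = ev2 U (xx P) (yy P))"
      by (rule yt_rational)
    show "f dvd a" if "\<And>P. P \<in> S \<Longrightarrow> ev2 a (xx P) (yy P) = 0" for a
      by (rule f_dvd[OF that])
    show "d - 1 > 0" by (rule d(2))
    show "cf f 0 (d - 1) \<noteq> 0" by (rule f_y_coeff)
  qed (simp_all add: regular_on_const regular_coordinates c h2(1,2) h3(1,2) P2_in_S p2)
  then show ?thesis by (rule plane_model.translate_proportional)
qed

text \<open>\<sigma> maps X onto itself and the image curve is not contained in the tangent line at
  Q_3, so the pulled back condition defines a nonempty open set, which meets \<open>S\<close>. This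
  serves to exclude that y' + \<alpha> x + \<beta> vanishes on \<open>S\<close>.\<close>

lemma L3_not_zero_on_S: "\<exists>P\<in>S. mp_eval L3 (coords (\<phi> (\<sigma> P))) \<noteq> 0"
proof -
  let ?V = "{R. mp_eval L3 (coords R) \<noteq> 0}"
  obtain R where R: "R \<in> C" "mp_eval L3 (coords R) \<noteq> 0"
    using I3.not_line[OF form_funI[OF I3.L(1)] I3.L_nonzero] by blast
  from R(1) obtain P' where P': "R = \<phi> P'" "P' \<in> X" by (rule imageE)
  then have "P' \<in> \<sigma> ` X" by (simp only: \<sigma>(2))
  then obtain P where P: "P' = \<sigma> P" "P \<in> X" by (rule imageE)
  have "openin (top_of_set X) {P \<in> X. \<phi> (\<sigma> P) \<in> ?V}"
    by (rule morphism_openin_preimage[OF \<phi>\<sigma> open_form_nonzero[OF form_funI[OF I3.L(1)]]])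
  moreover have "P \<in> {P \<in> X. \<phi> (\<sigma> P) \<in> ?V}" using P P'(1) R(2) by simp
  ultimately have "S \<inter> {P \<in> X. \<phi> (\<sigma> P) \<in> ?V} \<noteq> {}"
    using P2_in_S by (intro openin_inter_nonempty[OF X openin_S]) auto
  then show ?thesis by blast
qed

theorem linear_extension:
  "\<exists>M :: 'k ^ 3 ^ 3. invertible M \<and> proj_map M ` C = C \<and> (\<forall>P\<in>X. proj_map M (\<phi> P) = \<phi> (\<sigma> P))"
proof -
  obtain r where r: "\<forall>P\<in>S. yt P + \<alpha> * xx P + \<beta> = r * yy P"
    by (rule exE[OF y_affine])
  \<comment> \<open>With r = 0 the points \<sigma>(P) for P in \<open>S\<close> would all map into
    the tangent line at Q_3, and the matrix constructed next would be singular.\<close>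
  have "r \<noteq> 0"
  proof
    assume "r = 0"
    obtain P where P: "P \<in> S" "mp_eval L3 (coords (\<phi> (\<sigma> P))) \<noteq> 0"
      using L3_not_zero_on_S by blast
    let ?w = "coords (\<phi> (\<sigma> P))"
    have z: "cz ?w \<noteq> 0" using P(1) by (simp add: S_def)
    have "cy ?w / cz ?w + \<alpha> * (cx ?w / cz ?w) + \<beta> = 0"
      using r P(1) \<open>r = 0\<close> xx_\<sigma>[OF P(1)] by (simp add: yt_def)
    then have "cy ?w + \<alpha> * cx ?w + \<beta> * cz ?w = 0"
      using z by (simp add: field_simps)
    then have "mp_eval L3 (comb (cx ?w) (cy ?w) (cz ?w)) = 0"
      unfolding L3_comb by simp
    then show False using P(2) by (simp add: comb_coords)
  qed
  \<comment> \<open>The homogenized substitution (x, y, z) to (x, r y - \<alpha> x - \<beta> z, z)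
    in the coordinates of the frame; \<open>M\<close> is the same map in standard
    coordinates.\<close>
  define N :: "'k ^ 3 ^ 3" where "N = (\<chi> i j. if i = 2 then (if j = 1 then - \<alpha> else if j = 2 then r else - \<beta>)
    else if i = j then 1 else 0)"
  define M where "M = frame_matrix ** (N ** coord_matrix)"
  have N: "(N *v u) $ 1 = u $ 1" "(N *v u) $ 2 = r * u $ 2 - \<alpha> * u $ 1 - \<beta> * u $ 3" "(N *v u) $ 3 = u $ 3" for u
    by (simp_all add: N_def matrix_vector_mult_def sum_3)
  have M: "M *v v = comb (cx v) (r * cy v - \<alpha> * cx v - \<beta> * cz v) (cz v)" for v
    by (simp add: M_def frame_matrix_mult N flip: matrix_vector_mul_assoc)
  have ker: "v = 0" if "M *v v = 0" for v
  proof -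
    have c: "cx v = 0 \<and> r * cy v - \<alpha> * cx v - \<beta> * cz v = 0 \<and> cz v = 0"
      by (rule independent) (use that in \<open>simp only: M comb_def\<close>)
    then have "r * cy v - \<alpha> * 0 - \<beta> * 0 = 0" by metis
    then have "cy v = 0" using \<open>r \<noteq> 0\<close> by simp
    then have "comb (cx v) (cy v) (cz v) = 0" using c by (simp add: comb_def)
    then show ?thesis by (simp only: comb_coords)
  qed
  have inv: "invertible M"
    unfolding invertible_left_inverse matrix_left_invertible_ker using ker by blast
  have nz: "M *v coords P \<noteq> 0" for P
    using ker coords_nonzero by blast
  have on_S: "proj_map M (\<phi> P) = \<phi> (\<sigma> P)" if P: "P \<in> S" for P
  proof -
    let ?v = "coords (\<phi> P)" and ?w = "coords (\<phi> (\<sigma> P))"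
    have z: "cz ?v \<noteq> 0" "cz ?w \<noteq> 0" using P by (simp_all add: S_def)
    have cx: "cx ?w = cz ?w / cz ?v * cx ?v"
      using xx_\<sigma>[OF P] z by (simp add: xx_def field_simps)
    have "yt P = r * yy P - \<alpha> * xx P - \<beta>"
      using r[rule_format, OF P] by (simp add: algebra_simps eq_diff_eq)
    then have cy: "cy ?w = cz ?w / cz ?v * (r * cy ?v - \<alpha> * cx ?v - \<beta> * cz ?v)"
      using z by (simp add: xx_def yy_def yt_def field_simps)
    have cz: "cz ?w = cz ?w / cz ?v * cz ?v" using z by simp
    have "?w = comb (cx ?w) (cy ?w) (cz ?w)" by (simp only: comb_coords)
    also have "\<dots> = comb (cz ?w / cz ?v * cx ?v) (cz ?w / cz ?v * (r * cy ?v - \<alpha> * cx ?v - \<beta> * cz ?v))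
        (cz ?w / cz ?v * cz ?v)"
      by (rule arg_cong3[of _ _ _ _ _ _ comb, OF cx cy cz])
    also have "\<dots> = (cz ?w / cz ?v) *s (M *v ?v)"
      by (simp only: M comb_scale)
    finally have "point ?w = point ((cz ?w / cz ?v) *s (M *v ?v))"
      by (rule arg_cong)
    then show ?thesis
      using point_scale[of "cz ?w / cz ?v" "M *v ?v"] z nz[of "\<phi> P"] by (simp add: proj_map_coords)
  qed
  \<comment> \<open>Both sides are morphisms on X that agree on the nonempty open set
    \<open>S\<close>, so they agree everywhere, including the points over infinity.\<close>
  have mor: "morphism X UNIV (\<lambda>P. proj_map M (\<phi> P))"
    by (rule morphism_compose[OF \<phi> morphism_proj_map[OF nz]])
  have ne: "S \<noteq> {}" using P2_in_S by blast
  have ext: "proj_map M (\<phi> P) = \<phi> (\<sigma> P)" if "P \<in> X" for P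
    by (rule morphisms_eq[OF X mor \<phi>\<sigma> openin_S ne on_S that])
  have "proj_map M ` C = (\<lambda>P. \<phi> (\<sigma> P)) ` X"
    unfolding image_image using ext by (rule image_cong[OF refl])
  also have "\<dots> = \<phi> ` (\<sigma> ` X)" by (simp only: image_image)
  also have "\<dots> = C" by (simp only: \<sigma>(2))
  finally show ?thesis using inv ext by blast
qed

end

text \<open>Q1 need not be Q: the dominance of the projection from any one inner Galois point shows
  that \<open>C\<close> is not contained in a line, which is \<open>not_line\<close> for every
  Q.\<close>

lemma inflection_point_of:
  fixes C :: "('k::alg_closed_field, 3) proj set"
  assumes "inner_galois_point C Q1" and Q: "total_inflection_point C Q" "Q \<in> C"
  obtains d F L where "inflection_point C Q d F L"
proof -
  obtain A where A: "projection_from Q1 A" "closure (proj_map A ` (C - {Q1})) = UNIV" and Q1: "Q1 \<in> C"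
    using assms(1) unfolding inner_galois_point_def galois_point_def by blast
  obtain d F L where "defining_form C d F" "defining_form (tangent_line C Q) 1 L" "intersection_mult F L Q d"
    using Q(1) unfolding total_inflection_point_def by blast
  then have "inflection_point C Q d F L"
    unfolding defining_form_def
    using Q(2) dominant_projection_not_line[OF Q1 A] by (intro inflection_point.intro) blast+
  then show ?thesis by (rule that)
qed

theorem corollary1:
  fixes X :: "('k::alg_closed_field, 'n::finite) proj set"
    and \<phi> :: "('k, 'n) proj \<Rightarrow> ('k, 3) proj"
    and P1 P2 P3 :: "('k, 'n) proj"
    and \<sigma> :: "('k, 'n) proj \<Rightarrow> ('k, 'n) proj"
  assumes "smooth_curve X"
    and "morphism X UNIV \<phi>"
    and "birational_onto_image X \<phi>"
    and "P1 \<in> X" "P2 \<in> X" "P3 \<in> X"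
    and "inner_galois_point (\<phi> ` X) (\<phi> P1)"
    and "inner_galois_point (\<phi> ` X) (\<phi> P2)"
    and "inner_galois_point (\<phi> ` X) (\<phi> P3)"
    and "\<phi> P1 \<noteq> \<phi> P2" "\<phi> P1 \<noteq> \<phi> P3" "\<phi> P2 \<noteq> \<phi> P3"
    and "\<sigma> \<in> point_group X \<phi> (\<phi> P1)"
    and "\<sigma> P2 = P3"
    and "total_inflection_point (\<phi> ` X) (\<phi> P1)"
    and "total_inflection_point (\<phi> ` X) (\<phi> P2)"
    and "total_inflection_point (\<phi> ` X) (\<phi> P3)"
  shows "\<exists>A :: 'k ^ 3 ^ 3. invertible A \<and> proj_map A ` (\<phi> ` X) = \<phi> ` X \<and>
    (\<forall>P\<in>X. proj_map A (\<phi> P) = \<phi> (\<sigma> P))"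
proof -
  have X: "zariski_irreducible X"
    using assms(1) by (simp add: smooth_curve_def curve_def variety_def)
  note \<phi> = assms(2)
  have C: "zariski_irreducible (\<phi> ` X)"
    by (rule irreducible_image[OF \<phi> X])
  obtain d F L1 where I1: "inflection_point (\<phi> ` X) (\<phi> P1) d F L1"
    by (rule inflection_point_of[OF assms(7) assms(15) imageI[OF assms(4)]])
  obtain d2 F2 L2 where I2: "inflection_point (\<phi> ` X) (\<phi> P2) d2 F2 L2"
    by (rule inflection_point_of[OF assms(7) assms(16) imageI[OF assms(5)]])
  obtain d3 F3 L3 where I3: "inflection_point (\<phi> ` X) (\<phi> P3) d3 F3 L3"
    by (rule inflection_point_of[OF assms(7) assms(17) imageI[OF assms(6)]])
  obtain v0 f a2 a3 where conf:
    "inflection_configuration (\<phi> ` X) (\<phi> P1) (\<phi> P2) (\<phi> P3) d F L1 F2 L2 F3 L3 v0 f a2 a3"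
    by (rule configuration_exists[OF C I1 I2 I3 assms(10-12)])
  obtain A \<tau> where A: "projection_from (\<phi> P1) A"
    and \<tau>: "\<tau> \<in> galois_group (function_field (\<phi> ` X)) (projection_subfield (\<phi> ` X) A (\<phi> P1))"
    and comm: "\<forall>a\<in>carrier (function_field (\<phi> ` X)).
      pullback X X \<sigma> (pullback X X \<phi> a) = pullback X X \<phi> (\<tau> a)"
    and aut: "\<sigma> \<in> automorphisms X"
    using assms(13) unfolding point_group_def by blast
  obtain \<rho> where \<sigma>: "morphism X X \<sigma>" and \<rho>: "morphism X X \<rho>" "\<forall>P\<in>X. \<rho> (\<sigma> P) = P \<and> \<sigma> (\<rho> P) = P"
    using aut unfolding automorphisms_def by blast
  have into: "\<sigma> P \<in> X" "\<rho> P \<in> X" if "P \<in> X" for P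
    using \<sigma> \<rho>(1) that unfolding morphism_def by blast+
  have surj: "\<sigma> ` X = X"
  proof
    show "\<sigma> ` X \<subseteq> X" using into(1) by blast
    show "X \<subseteq> \<sigma> ` X"
    proof
      fix P assume "P \<in> X"
      then have "P = \<sigma> (\<rho> P)" using \<rho>(2) by simp
      then show "P \<in> \<sigma> ` X" using into(2)[OF \<open>P \<in> X\<close>] by (rule image_eqI)
    qed
  qed
  have "galois_configuration X \<phi> P1 P2 P3 d F L1 F2 L2 F3 L3 v0 f a2 a3 \<sigma> A \<tau>"
    by (intro galois_configuration.intro galois_configuration_axioms.intro
        conf X \<phi> \<sigma> surj assms(5,14) A \<tau> comm)
  then show ?thesis by (rule galois_configuration.linear_extension)
qed

end
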